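(* Let $k$ be a field of characteristic $0$ containing all roots of unity, let $H\subseteq G$ be an inclusion of finite groups, let $\mathcal V$ be a $k$-linear category, and let $\rho$ be an action of $H$ on $\mathcal V$ (a 2-representation by $k$-linear functors). Then the categorical trace takes the induced 2-representation to the induced representation of inertia groupoids; that is, there is an isomorphism $$\mathbb{T}r\big(\mathrm{ind}|_H^G\,\rho\big)\;\cong\;\mathrm{ind}|_{\Lambda(H)}^{\Lambda(G)}\big(\mathbb{T}r(\rho)\big)$$ of representations of the groupoid $\Lambda(G)$.
   Context: Group actions. An action (2-representation) $\rho$ of a group $G$ on a category $\mathcal V$ consists of functors $\rho(g):\mathcal V\to\mathcal V$ ($g\in G$), natural isomorphisms $\phi_{g,h}:\rho(g)\circ\rho(h)\Rightarrow\rho(gh)$ ($g,h\in G$) and $\phi_1:\rho(1)\Rightarrow \mathrm{id}_{\mathcal V}$ such that for all $g,h,l\in G$: $\phi_{gh,l}\,(\phi_{g,h}\circ\rho(l))=\phi_{g,hl}\,(\rho(g)\circ\phi_{h,l})$ (this common value is denoted $\phi_{g,h,l}:\rho(g)\rho(h)\rho(l)\Rightarrow\rho(ghl)$), $\phi_{1,g}=\phi_1\circ\rho(g)$ and $\phi_{g,1}=\rho(g)\circ\phi_1$. When $\mathcal V$ is $k$-linear all $\rho(g)$ are $k$-linear functors. Categorical trace. For an endofunctor $A:\mathcal V\to\mathcal V$, $\mathbb{T}r(A)=NT(\mathrm{id}_{\mathcal V},A)$, the set of natural transformations from the identity functor to $A$; if $\mathcal V$ is $k$-linear this is a $k$-vector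 space. Inertia groupoid. For a group $G$, $\Lambda(G)$ is the groupoid whose objects are the elements of $G$ and $\mathrm{Hom}_{\Lambda(G)}(u,v)=\{g\in G: v=gug^{-1}\}$, with composition given by multiplication in $G$. A representation of a groupoid over $k$ is a functor from it to $k$-vector spaces. The inclusion $H\subseteq G$ induces a functor $\Lambda(H)\to\Lambda(G)$. Categorical character. For an action $\rho$ of $G$ on a $k$-linear category, $\mathbb{T}r(\rho)$ is the representation of $\Lambda(G)$ given on objects by $f\mapsto\mathbb{T}r(\rho(f))$ and on the morphism $g: f\to gfg^{-1}$ by the linear isomorphism $\psi_f(g):\mathbb{T}r(\rho(f))\to\mathbb{T}r(\rho(gfg^{-1}))$ sending $\xi:\mathrm{id}\Rightarrow\rho(f)$ to the composite $$\mathrm{id}\xrightarrow{\phi_{g,g^{-1}}^{-1}\phi_1^{-1}}\rho(g)\rho(g^{-1})\xrightarrow{\rho(g)\circ\xi\circ\rho(g^{-1})}\rho(g)\rho(f)\rho(g^{-1})\xrightarrow{\phi_{g,f,g^{-1}}}\rho(gfg^{-1}).$$ Induced groupoid representation. For a finite groupoid $\Gamma$, the groupoid algebra $k[\Gamma]$ has a basis $e_g$ indexed by the morphisms $g$ of $\Gamma$, with $e_ge_h=e_{gh}$ if $g,h$ are composable and $0$ otherwise; representations of $\Gamma$ are the same as $k[\Gamma]$-modules. For a representation $\pi$ of $\Lambda(H)$, $\mathrm{ind}|_{\Lambda(H)}^{\Lambda(G)}\pi=k[\Lambda(G)]\otimes_{k[\Lambda(H)]}\pi$. Induced 2-representation.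 Given an action $\rho$ of $H$ on $\mathcal V$, $\mathrm{ind}|_H^G(\mathcal V)$ is the category whose objects are maps $f:G\to\mathrm{Ob}\,\mathcal V$ together with isomorphisms $u_{g,h}:f(gh)\to\rho(h^{-1})(f(g))$ for all $g\in G$, $h\in H$, such that $u_{g,1}=\phi_{1,f(g)}^{-1}$ and, for all $g\in G$, $h_1,h_2\in H$, $$u_{g,h_1h_2}=\phi_{h_2^{-1},h_1^{-1}}\circ\rho(h_2^{-1})(u_{g,h_1})\circ u_{gh_1,h_2}:\ f(gh_1h_2)\to\rho((h_1h_2)^{-1})(f(g)).$$ A morphism $(f,u)\to(f',u')$ is a system of morphisms $f(g)\to f'(g)$, $g\in G$, commuting with the $u_{g,h}$ and $u'_{g,h}$. The group $G$ acts on the left on this category (strictly) by $(\sigma(g_1)f)(g)=f(g_1^{-1}g)$, $(\sigma(g_1)u)_{g,h}=u_{g_1^{-1}g,h}$. This 2-representation of $G$ is denoted $\mathrm{ind}|_H^G\,\rho$. *)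

theory Defs
  imports
    "HOL-Algebra.Module"
    "HOL-Algebra.Generated_Groups"
    "HOL-Algebra.Free_Abelian_Groups"
    "HOL-Algebra.Polynomial_Divisibility"
begin

definition char_zero :: "('k, 'r) ring_scheme \<Rightarrow> bool" where
  "char_zero K \<longleftrightarrow> (\<forall>n::nat. n > 0 \<longrightarrow> [n] \<cdot>\<^bsub>K\<^esub> \<one>\<^bsub>K\<^esub> \<noteq> \<zero>\<^bsub>K\<^esub>)"

text \<open>All roots of unity of an algebraic closure lie in \<open>K\<close> iff every \<open>X^n - 1\<close> with \<open>n > 0\<close>
  splits over \<open>K\<close>; the latter does not mention a closure.\<close>

definition contains_roots_of_unity :: "('k, 'r) ring_scheme \<Rightarrow> bool" where
  "contains_roots_of_unity K \<longleftrightarrow>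
     (\<forall>n::nat. n > 0 \<longrightarrow>
        ring.splitted K
          (X\<^bsub>K\<^esub> [^]\<^bsub>poly_ring K\<^esub> n \<ominus>\<^bsub>poly_ring K\<^esub> \<one>\<^bsub>poly_ring K\<^esub>))"

definition linear_maps ::
  "('k, 'r) ring_scheme \<Rightarrow> ('k, 'v, 's) module_scheme \<Rightarrow> ('k, 'w, 't) module_scheme \<Rightarrow> ('v \<Rightarrow> 'w) set"
where
  "linear_maps K M N =
     {h \<in> carrier M \<rightarrow> carrier N.
        (\<forall>v\<in>carrier M. \<forall>w\<in>carrier M. h (v \<oplus>\<^bsub>M\<^esub> w) = h v \<oplus>\<^bsub>N\<^esub> h w) \<and>
        (\<forall>c\<in>carrier K. \<forall>v\<in>carrier M. h (c \<odot>\<^bsub>M\<^esub> v) = c \<odot>\<^bsub>N\<^esub> h v)}"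

record ('o, 'a) category =
  Obj :: "'o set"
  Arr :: "'a set"
  Dom :: "'a \<Rightarrow> 'o"
  Cod :: "'a \<Rightarrow> 'o"
  Ide :: "'o \<Rightarrow> 'a"
  Cmp :: "'a \<Rightarrow> 'a \<Rightarrow> 'a"  (infixr \<open>\<cdot>\<index>\<close> 70)

definition homs :: "('o, 'a, 'z) category_scheme \<Rightarrow> 'o \<Rightarrow> 'o \<Rightarrow> 'a set" where
  "homs C x y = {a \<in> Arr C. Dom C a = x \<and> Cod C a = y}"

locale category =
  fixes C :: "('o, 'a, 'z) category_scheme" (structure)
  assumes Dom_closed: "a \<in> Arr C \<Longrightarrow> Dom C a \<in> Obj C"
    and Cod_closed: "a \<in> Arr C \<Longrightarrow> Cod C a \<in> Obj C"
    and Ide_closed: "x \<in> Obj C \<Longrightarrow> Ide C x \<in> homs C x x"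
    and Cmp_closed: "\<lbrakk>a \<in> homs C x y; b \<in> homs C y z\<rbrakk> \<Longrightarrow> b \<cdot> a \<in> homs C x z"
    and Cmp_assoc: "\<lbrakk>a \<in> homs C w x; b \<in> homs C x y; c \<in> homs C y z\<rbrakk> \<Longrightarrow> (c \<cdot> b) \<cdot> a = c \<cdot> (b \<cdot> a)"
    and Ide_left: "a \<in> homs C x y \<Longrightarrow> Ide C y \<cdot> a = a"
    and Ide_right: "a \<in> homs C x y \<Longrightarrow> a \<cdot> Ide C x = a"

definition inverse_arrows :: "('o, 'a, 'z) category_scheme \<Rightarrow> 'a \<Rightarrow> 'a \<Rightarrow> bool" where
  "inverse_arrows C a b \<longleftrightarrow>
     a \<in> Arr C \<and> b \<in> homs C (Cod C a) (Dom C a) \<and>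
     b \<cdot>\<^bsub>C\<^esub> a = Ide C (Dom C a) \<and> a \<cdot>\<^bsub>C\<^esub> b = Ide C (Cod C a)"

definition isos :: "('o, 'a, 'z) category_scheme \<Rightarrow> 'o \<Rightarrow> 'o \<Rightarrow> 'a set" where
  "isos C x y = {a \<in> homs C x y. \<exists>b. inverse_arrows C a b}"

definition inverse_arrow :: "('o, 'a, 'z) category_scheme \<Rightarrow> 'a \<Rightarrow> 'a" where
  "inverse_arrow C a = (THE b. inverse_arrows C a b)"

locale groupoid = category C for C :: "('o, 'a, 'z) category_scheme" (structure) +
  assumes all_isos: "a \<in> Arr C \<Longrightarrow> \<exists>b. inverse_arrows C a b"

record ('o, 'a, 'p, 'b) cat_functor =
  omap :: "'o \<Rightarrow> 'p"
  amap :: "'a \<Rightarrow> 'b"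

locale cat_functor = dom: category C + cod: category D
  for C :: "('o, 'a, 'z) category_scheme" and D :: "('p, 'b, 'y) category_scheme" +
  fixes F :: "('o, 'a, 'p, 'b) cat_functor"
  assumes omap_closed: "x \<in> Obj C \<Longrightarrow> omap F x \<in> Obj D"
    and amap_closed: "a \<in> homs C x y \<Longrightarrow> amap F a \<in> homs D (omap F x) (omap F y)"
    and amap_Ide: "x \<in> Obj C \<Longrightarrow> amap F (Ide C x) = Ide D (omap F x)"
    and amap_Cmp: "\<lbrakk>a \<in> homs C x y; b \<in> homs C y z\<rbrakk> \<Longrightarrow>
      amap F (b \<cdot>\<^bsub>C\<^esub> a) = amap F b \<cdot>\<^bsub>D\<^esub> amap F a"

definition id_functor :: "('o, 'a, 'o, 'a) cat_functor" where
  "id_functor = \<lparr>omap = (\<lambda>x. x), amap = (\<lambda>a. a)\<rparr>"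

definition comp_functor ::
  "('p, 'b, 'q, 'c) cat_functor \<Rightarrow> ('o, 'a, 'p, 'b) cat_functor \<Rightarrow> ('o, 'a, 'q, 'c) cat_functor"
  (infixl \<open>\<circ>\<circ>\<close> 55)
where
  "F \<circ>\<circ> E = \<lparr>omap = (\<lambda>x. omap F (omap E x)), amap = (\<lambda>a. amap F (amap E a))\<rparr>"

text \<open>A natural transformation is identified with its family of components, made extensional
  on the objects so that equality of transformations is equality of functions.\<close>

definition nat_trans ::
  "('o, 'a, 'z) category_scheme \<Rightarrow> ('p, 'b, 'y) category_scheme \<Rightarrow>
   ('o, 'a, 'p, 'b) cat_functor \<Rightarrow> ('o, 'a, 'p, 'b) cat_functor \<Rightarrow> ('o \<Rightarrow> 'b) set"
where
  "nat_trans C D E F =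
     {\<eta> \<in> (\<Pi>\<^sub>E x\<in>Obj C. homs D (omap E x) (omap F x)).
        \<forall>a\<in>Arr C. amap F a \<cdot>\<^bsub>D\<^esub> \<eta> (Dom C a) = \<eta> (Cod C a) \<cdot>\<^bsub>D\<^esub> amap E a}"

definition nat_isos ::
  "('o, 'a, 'z) category_scheme \<Rightarrow> ('p, 'b, 'y) category_scheme \<Rightarrow>
   ('o, 'a, 'p, 'b) cat_functor \<Rightarrow> ('o, 'a, 'p, 'b) cat_functor \<Rightarrow> ('o \<Rightarrow> 'b) set"
where
  "nat_isos C D E F =
     {\<eta> \<in> nat_trans C D E F. \<forall>x\<in>Obj C. \<eta> x \<in> isos D (omap E x) (omap F x)}"

record ('o, 'a, 'k) linear_category = "('o, 'a) category" +
  Zero :: "'o \<Rightarrow> 'o \<Rightarrow> 'a"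
  Add :: "'a \<Rightarrow> 'a \<Rightarrow> 'a"
  Scal :: "'k \<Rightarrow> 'a \<Rightarrow> 'a"

text \<open>Vector spaces are modules over a field. The fields \<open>mult\<close> and \<open>one\<close> of a module
  record play no role in the locale \<open>module\<close>.\<close>

definition hom_space :: "('o, 'a, 'k, 'z) linear_category_scheme \<Rightarrow> 'o \<Rightarrow> 'o \<Rightarrow> ('k, 'a) module" where
  "hom_space C x y =
     \<lparr>carrier = homs C x y, monoid.mult = undefined, one = undefined,
      zero = Zero C x y, add = Add C, smult = Scal C\<rparr>"

locale linear_category = field K + category C
  for K :: "('k, 'r) ring_scheme" and C :: "('o, 'a, 'k, 'z) linear_category_scheme" +
  assumes hom_space: "\<lbrakk>x \<in> Obj C; y \<in> Obj C\<rbrakk> \<Longrightarrow> module K (hom_space C x y)"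
    and Cmp_linear_left:
      "\<lbrakk>a \<in> homs C x y; z \<in> Obj C\<rbrakk> \<Longrightarrow>
        (\<lambda>b. b \<cdot>\<^bsub>C\<^esub> a) \<in> linear_maps K (hom_space C y z) (hom_space C x z)"
    and Cmp_linear_right:
      "\<lbrakk>b \<in> homs C y z; x \<in> Obj C\<rbrakk> \<Longrightarrow>
        (\<lambda>a. b \<cdot>\<^bsub>C\<^esub> a) \<in> linear_maps K (hom_space C x y) (hom_space C x z)"

locale linear_functor = cat_functor C D F + dom: linear_category K C + cod: linear_category K D
  for K :: "('k, 'r) ring_scheme"
    and C :: "('o, 'a, 'k, 'z) linear_category_scheme"
    and D :: "('p, 'b, 'k, 'y) linear_category_scheme"
    and F :: "('o, 'a, 'p, 'b) cat_functor" +
  assumes amap_linear: "\<lbrakk>x \<in> Obj C; y \<in> Obj C\<rbrakk> \<Longrightarrow>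
    amap F \<in> linear_maps K (hom_space C x y) (hom_space D (omap F x) (omap F y))"

record ('g, 'o, 'a) action =
  act :: "'g \<Rightarrow> ('o, 'a, 'o, 'a) cat_functor"
  act_mult :: "'g \<Rightarrow> 'g \<Rightarrow> 'o \<Rightarrow> 'a"
  act_one :: "'o \<Rightarrow> 'a"

text \<open>\<open>act_mult \<rho> g h\<close> and \<open>act_one \<rho>\<close> are the natural isomorphisms
  \<open>\<phi>\<^bsub>g,h\<^esub> : \<rho>(g) \<rho>(h) \<Rightarrow> \<rho>(gh)\<close> and \<open>\<phi>\<^sub>1 : \<rho>(1) \<Rightarrow> id\<close>.\<close>

locale linear_action = group G + linear_category K C
  for K :: "('k, 'r) ring_scheme" and G :: "('g, 's) monoid_scheme"
    and C :: "('o, 'a, 'k, 'z) linear_category_scheme" +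
  fixes \<rho> :: "('g, 'o, 'a) action"
  assumes act_functor: "g \<in> carrier G \<Longrightarrow> linear_functor K C C (act \<rho> g)"
    and act_mult_iso: "\<lbrakk>g \<in> carrier G; h \<in> carrier G\<rbrakk> \<Longrightarrow>
      act_mult \<rho> g h \<in> nat_isos C C (act \<rho> g \<circ>\<circ> act \<rho> h) (act \<rho> (g \<otimes>\<^bsub>G\<^esub> h))"
    and act_one_iso: "act_one \<rho> \<in> nat_isos C C (act \<rho> \<one>\<^bsub>G\<^esub>) id_functor"
    and act_assoc: "\<lbrakk>g \<in> carrier G; h \<in> carrier G; l \<in> carrier G; x \<in> Obj C\<rbrakk> \<Longrightarrow>
      act_mult \<rho> (g \<otimes>\<^bsub>G\<^esub> h) l x \<cdot>\<^bsub>C\<^esub> act_mult \<rho> g h (omap (act \<rho> l) x) =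
      act_mult \<rho> g (h \<otimes>\<^bsub>G\<^esub> l) x \<cdot>\<^bsub>C\<^esub> amap (act \<rho> g) (act_mult \<rho> h l x)"
    and act_one_left: "\<lbrakk>g \<in> carrier G; x \<in> Obj C\<rbrakk> \<Longrightarrow>
      act_mult \<rho> \<one>\<^bsub>G\<^esub> g x = act_one \<rho> (omap (act \<rho> g) x)"
    and act_one_right: "\<lbrakk>g \<in> carrier G; x \<in> Obj C\<rbrakk> \<Longrightarrow>
      act_mult \<rho> g \<one>\<^bsub>G\<^esub> x = amap (act \<rho> g) (act_one \<rho> x)"

definition act_mult3 ::
  "('g, 's) monoid_scheme \<Rightarrow> ('o, 'a, 'z) category_scheme \<Rightarrow> ('g, 'o, 'a) action \<Rightarrow>
   'g \<Rightarrow> 'g \<Rightarrow> 'g \<Rightarrow> 'o \<Rightarrow> 'a"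
where
  "act_mult3 G C \<rho> g h l x =
     act_mult \<rho> (g \<otimes>\<^bsub>G\<^esub> h) l x \<cdot>\<^bsub>C\<^esub> act_mult \<rho> g h (omap (act \<rho> l) x)"

record ('o, 'a, 'k, 'v) representation =
  space :: "'o \<Rightarrow> ('k, 'v) module"
  rmap :: "'a \<Rightarrow> 'v \<Rightarrow> 'v"

locale representation = field K + groupoid \<Gamma>
  for K :: "('k, 'r) ring_scheme" and \<Gamma> :: "('o, 'a, 'z) category_scheme" +
  fixes \<pi> :: "('o, 'a, 'k, 'v) representation"
  assumes space_module: "x \<in> Obj \<Gamma> \<Longrightarrow> module K (space \<pi> x)"
    and rmap_linear: "a \<in> homs \<Gamma> x y \<Longrightarrow> rmap \<pi> a \<in> linear_maps K (space \<pi> x) (space \<pi> y)"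
    and rmap_Ide: "\<lbrakk>x \<in> Obj \<Gamma>; v \<in> carrier (space \<pi> x)\<rbrakk> \<Longrightarrow> rmap \<pi> (Ide \<Gamma> x) v = v"
    and rmap_Cmp: "\<lbrakk>a \<in> homs \<Gamma> x y; b \<in> homs \<Gamma> y z; v \<in> carrier (space \<pi> x)\<rbrakk> \<Longrightarrow>
      rmap \<pi> (b \<cdot>\<^bsub>\<Gamma>\<^esub> a) v = rmap \<pi> b (rmap \<pi> a v)"

definition isomorphic_representations ::
  "('k, 'r) ring_scheme \<Rightarrow> ('o, 'a, 'z) category_scheme \<Rightarrow>
   ('o, 'a, 'k, 'v) representation \<Rightarrow> ('o, 'a, 'k, 'w) representation \<Rightarrow> bool"
where
  "isomorphic_representations K \<Gamma> \<pi> \<pi>' \<longleftrightarrow>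
     representation K \<Gamma> \<pi> \<and> representation K \<Gamma> \<pi>' \<and>
     (\<exists>\<theta>. (\<forall>x\<in>Obj \<Gamma>. \<theta> x \<in> linear_maps K (space \<pi> x) (space \<pi>' x) \<and>
                    bij_betw (\<theta> x) (carrier (space \<pi> x)) (carrier (space \<pi>' x))) \<and>
          (\<forall>a\<in>Arr \<Gamma>. \<forall>v\<in>carrier (space \<pi> (Dom \<Gamma> a)).
             \<theta> (Cod \<Gamma> a) (rmap \<pi> a v) = rmap \<pi>' a (\<theta> (Dom \<Gamma> a) v)))"

text \<open>The arrow \<open>g : u \<rightarrow> gug\<^sup>-\<^sup>1\<close> is encoded as the pair \<open>(u, g)\<close>, since the same \<open>g\<close>
  occurs as an arrow out of every object.\<close>

definition inertia :: "('g, 's) monoid_scheme \<Rightarrow> ('g, 'g \<times> 'g) category" where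
  "inertia G =
     \<lparr>Obj = carrier G,
      Arr = carrier G \<times> carrier G,
      Dom = (\<lambda>(u, g). u),
      Cod = (\<lambda>(u, g). g \<otimes>\<^bsub>G\<^esub> u \<otimes>\<^bsub>G\<^esub> inv\<^bsub>G\<^esub> g),
      Ide = (\<lambda>u. (u, \<one>\<^bsub>G\<^esub>)),
      Cmp = (\<lambda>(v, h) (u, g). (u, h \<otimes>\<^bsub>G\<^esub> g))\<rparr>"

definition cat_trace ::
  "('o, 'a, 'k, 'z) linear_category_scheme \<Rightarrow> ('o, 'a, 'o, 'a) cat_functor \<Rightarrow> ('k, 'o \<Rightarrow> 'a) module"
where
  "cat_trace C A =
     \<lparr>carrier = nat_trans C C id_functor A, monoid.mult = undefined, one = undefined,
      zero = (\<lambda>x\<in>Obj C. Zero C x (omap A x)),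
      add = (\<lambda>\<xi> \<eta>. \<lambda>x\<in>Obj C. Add C (\<xi> x) (\<eta> x)),
      smult = (\<lambda>c \<xi>. \<lambda>x\<in>Obj C. Scal C c (\<xi> x))\<rparr>"

definition conj_map ::
  "('g, 's) monoid_scheme \<Rightarrow> ('o, 'a, 'z) category_scheme \<Rightarrow> ('g, 'o, 'a) action \<Rightarrow>
   'g \<Rightarrow> 'g \<Rightarrow> ('o \<Rightarrow> 'a) \<Rightarrow> 'o \<Rightarrow> 'a"
where
  "conj_map G C \<rho> f g \<xi> =
     (\<lambda>x\<in>Obj C.
        act_mult3 G C \<rho> g f (inv\<^bsub>G\<^esub> g) x \<cdot>\<^bsub>C\<^esub>
        amap (act \<rho> g) (\<xi> (omap (act \<rho> (inv\<^bsub>G\<^esub> g)) x)) \<cdot>\<^bsub>C\<^esub>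
        inverse_arrow C (act_mult \<rho> g (inv\<^bsub>G\<^esub> g) x) \<cdot>\<^bsub>C\<^esub>
        inverse_arrow C (act_one \<rho> x))"

definition cat_character ::
  "('g, 's) monoid_scheme \<Rightarrow> ('o, 'a, 'k, 'z) linear_category_scheme \<Rightarrow> ('g, 'o, 'a) action \<Rightarrow>
   ('g, 'g \<times> 'g, 'k, 'o \<Rightarrow> 'a) representation"
where
  "cat_character G C \<rho> =
     \<lparr>space = (\<lambda>f. cat_trace C (act \<rho> f)), rmap = (\<lambda>(f, g). conj_map G C \<rho> f g)\<rparr>"

text \<open>For a finite groupoid, the element \<open>\<Sum> a\<^sub>g e\<^sub>g\<close> of the groupoid algebra is the
  function \<open>g \<mapsto> a\<^sub>g\<close>.\<close>

definition groupoid_algebra ::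
  "('k, 'r) ring_scheme \<Rightarrow> ('o, 'a, 'z) category_scheme \<Rightarrow> ('k, 'a \<Rightarrow> 'k) module"
where
  "groupoid_algebra K \<Gamma> =
     \<lparr>carrier = Arr \<Gamma> \<rightarrow>\<^sub>E carrier K,
      monoid.mult = (\<lambda>a b. \<lambda>g\<in>Arr \<Gamma>.
        \<Oplus>\<^bsub>K\<^esub>pq\<in>{(p, q). p \<in> Arr \<Gamma> \<and> q \<in> Arr \<Gamma> \<and> Dom \<Gamma> p = Cod \<Gamma> q \<and> p \<cdot>\<^bsub>\<Gamma>\<^esub> q = g}.
          a (fst pq) \<otimes>\<^bsub>K\<^esub> b (snd pq)),
      one = (\<lambda>g\<in>Arr \<Gamma>. if g \<in> Ide \<Gamma> ` Obj \<Gamma> then \<one>\<^bsub>K\<^esub> else \<zero>\<^bsub>K\<^esub>),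
      zero = (\<lambda>g\<in>Arr \<Gamma>. \<zero>\<^bsub>K\<^esub>),
      add = (\<lambda>a b. \<lambda>g\<in>Arr \<Gamma>. a g \<oplus>\<^bsub>K\<^esub> b g),
      smult = (\<lambda>c a. \<lambda>g\<in>Arr \<Gamma>. c \<otimes>\<^bsub>K\<^esub> a g)\<rparr>"

definition basis_elt :: "('k, 'r) ring_scheme \<Rightarrow> ('o, 'a, 'z) category_scheme \<Rightarrow> 'a \<Rightarrow> 'a \<Rightarrow> 'k" where
  "basis_elt K \<Gamma> g = (\<lambda>h\<in>Arr \<Gamma>. if h = g then \<one>\<^bsub>K\<^esub> else \<zero>\<^bsub>K\<^esub>)"

text \<open>Representations versus modules: the module of \<open>\<pi>\<close> is \<open>\<Oplus>\<^sub>x \<pi>(x)\<close> with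
  \<open>e\<^sub>g\<close> acting by \<open>\<pi>(g)\<close> on the summand at the source of \<open>g\<close> and by \<open>0\<close> on the others; the
  representation of a module \<open>M\<close> is \<open>x \<mapsto> e\<^sub>x M\<close>, where \<open>e\<^sub>x\<close> is the basis element of the
  identity arrow of \<open>x\<close>. A left module over the (noncommutative) groupoid algebra \<open>A\<close> is a module
  record with scalars in \<open>A\<close>.\<close>

definition rep_module ::
  "('o, 'a, 'z) category_scheme \<Rightarrow> ('o, 'a, 'k, 'v) representation \<Rightarrow> ('a \<Rightarrow> 'k, 'o \<Rightarrow> 'v) module"
where
  "rep_module \<Gamma> \<pi> =
     \<lparr>carrier = (\<Pi>\<^sub>E x\<in>Obj \<Gamma>. carrier (space \<pi> x)), monoid.mult = undefined, one = undefined,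
      zero = (\<lambda>x\<in>Obj \<Gamma>. \<zero>\<^bsub>space \<pi> x\<^esub>),
      add = (\<lambda>v w. \<lambda>x\<in>Obj \<Gamma>. v x \<oplus>\<^bsub>space \<pi> x\<^esub> w x),
      smult = (\<lambda>a v. \<lambda>y\<in>Obj \<Gamma>.
        \<Oplus>\<^bsub>space \<pi> y\<^esub>g\<in>{g \<in> Arr \<Gamma>. Cod \<Gamma> g = y}. a g \<odot>\<^bsub>space \<pi> y\<^esub> rmap \<pi> g (v (Dom \<Gamma> g)))\<rparr>"

definition module_rep ::
  "('k, 'r) ring_scheme \<Rightarrow> ('o, 'a, 'z) category_scheme \<Rightarrow> ('a \<Rightarrow> 'k, 'v, 's) module_scheme \<Rightarrow>
   ('o, 'a, 'k, 'v) representation"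
where
  "module_rep K \<Gamma> M =
     \<lparr>space = (\<lambda>x.
        \<lparr>carrier = (\<lambda>v. basis_elt K \<Gamma> (Ide \<Gamma> x) \<odot>\<^bsub>M\<^esub> v) ` carrier M,
         monoid.mult = undefined, one = undefined,
         zero = \<zero>\<^bsub>M\<^esub>, add = add M,
         smult = (\<lambda>c v. (c \<odot>\<^bsub>groupoid_algebra K \<Gamma>\<^esub> \<one>\<^bsub>groupoid_algebra K \<Gamma>\<^esub>) \<odot>\<^bsub>M\<^esub> v)\<rparr>),
      rmap = (\<lambda>g v. basis_elt K \<Gamma> g \<odot>\<^bsub>M\<^esub> v)\<rparr>"

text \<open>The tensor product \<open>A \<otimes>\<^sub>B N\<close> for a ring \<open>A\<close>, regarded as a right \<open>B\<close>-module along a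
  map \<open>\<iota> : B \<rightarrow> A\<close>, and a left \<open>B\<close>-module \<open>N\<close>: the free abelian group on \<open>A \<times> N\<close> modulo
  the subgroup generated by the biadditivity and balancing relations. \<open>\<iota>\<close> need only be
  additive and multiplicative, not unital.\<close>

definition tensor_free :: "('e, 'r) ring_scheme \<Rightarrow> ('b, 'v, 's) module_scheme \<Rightarrow> ('e \<times> 'v \<Rightarrow>\<^sub>0 int) monoid" where
  "tensor_free A N = free_Abelian_group (carrier A \<times> carrier N)"

definition tensor_relations ::
  "('e, 'r) ring_scheme \<Rightarrow> ('b, 't) ring_scheme \<Rightarrow> ('b \<Rightarrow> 'e) \<Rightarrow> ('b, 'v, 's) module_scheme \<Rightarrow>
   ('e \<times> 'v \<Rightarrow>\<^sub>0 int) set"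
where
  "tensor_relations A B \<iota> N = generate (tensor_free A N)
     ({frag_of (m \<oplus>\<^bsub>A\<^esub> m', n) - frag_of (m, n) - frag_of (m', n) |m m' n.
         m \<in> carrier A \<and> m' \<in> carrier A \<and> n \<in> carrier N} \<union>
      {frag_of (m, n \<oplus>\<^bsub>N\<^esub> n') - frag_of (m, n) - frag_of (m, n') |m n n'.
         m \<in> carrier A \<and> n \<in> carrier N \<and> n' \<in> carrier N} \<union>
      {frag_of (m \<otimes>\<^bsub>A\<^esub> \<iota> b, n) - frag_of (m, b \<odot>\<^bsub>N\<^esub> n) |m b n.
         m \<in> carrier A \<and> b \<in> carrier B \<and> n \<in> carrier N})"

text \<open>The left \<open>A\<close>-action \<open>a (m \<otimes> n) = (a m) \<otimes> n\<close> sends a coset \<open>S\<close> to the coset of the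
  image of any of its elements; the union below runs over equal cosets.\<close>

definition extend_scalars ::
  "('e, 'r) ring_scheme \<Rightarrow> ('b, 't) ring_scheme \<Rightarrow> ('b \<Rightarrow> 'e) \<Rightarrow> ('b, 'v, 's) module_scheme \<Rightarrow>
   ('e, ('e \<times> 'v \<Rightarrow>\<^sub>0 int) set) module"
where
  "extend_scalars A B \<iota> N =
     (let F = tensor_free A N; R = tensor_relations A B \<iota> N; Q = F Mod R in
      \<lparr>carrier = carrier Q, monoid.mult = undefined, one = undefined,
       zero = \<one>\<^bsub>Q\<^esub>, add = monoid.mult Q,
       smult = (\<lambda>a S. \<Union>z\<in>S. R #>\<^bsub>F\<^esub> frag_extend (\<lambda>(m, n). frag_of (a \<otimes>\<^bsub>A\<^esub> m, n)) z)\<rparr>)"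

text \<open>Induction along the inclusion of a subgroupoid \<open>\<Delta>\<close> of \<open>\<Gamma>\<close>: the inclusion induces
  \<open>K[\<Delta>] \<rightarrow> K[\<Gamma>]\<close>, \<open>e\<^sub>g \<mapsto> e\<^sub>g\<close>, which is extension by zero. For a group \<open>G\<close> with subgroup
  \<open>H\<close>, \<open>inertia H\<close> is a subgroupoid of \<open>inertia G\<close> on the nose.\<close>

definition groupoid_algebra_inclusion ::
  "('k, 'r) ring_scheme \<Rightarrow> ('o, 'a, 'z) category_scheme \<Rightarrow> ('o, 'a, 'y) category_scheme \<Rightarrow>
   ('a \<Rightarrow> 'k) \<Rightarrow> 'a \<Rightarrow> 'k"
where
  "groupoid_algebra_inclusion K \<Delta> \<Gamma> a = (\<lambda>g\<in>Arr \<Gamma>. if g \<in> Arr \<Delta> then a g else \<zero>\<^bsub>K\<^esub>)"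

definition induced_representation ::
  "('k, 'r) ring_scheme \<Rightarrow> ('o, 'a, 'z) category_scheme \<Rightarrow> ('o, 'a, 'y) category_scheme \<Rightarrow>
   ('o, 'a, 'k, 'v) representation \<Rightarrow>
   ('o, 'a, 'k, (('a \<Rightarrow> 'k) \<times> ('o \<Rightarrow> 'v) \<Rightarrow>\<^sub>0 int) set) representation"
where
  "induced_representation K \<Delta> \<Gamma> \<pi> =
     module_rep K \<Gamma>
       (extend_scalars (groupoid_algebra K \<Gamma>) (groupoid_algebra K \<Delta>)
          (groupoid_algebra_inclusion K \<Delta> \<Gamma>) (rep_module \<Delta> \<pi>))"

type_synonym ('g, 'o, 'a) ind_obj = "('g \<Rightarrow> 'o) \<times> ('g \<Rightarrow> 'g \<Rightarrow> 'a)"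
type_synonym ('g, 'o, 'a) ind_arr =
  "('g, 'o, 'a) ind_obj \<times> ('g \<Rightarrow> 'a) \<times> ('g, 'o, 'a) ind_obj"

definition ind_objs ::
  "('g, 's) monoid_scheme \<Rightarrow> 'g set \<Rightarrow> ('o, 'a, 'z) category_scheme \<Rightarrow> ('g, 'o, 'a) action \<Rightarrow>
   ('g, 'o, 'a) ind_obj set"
where
  "ind_objs G H C \<rho> =
     {(f, u).
        f \<in> carrier G \<rightarrow>\<^sub>E Obj C \<and>
        u \<in> (\<Pi>\<^sub>E g\<in>carrier G. \<Pi>\<^sub>E h\<in>H. isos C (f (g \<otimes>\<^bsub>G\<^esub> h)) (omap (act \<rho> (inv\<^bsub>G\<^esub> h)) (f g))) \<and>
        (\<forall>g\<in>carrier G. u g \<one>\<^bsub>G\<^esub> = inverse_arrow C (act_one \<rho> (f g))) \<and>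
        (\<forall>g\<in>carrier G. \<forall>h\<^sub>1\<in>H. \<forall>h\<^sub>2\<in>H.
           u g (h\<^sub>1 \<otimes>\<^bsub>G\<^esub> h\<^sub>2) =
             act_mult \<rho> (inv\<^bsub>G\<^esub> h\<^sub>2) (inv\<^bsub>G\<^esub> h\<^sub>1) (f g) \<cdot>\<^bsub>C\<^esub>
             amap (act \<rho> (inv\<^bsub>G\<^esub> h\<^sub>2)) (u g h\<^sub>1) \<cdot>\<^bsub>C\<^esub>
             u (g \<otimes>\<^bsub>G\<^esub> h\<^sub>1) h\<^sub>2)}"

text \<open>An arrow is a system of arrows \<open>f(g) \<rightarrow> f'(g)\<close> together with its source and target.\<close>

definition ind_arrs ::
  "('g, 's) monoid_scheme \<Rightarrow> 'g set \<Rightarrow> ('o, 'a, 'z) category_scheme \<Rightarrow> ('g, 'o, 'a) action \<Rightarrow>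
   ('g, 'o, 'a) ind_arr set"
where
  "ind_arrs G H C \<rho> =
     {((f, u), a, (f', u')).
        (f, u) \<in> ind_objs G H C \<rho> \<and> (f', u') \<in> ind_objs G H C \<rho> \<and>
        a \<in> (\<Pi>\<^sub>E g\<in>carrier G. homs C (f g) (f' g)) \<and>
        (\<forall>g\<in>carrier G. \<forall>h\<in>H.
           amap (act \<rho> (inv\<^bsub>G\<^esub> h)) (a g) \<cdot>\<^bsub>C\<^esub> u g h = u' g h \<cdot>\<^bsub>C\<^esub> a (g \<otimes>\<^bsub>G\<^esub> h))}"

definition ind_category ::
  "('g, 's) monoid_scheme \<Rightarrow> 'g set \<Rightarrow> ('o, 'a, 'k, 'z) linear_category_scheme \<Rightarrow>
   ('g, 'o, 'a) action \<Rightarrow> (('g, 'o, 'a) ind_obj, ('g, 'o, 'a) ind_arr, 'k) linear_category"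
where
  "ind_category G H C \<rho> =
     \<lparr>Obj = ind_objs G H C \<rho>,
      Arr = ind_arrs G H C \<rho>,
      Dom = (\<lambda>(x, a, y). x),
      Cod = (\<lambda>(x, a, y). y),
      Ide = (\<lambda>x. (x, \<lambda>g\<in>carrier G. Ide C (fst x g), x)),
      Cmp = (\<lambda>(y, b, z) (x, a, y'). (x, \<lambda>g\<in>carrier G. b g \<cdot>\<^bsub>C\<^esub> a g, z)),
      Zero = (\<lambda>x y. (x, \<lambda>g\<in>carrier G. Zero C (fst x g) (fst y g), y)),
      Add = (\<lambda>(x, a, y) (x', b, y'). (x, \<lambda>g\<in>carrier G. Add C (a g) (b g), y)),
      Scal = (\<lambda>c (x, a, y). (x, \<lambda>g\<in>carrier G. Scal C c (a g), y))\<rparr>"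

definition ind_translate_obj ::
  "('g, 's) monoid_scheme \<Rightarrow> 'g set \<Rightarrow> 'g \<Rightarrow> ('g, 'o, 'a) ind_obj \<Rightarrow> ('g, 'o, 'a) ind_obj"
where
  "ind_translate_obj G H g\<^sub>1 =
     (\<lambda>(f, u). (\<lambda>g\<in>carrier G. f (inv\<^bsub>G\<^esub> g\<^sub>1 \<otimes>\<^bsub>G\<^esub> g),
                \<lambda>g\<in>carrier G. \<lambda>h\<in>H. u (inv\<^bsub>G\<^esub> g\<^sub>1 \<otimes>\<^bsub>G\<^esub> g) h))"

definition ind_action ::
  "('g, 's) monoid_scheme \<Rightarrow> 'g set \<Rightarrow> ('o, 'a, 'k, 'z) linear_category_scheme \<Rightarrow>
   ('g, 'o, 'a) action \<Rightarrow> ('g, ('g, 'o, 'a) ind_obj, ('g, 'o, 'a) ind_arr) action"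
where
  "ind_action G H C \<rho> =
     \<lparr>act = (\<lambda>g\<^sub>1.
        \<lparr>omap = ind_translate_obj G H g\<^sub>1,
         amap = (\<lambda>(x, a, y). (ind_translate_obj G H g\<^sub>1 x,
                              \<lambda>g\<in>carrier G. a (inv\<^bsub>G\<^esub> g\<^sub>1 \<otimes>\<^bsub>G\<^esub> g),
                              ind_translate_obj G H g\<^sub>1 y))\<rparr>),
      act_mult = (\<lambda>g h. \<lambda>x\<in>ind_objs G H C \<rho>.
        Ide (ind_category G H C \<rho>) (ind_translate_obj G H (g \<otimes>\<^bsub>G\<^esub> h) x)),
      act_one = (\<lambda>x\<in>ind_objs G H C \<rho>. Ide (ind_category G H C \<rho>) x)\<rparr>"

end

theory Submission
  imports Defs
begin

text \<open>
  Write \<open>\<sigma>\<close> for the induced action. A transformation \<open>\<eta> : id \<Rightarrow> \<sigma>(s)\<close> has, at an object \<open>(f, u)\<close>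
  of the induced category, components \<open>f(r) \<rightarrow> f(s\<^sup>-\<^sup>1r)\<close>, and the isomorphisms \<open>u\<close> determine the
  components on a coset \<open>rH\<close> from the one at \<open>r\<close>. Conversely, an arrow of the induced category can be
  prescribed freely at one representative of each coset; since the hom spaces contain zero arrows,
  there are arrows concentrated on a single coset (\<open>coset_arrow\<close>). Naturality of \<open>\<eta>\<close> along these
  has two consequences. If \<open>t = r\<^sup>-\<^sup>1sr\<close> is not in \<open>H\<close>, then the component at \<open>r\<close> is zero
  (\<open>Tr_zero_off\<close>). If \<open>t\<close> is in \<open>H\<close>, then the component at \<open>r\<close>, followed by
  \<open>u : f(rt\<^sup>-\<^sup>1) \<cong> \<rho>(t)f(r)\<close>, depends only on the object \<open>f(r)\<close> and is an element of \<open>Tr(\<rho>(t))\<close>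
  (\<open>component_eq\<close>, \<open>component_NT\<close>). Hence \<open>Tr(\<sigma>(s))\<close> is the direct sum of the spaces
  \<open>Tr(\<rho>(r\<^sup>-\<^sup>1sr))\<close> over the cosets \<open>rH\<close> fixed by \<open>s\<close>, which is also what induction from the
  inertia groupoid of \<open>H\<close> to that of \<open>G\<close> produces at \<open>s\<close>.

  The comparison with the tensor product is a general fact about a finite groupoid \<open>\<Gamma>\<close> and a
  subgroupoid \<open>\<Delta>\<close> (\<open>isomorphic_induced\<close>, in the locale \<open>induction_data\<close>). Given representations
  \<open>\<pi>\<close> of \<open>\<Delta>\<close> and \<open>\<pi>'\<close> of \<open>\<Gamma>\<close> and an intertwining map \<open>j\<close> from \<open>\<pi>\<close> to the restriction of \<open>\<pi>'\<close>,
  the assignment \<open>a \<otimes> n \<mapsto> \<Sum>\<^sub>p a(p) \<pi>'(p) j(n)\<close> maps the induced representation to \<open>\<pi>'\<close>. At an object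
  \<open>s\<close>, every element of the tensor product is a sum of terms \<open>e\<^sub>p \<otimes> v\<^sub>p\<close> with \<open>p\<close> in a set \<open>P(s)\<close> of
  arrows into \<open>s\<close> through which all arrows from \<open>\<Delta>\<close> to \<open>s\<close> factor (\<open>E_eq\<close>). The map is therefore
  bijective as soon as \<open>\<pi>'(s)\<close> has projections that recover the \<open>v\<^sub>p\<close> and detect zero. Bijectivity
  also transports the module axioms and functoriality from \<open>\<pi>'\<close> to the tensor product.

  For the theorem, \<open>j\<close> is extension by zero from the coset \<open>H\<close> (\<open>extend\<close>), \<open>P(s)\<close> consists of the
  arrows \<open>r : r\<^sup>-\<^sup>1sr \<rightarrow> s\<close> for representatives \<open>r\<close> of the fixed cosets (\<open>fixed_cosets\<close>), and the
  projections are the components just described. The substantial point is that \<open>j\<close> intertwines the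
  conjugation maps (\<open>extend_equivariant\<close>), which rests on the cocycle identities of \<open>u\<close>.
\<close>

section \<open>Additive maps and modules with coordinates\<close>

lemma additive_zero:
  assumes "abelian_group M" "abelian_group N"
    and "h \<in> carrier M \<rightarrow> carrier N"
    and "\<And>x y. \<lbrakk>x \<in> carrier M; y \<in> carrier M\<rbrakk> \<Longrightarrow> h (x \<oplus>\<^bsub>M\<^esub> y) = h x \<oplus>\<^bsub>N\<^esub> h y"
  shows "h \<zero>\<^bsub>M\<^esub> = \<zero>\<^bsub>N\<^esub>"
proof -
  interpret M: abelian_group M by fact
  interpret N: abelian_group N by fact
  have c: "h \<zero>\<^bsub>M\<^esub> \<in> carrier N" using assms(3) by auto
  have "h \<zero>\<^bsub>M\<^esub> \<oplus>\<^bsub>N\<^esub> h \<zero>\<^bsub>M\<^esub> = h \<zero>\<^bsub>M\<^esub> \<oplus>\<^bsub>N\<^esub> \<zero>\<^bsub>N\<^esub>"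
    using assms(4)[of "\<zero>\<^bsub>M\<^esub>" "\<zero>\<^bsub>M\<^esub>"] c by simp
  thus ?thesis using c by (metis N.add.l_cancel N.zero_closed)
qed

lemma additive_minus:
  assumes "abelian_group M" "abelian_group N"
    and "h \<in> carrier M \<rightarrow> carrier N"
    and "\<And>x y. \<lbrakk>x \<in> carrier M; y \<in> carrier M\<rbrakk> \<Longrightarrow> h (x \<oplus>\<^bsub>M\<^esub> y) = h x \<oplus>\<^bsub>N\<^esub> h y"
    and "x \<in> carrier M" "y \<in> carrier M"
  shows "h (x \<ominus>\<^bsub>M\<^esub> y) = h x \<ominus>\<^bsub>N\<^esub> h y"
proof -
  interpret M: abelian_group M by fact
  interpret N: abelian_group N by fact
  have c: "h x \<in> carrier N" "h y \<in> carrier N" "h (x \<ominus>\<^bsub>M\<^esub> y) \<in> carrier N" using assms(3,5,6) by auto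
  have "h x = h (x \<ominus>\<^bsub>M\<^esub> y) \<oplus>\<^bsub>N\<^esub> h y"
    using assms(5,6) assms(4)[of "x \<ominus>\<^bsub>M\<^esub> y" y, symmetric]
    by (simp add: M.minus_eq M.a_assoc M.l_neg)
  thus ?thesis using c by (simp add: N.minus_eq N.a_assoc N.r_neg)
qed

lemma additive_finsum:
  assumes "abelian_group M" "abelian_group N"
    and "h \<in> carrier M \<rightarrow> carrier N"
    and "\<And>x y. \<lbrakk>x \<in> carrier M; y \<in> carrier M\<rbrakk> \<Longrightarrow> h (x \<oplus>\<^bsub>M\<^esub> y) = h x \<oplus>\<^bsub>N\<^esub> h y"
    and "f \<in> I \<rightarrow> carrier M"
  shows "h (finsum M f I) = finsum N (\<lambda>i. h (f i)) I"
proof -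
  interpret M: abelian_group M by fact
  interpret N: abelian_group N by fact
  show ?thesis using assms(5)
  proof (induction I rule: infinite_finite_induct)
    case (insert i I)
    have "f \<in> I \<rightarrow> carrier M" "f i \<in> carrier M" using insert.prems by auto
    moreover have "(\<lambda>i. h (f i)) \<in> I \<rightarrow> carrier N" "h (f i) \<in> carrier N"
      using insert.prems assms(3) by auto
    ultimately show ?case
      using insert assms(4)[of "f i" "finsum M f I"] by (simp add: M.finsum_closed)
  qed (simp_all add: additive_zero[OF assms(1-4)])
qed

lemma (in abelian_monoid) finsum_single:
  assumes "finite I" "i \<in> I" "f i \<in> carrier G" "\<And>k. \<lbrakk>k \<in> I; k \<noteq> i\<rbrakk> \<Longrightarrow> f k = \<zero>"
  shows "finsum G f I = f i"
proof -
  have "finsum G f I = finsum G f {i}"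
    using assms by (intro add.finprod_mono_neutral_cong_right) (auto, metis assms(3,4) zero_closed)
  also have "\<dots> = f i" using assms by simp
  finally show ?thesis .
qed

text \<open>The module axioms are identities, so they can be checked after jointly injective maps into
  modules. Additive inverses are obtained by multiplication with \<open>-1\<close>.\<close>

lemma module_by_coordinates:
  assumes "cring K" and N: "\<And>i. i \<in> I \<Longrightarrow> module K (N i)"
    and ev: "\<And>i x. \<lbrakk>i \<in> I; x \<in> carrier M\<rbrakk> \<Longrightarrow> ev i x \<in> carrier (N i)"
    and inj: "\<And>x y. \<lbrakk>x \<in> carrier M; y \<in> carrier M; \<And>i. i \<in> I \<Longrightarrow> ev i x = ev i y\<rbrakk> \<Longrightarrow> x = y"
    and zero: "\<zero>\<^bsub>M\<^esub> \<in> carrier M" "\<And>i. i \<in> I \<Longrightarrow> ev i \<zero>\<^bsub>M\<^esub> = \<zero>\<^bsub>N i\<^esub>"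
    and add: "\<And>x y. \<lbrakk>x \<in> carrier M; y \<in> carrier M\<rbrakk> \<Longrightarrow> x \<oplus>\<^bsub>M\<^esub> y \<in> carrier M"
       "\<And>i x y. \<lbrakk>i \<in> I; x \<in> carrier M; y \<in> carrier M\<rbrakk> \<Longrightarrow> ev i (x \<oplus>\<^bsub>M\<^esub> y) = ev i x \<oplus>\<^bsub>N i\<^esub> ev i y"
    and smult: "\<And>c x. \<lbrakk>c \<in> carrier K; x \<in> carrier M\<rbrakk> \<Longrightarrow> c \<odot>\<^bsub>M\<^esub> x \<in> carrier M"
       "\<And>i c x. \<lbrakk>i \<in> I; c \<in> carrier K; x \<in> carrier M\<rbrakk> \<Longrightarrow> ev i (c \<odot>\<^bsub>M\<^esub> x) = c \<odot>\<^bsub>N i\<^esub> ev i x"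
  shows "module K M"
proof -
  interpret K: cring K by fact
  note N' = N[THEN module.axioms(2)] N[THEN module.axioms(2), THEN abelian_group.axioms(1)]
  have "abelian_group M"
  proof (rule abelian_groupI)
    show "\<exists>y\<in>carrier M. y \<oplus>\<^bsub>M\<^esub> x = \<zero>\<^bsub>M\<^esub>" if x: "x \<in> carrier M" for x
    proof (intro bexI[of _ "(\<ominus>\<^bsub>K\<^esub> \<one>\<^bsub>K\<^esub>) \<odot>\<^bsub>M\<^esub> x"] inj)
      fix i assume i: "i \<in> I"
      interpret Ni: module K "N i" by (rule N[OF i])
      show "ev i ((\<ominus>\<^bsub>K\<^esub> \<one>\<^bsub>K\<^esub>) \<odot>\<^bsub>M\<^esub> x \<oplus>\<^bsub>M\<^esub> x) = ev i \<zero>\<^bsub>M\<^esub>"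
        using i x by (simp add: add smult zero ev Ni.smult_l_minus Ni.l_neg)
    qed (use x in \<open>simp_all add: add smult zero\<close>)
  next
    fix x y z assume xyz: "x \<in> carrier M" "y \<in> carrier M" "z \<in> carrier M"
    show "x \<oplus>\<^bsub>M\<^esub> y \<oplus>\<^bsub>M\<^esub> z = x \<oplus>\<^bsub>M\<^esub> (y \<oplus>\<^bsub>M\<^esub> z)"
      by (rule inj) (use xyz N' in \<open>simp_all add: add ev abelian_monoid.a_assoc\<close>)
    show "x \<oplus>\<^bsub>M\<^esub> y = y \<oplus>\<^bsub>M\<^esub> x"
      by (rule inj) (use xyz N' in \<open>simp_all add: add ev abelian_monoid.a_comm\<close>)
    show "\<zero>\<^bsub>M\<^esub> \<oplus>\<^bsub>M\<^esub> x = x"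
      by (rule inj) (use xyz N' in \<open>simp_all add: add ev zero abelian_monoid.l_zero\<close>)
  qed (simp_all add: add zero)
  thus ?thesis
  proof (intro moduleI assms(1))
    fix a b x y assume *: "a \<in> carrier K" "b \<in> carrier K" "x \<in> carrier M" "y \<in> carrier M"
    show "(a \<oplus>\<^bsub>K\<^esub> b) \<odot>\<^bsub>M\<^esub> x = a \<odot>\<^bsub>M\<^esub> x \<oplus>\<^bsub>M\<^esub> b \<odot>\<^bsub>M\<^esub> x"
      by (rule inj) (use * N in \<open>simp_all add: add smult ev module.smult_l_distr\<close>)
    show "a \<odot>\<^bsub>M\<^esub> (x \<oplus>\<^bsub>M\<^esub> y) = a \<odot>\<^bsub>M\<^esub> x \<oplus>\<^bsub>M\<^esub> a \<odot>\<^bsub>M\<^esub> y"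
      by (rule inj) (use * in \<open>simp_all add: add smult ev module.smult_r_distr[OF N]\<close>)
    show "(a \<otimes>\<^bsub>K\<^esub> b) \<odot>\<^bsub>M\<^esub> x = a \<odot>\<^bsub>M\<^esub> (b \<odot>\<^bsub>M\<^esub> x)"
      by (rule inj) (use * N in \<open>simp_all add: smult ev module.smult_assoc1\<close>)
  next
    fix x assume *: "x \<in> carrier M"
    show "\<one>\<^bsub>K\<^esub> \<odot>\<^bsub>M\<^esub> x = x"
      by (rule inj) (use * N in \<open>simp_all add: smult ev module.smult_one\<close>)
  qed (simp_all add: smult)
qed

section \<open>Tensor products presented by generators and relations\<close>

text \<open>The assumptions say that the three families of relations lie in the free abelian group on
  \<open>A \<times> N\<close>.\<close>

locale tensor_product =
  fixes A :: "('e, 'r) ring_scheme" and B :: "('b, 't) ring_scheme" and \<iota> :: "'b \<Rightarrow> 'e"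
    and N :: "('b, 'v, 's) module_scheme"
  assumes A_add: "\<lbrakk>m \<in> carrier A; m' \<in> carrier A\<rbrakk> \<Longrightarrow> m \<oplus>\<^bsub>A\<^esub> m' \<in> carrier A"
    and A_mult: "\<lbrakk>m \<in> carrier A; b \<in> carrier B\<rbrakk> \<Longrightarrow> m \<otimes>\<^bsub>A\<^esub> \<iota> b \<in> carrier A"
    and N_add: "\<lbrakk>n \<in> carrier N; n' \<in> carrier N\<rbrakk> \<Longrightarrow> n \<oplus>\<^bsub>N\<^esub> n' \<in> carrier N"
    and N_smult: "\<lbrakk>b \<in> carrier B; n \<in> carrier N\<rbrakk> \<Longrightarrow> b \<odot>\<^bsub>N\<^esub> n \<in> carrier N"
begin

abbreviation "F \<equiv> tensor_free A N"
abbreviation "R \<equiv> tensor_relations A B \<iota> N"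
abbreviation "T \<equiv> extend_scalars A B \<iota> N"

definition tens :: "'e \<Rightarrow> 'v \<Rightarrow> ('e \<times> 'v \<Rightarrow>\<^sub>0 int) set" where
  "tens m n = R #>\<^bsub>F\<^esub> frag_of (m, n)"

lemma carrier_F: "x \<in> carrier F \<longleftrightarrow> Poly_Mapping.keys x \<subseteq> carrier A \<times> carrier N"
  by (simp add: tensor_free_def)

lemma frag_of_F: "\<lbrakk>m \<in> carrier A; n \<in> carrier N\<rbrakk> \<Longrightarrow> frag_of (m, n) \<in> carrier F"
  by (simp add: tensor_free_def)

lemma mult_F: "x \<otimes>\<^bsub>F\<^esub> y = x + y"
  by (simp add: tensor_free_def)

lemma comm_group_F: "comm_group F"
  by (simp add: tensor_free_def abelian_free_Abelian_group)

lemma group_F: "group F"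
  by (simp add: tensor_free_def)

lemma diff_F: "\<lbrakk>x \<in> carrier F; y \<in> carrier F\<rbrakk> \<Longrightarrow> x - y \<in> carrier F"
  unfolding carrier_F using keys_diff by fastforce

lemma relations_in_F:
  "{frag_of (m \<oplus>\<^bsub>A\<^esub> m', n) - frag_of (m, n) - frag_of (m', n) |m m' n.
         m \<in> carrier A \<and> m' \<in> carrier A \<and> n \<in> carrier N} \<union>
   {frag_of (m, n \<oplus>\<^bsub>N\<^esub> n') - frag_of (m, n) - frag_of (m, n') |m n n'.
         m \<in> carrier A \<and> n \<in> carrier N \<and> n' \<in> carrier N} \<union>
   {frag_of (m \<otimes>\<^bsub>A\<^esub> \<iota> b, n) - frag_of (m, b \<odot>\<^bsub>N\<^esub> n) |m b n.
         m \<in> carrier A \<and> b \<in> carrier B \<and> n \<in> carrier N} \<subseteq> carrier F"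
  by (auto intro!: diff_F frag_of_F A_add A_mult N_add N_smult)

lemma subgroup_R: "subgroup R F"
  unfolding tensor_relations_def by (rule group.generate_is_subgroup[OF group_F relations_in_F])

lemma T_simps:
  "carrier T = carrier (F Mod R)" "\<zero>\<^bsub>T\<^esub> = R" "(\<oplus>\<^bsub>T\<^esub>) = (<#>\<^bsub>F\<^esub>)"
  "a \<odot>\<^bsub>T\<^esub> S = (\<Union>z\<in>S. R #>\<^bsub>F\<^esub> frag_extend (\<lambda>(m, n). frag_of (a \<otimes>\<^bsub>A\<^esub> m, n)) z)"
  by (simp_all add: extend_scalars_def Let_def FactGroup_def)

lemma normal_R: "R \<lhd> F"
  using comm_group_F subgroup_R by (simp add: comm_group.normal_iff_subgroup)

lemma abelian_group_T: "abelian_group T"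
proof -
  interpret Q: comm_group "F Mod R"
    by (rule comm_group.abelian_FactGroup[OF comm_group_F subgroup_R])
  have T: "carrier T = carrier (F Mod R)" "\<zero>\<^bsub>T\<^esub> = \<one>\<^bsub>F Mod R\<^esub>" "(\<oplus>\<^bsub>T\<^esub>) = (\<otimes>\<^bsub>F Mod R\<^esub>)"
    by (simp_all add: extend_scalars_def Let_def)
  show ?thesis
    by (rule abelian_groupI) (auto simp: T Q.m_ac simp del: mult_FactGroup one_FactGroup intro: Q.l_inv_ex)
qed

sublocale T: abelian_group T by (rule abelian_group_T)

lemma coset_T: "z \<in> carrier F \<Longrightarrow> R #>\<^bsub>F\<^esub> z \<in> carrier T"
  unfolding T_simps FactGroup_def RCOSETS_def by auto

lemma coset_ex: "S \<in> carrier T \<Longrightarrow> \<exists>z\<in>carrier F. S = R #>\<^bsub>F\<^esub> z"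
  unfolding T_simps FactGroup_def RCOSETS_def by auto

lemma coset_add:
  "\<lbrakk>y \<in> carrier F; z \<in> carrier F\<rbrakk> \<Longrightarrow> R #>\<^bsub>F\<^esub> (y + z) = (R #>\<^bsub>F\<^esub> y) \<oplus>\<^bsub>T\<^esub> (R #>\<^bsub>F\<^esub> z)"
  unfolding T_simps using normal.rcos_sum[OF normal_R] by (simp add: mult_F)

lemma coset_R: "z \<in> R \<Longrightarrow> R #>\<^bsub>F\<^esub> z = \<zero>\<^bsub>T\<^esub>"
  unfolding T_simps by (meson group.coset_join2 group_F subgroup.mem_carrier subgroup_R)

lemma coset_diff:
  assumes "y \<in> carrier F" "z \<in> carrier F"
  shows "R #>\<^bsub>F\<^esub> (y - z) = (R #>\<^bsub>F\<^esub> y) \<ominus>\<^bsub>T\<^esub> (R #>\<^bsub>F\<^esub> z)"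
proof -
  have "R #>\<^bsub>F\<^esub> y = (R #>\<^bsub>F\<^esub> (y - z)) \<oplus>\<^bsub>T\<^esub> (R #>\<^bsub>F\<^esub> z)"
    using coset_add[OF diff_F[OF assms] assms(2)] by simp
  thus ?thesis
    using coset_T[OF assms(1)] coset_T[OF assms(2)] coset_T[OF diff_F[OF assms]]
    by (simp add: T.minus_eq T.a_assoc T.r_neg)
qed

lemma tens_closed: "\<lbrakk>m \<in> carrier A; n \<in> carrier N\<rbrakk> \<Longrightarrow> tens m n \<in> carrier T"
  unfolding tens_def by (intro coset_T frag_of_F)

lemma coset_eq:
  assumes "y \<in> carrier F" "z \<in> carrier F" "y - z \<in> R"
  shows "R #>\<^bsub>F\<^esub> y = R #>\<^bsub>F\<^esub> z"
proof -
  have "R #>\<^bsub>F\<^esub> y = R #>\<^bsub>F\<^esub> ((y - z) + z)" by simp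
  also have "\<dots> = R #>\<^bsub>F\<^esub> z"
    using coset_add[OF diff_F[OF assms(1,2)] assms(2)] coset_R[OF assms(3)] coset_T[OF assms(2)]
    by simp
  finally show ?thesis .
qed

lemma add_F: "\<lbrakk>x \<in> carrier F; y \<in> carrier F\<rbrakk> \<Longrightarrow> x + y \<in> carrier F"
  unfolding carrier_F using keys_add by fastforce

lemma tens_add_left:
  assumes "m \<in> carrier A" "m' \<in> carrier A" "n \<in> carrier N"
  shows "tens (m \<oplus>\<^bsub>A\<^esub> m') n = tens m n \<oplus>\<^bsub>T\<^esub> tens m' n"
proof -
  have "tens (m \<oplus>\<^bsub>A\<^esub> m') n = R #>\<^bsub>F\<^esub> (frag_of (m, n) + frag_of (m', n))"
    unfolding tens_def
  proof (rule coset_eq)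
    show "frag_of (m \<oplus>\<^bsub>A\<^esub> m', n) - (frag_of (m, n) + frag_of (m', n)) \<in> R"
      unfolding tensor_relations_def diff_diff_eq[symmetric]
      by (rule generate.incl) (use assms in blast)
  qed (intro frag_of_F A_add add_F assms)+
  thus ?thesis using assms by (simp add: tens_def coset_add frag_of_F)
qed

lemma tens_add_right:
  assumes "m \<in> carrier A" "n \<in> carrier N" "n' \<in> carrier N"
  shows "tens m (n \<oplus>\<^bsub>N\<^esub> n') = tens m n \<oplus>\<^bsub>T\<^esub> tens m n'"
proof -
  have "tens m (n \<oplus>\<^bsub>N\<^esub> n') = R #>\<^bsub>F\<^esub> (frag_of (m, n) + frag_of (m, n'))"
    unfolding tens_def
  proof (rule coset_eq)
    show "frag_of (m, n \<oplus>\<^bsub>N\<^esub> n') - (frag_of (m, n) + frag_of (m, n')) \<in> R"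
      unfolding tensor_relations_def diff_diff_eq[symmetric]
      by (rule generate.incl) (use assms in blast)
  qed (intro frag_of_F N_add add_F assms)+
  thus ?thesis using assms by (simp add: tens_def coset_add frag_of_F)
qed

lemma tens_balanced:
  assumes "m \<in> carrier A" "b \<in> carrier B" "n \<in> carrier N"
  shows "tens (m \<otimes>\<^bsub>A\<^esub> \<iota> b) n = tens m (b \<odot>\<^bsub>N\<^esub> n)"
  unfolding tens_def
proof (rule coset_eq)
  show "frag_of (m \<otimes>\<^bsub>A\<^esub> \<iota> b, n) - frag_of (m, b \<odot>\<^bsub>N\<^esub> n) \<in> R"
    unfolding tensor_relations_def by (rule generate.incl) (use assms in blast)
qed (intro frag_of_F A_mult N_smult assms)+

lemma F_induct [consumes 1, case_names zero minus frag_of]: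
  assumes "z \<in> carrier F"
    and "P 0" "\<And>x y. \<lbrakk>x \<in> carrier F; y \<in> carrier F; P x; P y\<rbrakk> \<Longrightarrow> P (x - y)"
    and "\<And>m n. \<lbrakk>m \<in> carrier A; n \<in> carrier N\<rbrakk> \<Longrightarrow> P (frag_of (m, n))"
  shows "P z"
  using assms(1) unfolding carrier_F
  by (rule free_Abelian_group_induct[of z "carrier A \<times> carrier N" P])
    (use assms(2-) in \<open>auto simp: carrier_F\<close>)

lemma zero_F: "0 \<in> carrier F"
  by (simp add: carrier_F)

lemma coset_zero: "R #>\<^bsub>F\<^esub> 0 = \<zero>\<^bsub>T\<^esub>"
  using coset_R subgroup.one_closed[OF subgroup_R] by (simp add: tensor_free_def)

lemma T_induct [consumes 1, case_names zero minus tens]: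
  assumes "S \<in> carrier T"
    and "P \<zero>\<^bsub>T\<^esub>" "\<And>x y. \<lbrakk>x \<in> carrier T; y \<in> carrier T; P x; P y\<rbrakk> \<Longrightarrow> P (x \<ominus>\<^bsub>T\<^esub> y)"
    and "\<And>m n. \<lbrakk>m \<in> carrier A; n \<in> carrier N\<rbrakk> \<Longrightarrow> P (tens m n)"
  shows "P S"
proof -
  obtain z where z: "z \<in> carrier F" "S = R #>\<^bsub>F\<^esub> z" using coset_ex assms(1) by blast
  from z(1) have "P (R #>\<^bsub>F\<^esub> z)"
    by (induction rule: F_induct)
      (use assms(2-4)[unfolded tens_def] in \<open>simp_all add: coset_zero coset_diff coset_T\<close>)
  thus ?thesis using z by simp
qed

text \<open>The universal property: the additive extension of \<open>b\<close> to the free group vanishes on the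
  generating relations, hence on the subgroup that they generate, and so descends to cosets.\<close>

lemma lift:
  assumes W: "abelian_group W"
    and cl: "\<And>m n. \<lbrakk>m \<in> carrier A; n \<in> carrier N\<rbrakk> \<Longrightarrow> b m n \<in> carrier W"
    and l: "\<And>m m' n. \<lbrakk>m \<in> carrier A; m' \<in> carrier A; n \<in> carrier N\<rbrakk> \<Longrightarrow>
              b (m \<oplus>\<^bsub>A\<^esub> m') n = b m n \<oplus>\<^bsub>W\<^esub> b m' n"
    and r: "\<And>m n n'. \<lbrakk>m \<in> carrier A; n \<in> carrier N; n' \<in> carrier N\<rbrakk> \<Longrightarrow>
              b m (n \<oplus>\<^bsub>N\<^esub> n') = b m n \<oplus>\<^bsub>W\<^esub> b m n'"
    and bal: "\<And>m c n. \<lbrakk>m \<in> carrier A; c \<in> carrier B; n \<in> carrier N\<rbrakk> \<Longrightarrow>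
              b (m \<otimes>\<^bsub>A\<^esub> \<iota> c) n = b m (c \<odot>\<^bsub>N\<^esub> n)"
  obtains \<beta> where "\<beta> \<in> carrier T \<rightarrow> carrier W"
    "\<And>x y. \<lbrakk>x \<in> carrier T; y \<in> carrier T\<rbrakk> \<Longrightarrow> \<beta> (x \<oplus>\<^bsub>T\<^esub> y) = \<beta> x \<oplus>\<^bsub>W\<^esub> \<beta> y"
    "\<And>m n. \<lbrakk>m \<in> carrier A; n \<in> carrier N\<rbrakk> \<Longrightarrow> \<beta> (tens m n) = b m n"
proof -
  interpret W: abelian_group W by fact
  obtain h where h: "h \<in> hom F (add_monoid W)"
    and h': "\<And>p. p \<in> carrier A \<times> carrier N \<Longrightarrow> h (frag_of p) = (\<lambda>(m, n). b m n) p"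
    unfolding tensor_free_def
    by (rule comm_group.free_Abelian_group_universal[OF W.a_comm_group,
          of "\<lambda>(m, n). b m n" "carrier A \<times> carrier N"]) (use cl in auto)
  have hc: "\<And>x. x \<in> carrier F \<Longrightarrow> h x \<in> carrier W"
    using h by (auto simp: hom_def)
  have hadd: "h (x + y) = h x \<oplus>\<^bsub>W\<^esub> h y" if "x \<in> carrier F" "y \<in> carrier F" for x y
    using h that by (auto simp: hom_def mult_F)
  have hdiff: "h (x - y) = h x \<ominus>\<^bsub>W\<^esub> h y" if "x \<in> carrier F" "y \<in> carrier F" for x y
    using hadd[OF diff_F[OF that] that(2)] hc[OF that(1)] hc[OF that(2)] hc[OF diff_F[OF that]]
    by (simp add: W.minus_eq W.a_assoc W.r_neg)
  interpret gh: group_hom F "add_monoid W" h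
    by (simp add: group_hom_def group_hom_axioms_def group_F W.a_group h)
  have h_tens: "\<And>m n. \<lbrakk>m \<in> carrier A; n \<in> carrier N\<rbrakk> \<Longrightarrow> h (frag_of (m, n)) = b m n"
    using h' by auto
  have ker: "R \<subseteq> kernel F (add_monoid W) h"
    unfolding tensor_relations_def
  proof (rule group.generate_subgroup_incl[OF group_F _ gh.subgroup_kernel], intro Un_least subsetI)
    show "z \<in> kernel F (add_monoid W) h"
      if "z \<in> {frag_of (m \<oplus>\<^bsub>A\<^esub> m', n) - frag_of (m, n) - frag_of (m', n) |m m' n.
         m \<in> carrier A \<and> m' \<in> carrier A \<and> n \<in> carrier N}" for z
    proof -
      from that obtain m m' n where z: "z = frag_of (m \<oplus>\<^bsub>A\<^esub> m', n) - frag_of (m, n) - frag_of (m', n)"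
        and mn: "m \<in> carrier A" "m' \<in> carrier A" "n \<in> carrier N" by blast
      have "h z = (b m n \<oplus>\<^bsub>W\<^esub> b m' n) \<ominus>\<^bsub>W\<^esub> b m n \<ominus>\<^bsub>W\<^esub> b m' n"
        using mn by (simp add: z hdiff h_tens frag_of_F A_add diff_F l)
      also have "\<dots> = \<zero>\<^bsub>W\<^esub>"
        using mn cl[OF mn(1,3)] cl[OF mn(2,3)]
        by (simp add: W.minus_eq W.a_ac W.r_neg W.r_neg1 W.r_neg2)
      finally show ?thesis using mn
        by (simp add: kernel_def) (simp add: z frag_of_F A_add diff_F)
    qed
    show "z \<in> kernel F (add_monoid W) h"
      if "z \<in> {frag_of (m, n \<oplus>\<^bsub>N\<^esub> n') - frag_of (m, n) - frag_of (m, n') |m n n'.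
         m \<in> carrier A \<and> n \<in> carrier N \<and> n' \<in> carrier N}" for z
    proof -
      from that obtain m n n' where z: "z = frag_of (m, n \<oplus>\<^bsub>N\<^esub> n') - frag_of (m, n) - frag_of (m, n')"
        and mn: "m \<in> carrier A" "n \<in> carrier N" "n' \<in> carrier N" by blast
      have "h z = (b m n \<oplus>\<^bsub>W\<^esub> b m n') \<ominus>\<^bsub>W\<^esub> b m n \<ominus>\<^bsub>W\<^esub> b m n'"
        using mn by (simp add: z hdiff h_tens frag_of_F N_add diff_F r)
      also have "\<dots> = \<zero>\<^bsub>W\<^esub>"
        using mn cl[OF mn(1,2)] cl[OF mn(1,3)]
        by (simp add: W.minus_eq W.a_ac W.r_neg W.r_neg1 W.r_neg2)
      finally show ?thesis using mn
        by (simp add: kernel_def) (simp add: z frag_of_F N_add diff_F)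
    qed
    show "z \<in> kernel F (add_monoid W) h"
      if "z \<in> {frag_of (m \<otimes>\<^bsub>A\<^esub> \<iota> b, n) - frag_of (m, b \<odot>\<^bsub>N\<^esub> n) |m b n.
         m \<in> carrier A \<and> b \<in> carrier B \<and> n \<in> carrier N}" for z
      using that by (auto simp: kernel_def hdiff h_tens frag_of_F A_mult N_smult diff_F bal cl W.minus_eq W.r_neg)
  qed
  define \<beta> where "\<beta> S = h (SOME z. z \<in> S)" for S
  have \<beta>: "\<beta> (R #>\<^bsub>F\<^esub> z) = h z" if z: "z \<in> carrier F" for z
  proof -
    have "z \<in> R #>\<^bsub>F\<^esub> z" by (simp add: group.rcos_self[OF group_F] z subgroup_R)
    hence "(SOME y. y \<in> R #>\<^bsub>F\<^esub> z) \<in> R #>\<^bsub>F\<^esub> z" by (rule someI)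
    then obtain y where y: "y \<in> R" "(SOME y. y \<in> R #>\<^bsub>F\<^esub> z) = y + z"
      by (auto simp: r_coset_def mult_F)
    have "y \<in> carrier F" "h y = \<zero>\<^bsub>W\<^esub>" using ker y by (auto simp: kernel_def)
    thus ?thesis unfolding \<beta>_def y(2) using z by (simp add: hadd hc)
  qed
  show thesis
  proof (rule that)
    show "\<beta> \<in> carrier T \<rightarrow> carrier W"
      using coset_ex \<beta> hc by fastforce
    show "\<beta> (x \<oplus>\<^bsub>T\<^esub> y) = \<beta> x \<oplus>\<^bsub>W\<^esub> \<beta> y" if xy: "x \<in> carrier T" "y \<in> carrier T" for x y
    proof -
      obtain u v where uv: "u \<in> carrier F" "v \<in> carrier F" "x = R #>\<^bsub>F\<^esub> u" "y = R #>\<^bsub>F\<^esub> v"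
        using xy coset_ex by meson
      show ?thesis unfolding uv(3,4) coset_add[OF uv(1,2), symmetric]
        by (simp add: \<beta> uv(1,2) hadd add_F)
    qed
    show "\<beta> (tens m n) = b m n" if "m \<in> carrier A" "n \<in> carrier N" for m n
      unfolding tens_def using that by (simp add: \<beta> frag_of_F h_tens)
  qed
qed

text \<open>The scalar action is defined by a union over the representatives of a coset. It coincides with
  the map that the universal property yields for \<open>(m, n) \<mapsto> am \<otimes> n\<close>, because both are the image of
  the same endomorphism of the free group; so the union runs over equal cosets.\<close>

lemma smult_additive:
  assumes "\<And>m. m \<in> carrier A \<Longrightarrow> a \<otimes>\<^bsub>A\<^esub> m \<in> carrier A"
    and "\<And>m m'. \<lbrakk>m \<in> carrier A; m' \<in> carrier A\<rbrakk> \<Longrightarrow> a \<otimes>\<^bsub>A\<^esub> (m \<oplus>\<^bsub>A\<^esub> m') = a \<otimes>\<^bsub>A\<^esub> m \<oplus>\<^bsub>A\<^esub> a \<otimes>\<^bsub>A\<^esub> m'"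
    and "\<And>m b. \<lbrakk>m \<in> carrier A; b \<in> carrier B\<rbrakk> \<Longrightarrow> a \<otimes>\<^bsub>A\<^esub> (m \<otimes>\<^bsub>A\<^esub> \<iota> b) = (a \<otimes>\<^bsub>A\<^esub> m) \<otimes>\<^bsub>A\<^esub> \<iota> b"
  shows "(\<lambda>S. a \<odot>\<^bsub>T\<^esub> S) \<in> carrier T \<rightarrow> carrier T"
    and "\<And>x y. \<lbrakk>x \<in> carrier T; y \<in> carrier T\<rbrakk> \<Longrightarrow> a \<odot>\<^bsub>T\<^esub> (x \<oplus>\<^bsub>T\<^esub> y) = a \<odot>\<^bsub>T\<^esub> x \<oplus>\<^bsub>T\<^esub> a \<odot>\<^bsub>T\<^esub> y"
    and "\<And>m n. \<lbrakk>m \<in> carrier A; n \<in> carrier N\<rbrakk> \<Longrightarrow> a \<odot>\<^bsub>T\<^esub> tens m n = tens (a \<otimes>\<^bsub>A\<^esub> m) n"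
proof -
  obtain \<beta> where \<beta>: "\<beta> \<in> carrier T \<rightarrow> carrier T"
    "\<And>x y. \<lbrakk>x \<in> carrier T; y \<in> carrier T\<rbrakk> \<Longrightarrow> \<beta> (x \<oplus>\<^bsub>T\<^esub> y) = \<beta> x \<oplus>\<^bsub>T\<^esub> \<beta> y"
    "\<And>m n. \<lbrakk>m \<in> carrier A; n \<in> carrier N\<rbrakk> \<Longrightarrow> \<beta> (tens m n) = tens (a \<otimes>\<^bsub>A\<^esub> m) n"
    by (rule lift[OF abelian_group_T, of "\<lambda>m n. tens (a \<otimes>\<^bsub>A\<^esub> m) n"])
      (auto simp: assms tens_closed tens_add_left tens_add_right tens_balanced)
  let ?L = "frag_extend (\<lambda>(m, n). frag_of (a \<otimes>\<^bsub>A\<^esub> m, n))"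
  have L: "?L z \<in> carrier F \<and> R #>\<^bsub>F\<^esub> ?L z = \<beta> (R #>\<^bsub>F\<^esub> z)" if "z \<in> carrier F" for z
    using that
  proof (induction rule: F_induct)
    case zero
    thus ?case by (simp add: zero_F coset_zero additive_zero[OF abelian_group_T abelian_group_T \<beta>(1,2)])
  next
    case (minus x y)
    thus ?case
      by (simp add: frag_extend_diff diff_F coset_diff coset_T
          additive_minus[OF abelian_group_T abelian_group_T \<beta>(1,2)])
  next
    case (frag_of m n)
    thus ?case using \<beta>(3)[of m n] by (simp add: assms frag_of_F tens_def)
  qed
  have eq: "a \<odot>\<^bsub>T\<^esub> S = \<beta> S" if S: "S \<in> carrier T" for S
  proof -
    obtain z0 where z0: "z0 \<in> carrier F" "S = R #>\<^bsub>F\<^esub> z0" using coset_ex S by blast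
    have "z0 \<in> S" by (simp add: z0 group.rcos_self[OF group_F] subgroup_R)
    moreover have "z \<in> carrier F \<and> R #>\<^bsub>F\<^esub> z = S" if "z \<in> S" for z
      using that z0 group.repr_independence[OF group_F that[unfolded z0(2)] z0(1) subgroup_R]
        subgroup.subset[OF subgroup_R]
      by (auto simp: r_coset_def mult_F intro: add_F)
    ultimately show ?thesis unfolding T_simps using L by auto
  qed
  show "(\<lambda>S. a \<odot>\<^bsub>T\<^esub> S) \<in> carrier T \<rightarrow> carrier T"
    using eq \<beta>(1) by auto
  show "a \<odot>\<^bsub>T\<^esub> (x \<oplus>\<^bsub>T\<^esub> y) = a \<odot>\<^bsub>T\<^esub> x \<oplus>\<^bsub>T\<^esub> a \<odot>\<^bsub>T\<^esub> y" if "x \<in> carrier T" "y \<in> carrier T" for x y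
    using that \<beta>(2) by (simp add: eq)
  show "a \<odot>\<^bsub>T\<^esub> tens m n = tens (a \<otimes>\<^bsub>A\<^esub> m) n" if "m \<in> carrier A" "n \<in> carrier N" for m n
    using that \<beta>(3) by (simp add: eq tens_closed)
qed

end

section \<open>The groupoid algebra\<close>

context category
begin

lemma Ide_arr:
  assumes "x \<in> Obj C" shows "Ide C x \<in> Arr C" "Dom C (Ide C x) = x" "Cod C (Ide C x) = x"
  using Ide_closed[OF assms] by (auto simp: homs_def)

lemma Cmp_arr:
  assumes "a \<in> Arr C" "b \<in> Arr C" "Dom C b = Cod C a"
  shows "b \<cdot> a \<in> Arr C" "Dom C (b \<cdot> a) = Dom C a" "Cod C (b \<cdot> a) = Cod C b"
  using Cmp_closed[of a "Dom C a" "Cod C a" b "Cod C b"] assms by (auto simp: homs_def)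

lemma Cmp_assoc_arr:
  assumes "a \<in> Arr C" "b \<in> Arr C" "c \<in> Arr C" "Dom C b = Cod C a" "Dom C c = Cod C b"
  shows "(c \<cdot> b) \<cdot> a = c \<cdot> (b \<cdot> a)"
  using Cmp_assoc[of a "Dom C a" "Cod C a" b "Cod C b" c "Cod C c"] assms by (auto simp: homs_def)

lemma Ide_left_arr: "\<lbrakk>a \<in> Arr C; Cod C a = y\<rbrakk> \<Longrightarrow> Ide C y \<cdot> a = a"
  using Ide_left[of a "Dom C a" y] by (auto simp: homs_def)

lemma Ide_right_arr: "\<lbrakk>a \<in> Arr C; Dom C a = x\<rbrakk> \<Longrightarrow> a \<cdot> Ide C x = a"
  using Ide_right[of a x "Cod C a"] by (auto simp: homs_def)

end

context groupoid
begin

lemma left_division: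
  assumes "q \<in> Arr C" "g \<in> Arr C" "Cod C g = Cod C q"
  obtains r where "r \<in> Arr C" "Cod C r = Dom C q" "q \<cdot> r = g"
proof -
  obtain q' where "inverse_arrows C q q'" using all_isos assms(1) by blast
  hence q': "q' \<in> Arr C" "Dom C q' = Cod C q" "Cod C q' = Dom C q" "q \<cdot> q' = Ide C (Cod C q)"
    by (auto simp: inverse_arrows_def homs_def)
  show thesis
    using assms q' by (intro that[of "q' \<cdot> g"])
      (simp_all add: Cmp_arr Cmp_assoc_arr[symmetric] Ide_left_arr)
qed

lemma left_cancel:
  assumes "q \<in> Arr C" "r \<in> Arr C" "r' \<in> Arr C" "Cod C r = Dom C q" "Cod C r' = Dom C q"
    and "q \<cdot> r = q \<cdot> r'"
  shows "r = r'"
proof -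
  obtain q' where "inverse_arrows C q q'" using all_isos assms(1) by blast
  hence q': "q' \<in> Arr C" "Dom C q' = Cod C q" "Cod C q' = Dom C q" "q' \<cdot> q = Ide C (Dom C q)"
    by (auto simp: inverse_arrows_def homs_def)
  have "(q' \<cdot> q) \<cdot> r = (q' \<cdot> q) \<cdot> r'"
    using assms q'(1-3) by (simp add: Cmp_assoc_arr)
  thus ?thesis using assms q'(4) by (simp add: Ide_left_arr)
qed

end

text \<open>The multiple \<open>c e\<^sub>g\<close> of a basis element of the groupoid algebra.\<close>

definition single ::
  "('k, 'r) ring_scheme \<Rightarrow> ('o, 'a, 'z) category_scheme \<Rightarrow> 'k \<Rightarrow> 'a \<Rightarrow> 'a \<Rightarrow> 'k" where
  "single K \<Gamma> c g = (\<lambda>h\<in>Arr \<Gamma>. if h = g then c else \<zero>\<^bsub>K\<^esub>)"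

lemma basis_elt_single: "basis_elt K \<Gamma> g = single K \<Gamma> \<one>\<^bsub>K\<^esub> g"
  by (simp add: basis_elt_def single_def)

locale finite_groupoid = K?: field K + groupoid \<Gamma>
  for K :: "('k, 'r) ring_scheme" and \<Gamma> :: "('o, 'a, 'z) category_scheme" +
  assumes finite_Arr: "finite (Arr \<Gamma>)"
begin

abbreviation "A \<equiv> groupoid_algebra K \<Gamma>"

lemma carrier_A: "carrier A = Arr \<Gamma> \<rightarrow>\<^sub>E carrier K"
  by (simp add: groupoid_algebra_def)

lemma add_A: "a \<oplus>\<^bsub>A\<^esub> b = (\<lambda>g\<in>Arr \<Gamma>. a g \<oplus>\<^bsub>K\<^esub> b g)"
  by (simp add: groupoid_algebra_def)

lemma zero_A: "\<zero>\<^bsub>A\<^esub> = (\<lambda>g\<in>Arr \<Gamma>. \<zero>\<^bsub>K\<^esub>)"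
  by (simp add: groupoid_algebra_def)

lemma app_A: "\<lbrakk>a \<in> carrier A; g \<in> Arr \<Gamma>\<rbrakk> \<Longrightarrow> a g \<in> carrier K"
  by (auto simp: carrier_A)

lemma add_A_closed: "\<lbrakk>a \<in> carrier A; b \<in> carrier A\<rbrakk> \<Longrightarrow> a \<oplus>\<^bsub>A\<^esub> b \<in> carrier A"
  by (auto simp: carrier_A add_A)

lemma A_eqI: "\<lbrakk>a \<in> carrier A; b \<in> carrier A; \<And>g. g \<in> Arr \<Gamma> \<Longrightarrow> a g = b g\<rbrakk> \<Longrightarrow> a = b"
  unfolding carrier_A by (rule PiE_ext)

lemma single_closed: "c \<in> carrier K \<Longrightarrow> single K \<Gamma> c p \<in> carrier A"
  by (auto simp: carrier_A single_def)

definition factorizations :: "'a \<Rightarrow> ('a \<times> 'a) set" where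
  "factorizations g = {(p, q). p \<in> Arr \<Gamma> \<and> q \<in> Arr \<Gamma> \<and> Dom \<Gamma> p = Cod \<Gamma> q \<and> p \<cdot>\<^bsub>\<Gamma>\<^esub> q = g}"

lemma factorizations_Cod: "pq \<in> factorizations g \<Longrightarrow> Cod \<Gamma> (fst pq) = Cod \<Gamma> g"
  by (auto simp: factorizations_def Cmp_arr)

lemma finite_factorizations: "finite (factorizations g)"
  by (rule finite_subset[of _ "Arr \<Gamma> \<times> Arr \<Gamma>"]) (auto simp: factorizations_def finite_Arr)

lemma mult_A:
  "g \<in> Arr \<Gamma> \<Longrightarrow> (a \<otimes>\<^bsub>A\<^esub> b) g = (\<Oplus>\<^bsub>K\<^esub>pq\<in>factorizations g. a (fst pq) \<otimes>\<^bsub>K\<^esub> b (snd pq))"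
  by (simp add: groupoid_algebra_def factorizations_def)

lemma mult_A_term:
  "\<lbrakk>a \<in> carrier A; b \<in> carrier A; pq \<in> factorizations g\<rbrakk> \<Longrightarrow> a (fst pq) \<otimes>\<^bsub>K\<^esub> b (snd pq) \<in> carrier K"
  by (auto simp: factorizations_def app_A)

lemma mult_A_closed:
  assumes "a \<in> carrier A" "b \<in> carrier A" shows "a \<otimes>\<^bsub>A\<^esub> b \<in> carrier A"
proof -
  have "(a \<otimes>\<^bsub>A\<^esub> b) g \<in> carrier K" if "g \<in> Arr \<Gamma>" for g
    unfolding mult_A[OF that] by (rule K.finsum_closed) (use mult_A_term[OF assms] in auto)
  thus ?thesis by (auto simp: carrier_A groupoid_algebra_def)
qed

lemma mult_A_distrib:
  assumes "a \<in> carrier A" "b \<in> carrier A" "b' \<in> carrier A"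
  shows "a \<otimes>\<^bsub>A\<^esub> (b \<oplus>\<^bsub>A\<^esub> b') = a \<otimes>\<^bsub>A\<^esub> b \<oplus>\<^bsub>A\<^esub> a \<otimes>\<^bsub>A\<^esub> b'"
proof (rule A_eqI)
  fix g assume g: "g \<in> Arr \<Gamma>"
  have "(a \<otimes>\<^bsub>A\<^esub> (b \<oplus>\<^bsub>A\<^esub> b')) g
      = (\<Oplus>\<^bsub>K\<^esub>pq\<in>factorizations g. a (fst pq) \<otimes>\<^bsub>K\<^esub> b (snd pq) \<oplus>\<^bsub>K\<^esub> a (fst pq) \<otimes>\<^bsub>K\<^esub> b' (snd pq))"
    unfolding mult_A[OF g]
    by (rule K.finsum_cong')
      (auto simp: factorizations_def app_A assms add_A K.r_distr)
  also have "\<dots> = (a \<otimes>\<^bsub>A\<^esub> b \<oplus>\<^bsub>A\<^esub> a \<otimes>\<^bsub>A\<^esub> b') g"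
    using g mult_A_term[OF assms(1,2)] mult_A_term[OF assms(1,3)]
    by (subst K.finsum_addf) (auto simp: add_A mult_A)
  finally show "(a \<otimes>\<^bsub>A\<^esub> (b \<oplus>\<^bsub>A\<^esub> b')) g = (a \<otimes>\<^bsub>A\<^esub> b \<oplus>\<^bsub>A\<^esub> a \<otimes>\<^bsub>A\<^esub> b') g" .
qed (intro mult_A_closed add_A_closed assms)+

lemma single_mult:
  assumes "c \<in> carrier K" "q \<in> Arr \<Gamma>" "r \<in> Arr \<Gamma>" "Cod \<Gamma> r = Dom \<Gamma> q" "x \<in> carrier A"
  shows "(single K \<Gamma> c q \<otimes>\<^bsub>A\<^esub> x) (q \<cdot>\<^bsub>\<Gamma>\<^esub> r) = c \<otimes>\<^bsub>K\<^esub> x r"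
proof -
  have g: "q \<cdot>\<^bsub>\<Gamma>\<^esub> r \<in> Arr \<Gamma>" using assms by (simp add: Cmp_arr)
  have "(single K \<Gamma> c q \<otimes>\<^bsub>A\<^esub> x) (q \<cdot>\<^bsub>\<Gamma>\<^esub> r) = single K \<Gamma> c q (fst (q, r)) \<otimes>\<^bsub>K\<^esub> x (snd (q, r))"
    unfolding mult_A[OF g]
  proof (rule K.finsum_single[OF finite_factorizations])
    show "single K \<Gamma> c q (fst k) \<otimes>\<^bsub>K\<^esub> x (snd k) = \<zero>\<^bsub>K\<^esub>"
      if "k \<in> factorizations (q \<cdot>\<^bsub>\<Gamma>\<^esub> r)" "k \<noteq> (q, r)" for k
      using that left_cancel[of q "snd k" r] assms
      by (auto simp: factorizations_def single_def app_A)
  qed (use assms in \<open>auto simp: factorizations_def single_def app_A\<close>)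
  thus ?thesis using assms by (simp add: single_def)
qed

lemma single_mult_off:
  assumes "c \<in> carrier K" "g \<in> Arr \<Gamma>" "Cod \<Gamma> g \<noteq> Cod \<Gamma> q" "x \<in> carrier A"
  shows "(single K \<Gamma> c q \<otimes>\<^bsub>A\<^esub> x) g = \<zero>\<^bsub>K\<^esub>"
  unfolding mult_A[OF assms(2)]
  by (rule K.add.finprod_one_eqI) (use assms in \<open>auto simp: factorizations_def single_def app_A Cmp_arr\<close>)

text \<open>Left multiplication by \<open>e\<^sub>q\<close> moves the coefficient at \<open>g\<close> to \<open>qg\<close>, so this case of associativity
  is the reindexing \<open>(p, r) \<mapsto> (qp, r)\<close> of the factorizations of \<open>g\<close> by those of \<open>qg\<close>.\<close>

lemma single_mult_assoc:
  assumes c: "c \<in> carrier K" and q: "q \<in> Arr \<Gamma>" and m: "m \<in> carrier A" and x: "x \<in> carrier A"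
  shows "single K \<Gamma> c q \<otimes>\<^bsub>A\<^esub> (m \<otimes>\<^bsub>A\<^esub> x) = (single K \<Gamma> c q \<otimes>\<^bsub>A\<^esub> m) \<otimes>\<^bsub>A\<^esub> x" (is "?l = ?r")
proof (rule A_eqI)
  fix g assume g: "g \<in> Arr \<Gamma>"
  show "?l g = ?r g"
  proof (cases "Cod \<Gamma> g = Cod \<Gamma> q")
    case True
    then obtain g' where g': "g' \<in> Arr \<Gamma>" "Cod \<Gamma> g' = Dom \<Gamma> q" "q \<cdot>\<^bsub>\<Gamma>\<^esub> g' = g"
      using left_division[OF q g] by blast
    let ?s = "\<lambda>(p, r). (q \<cdot>\<^bsub>\<Gamma>\<^esub> p, r)"
    have img: "?s ` factorizations g' = factorizations g"
    proof (intro equalityI subsetI)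
      fix k assume "k \<in> ?s ` factorizations g'"
      thus "k \<in> factorizations g"
        using q g' by (auto simp: factorizations_def Cmp_arr Cmp_assoc_arr)
    next
      fix k assume "k \<in> factorizations g"
      then obtain p r where k: "k = (p, r)" "p \<in> Arr \<Gamma>" "r \<in> Arr \<Gamma>" "Dom \<Gamma> p = Cod \<Gamma> r" "p \<cdot>\<^bsub>\<Gamma>\<^esub> r = g"
        by (auto simp: factorizations_def)
      have "Cod \<Gamma> p = Cod \<Gamma> q" using k True by (auto simp: Cmp_arr)
      then obtain p' where p': "p' \<in> Arr \<Gamma>" "Cod \<Gamma> p' = Dom \<Gamma> q" "q \<cdot>\<^bsub>\<Gamma>\<^esub> p' = p"
        using left_division[OF q k(2)] by blast
      have dp: "Dom \<Gamma> p' = Cod \<Gamma> r" using k(4) p' q by (auto simp: Cmp_arr)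
      have "p' \<cdot>\<^bsub>\<Gamma>\<^esub> r = g'"
        by (rule left_cancel[OF q]) (use k p' g' q dp in \<open>auto simp: Cmp_arr Cmp_assoc_arr[symmetric]\<close>)
      hence "(p', r) \<in> factorizations g'" using p' k dp by (auto simp: factorizations_def)
      thus "k \<in> ?s ` factorizations g'" using k p' by force
    qed
    have inj: "inj_on ?s (factorizations g')"
    proof (rule inj_onI)
      fix k k' assume *: "k \<in> factorizations g'" "k' \<in> factorizations g'" "?s k = ?s k'"
      obtain p r p' r' where k: "k = (p, r)" "k' = (p', r')" by (cases k, cases k')
      have p: "p \<in> Arr \<Gamma>" "p' \<in> Arr \<Gamma>" "Cod \<Gamma> p = Dom \<Gamma> q" "Cod \<Gamma> p' = Dom \<Gamma> q"
        using factorizations_Cod[OF *(1)] factorizations_Cod[OF *(2)] g' *(1,2)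
        by (simp_all add: k factorizations_def)
      have "p = p'"
        using left_cancel[OF q p] *(3) by (simp add: k)
      thus "k = k'" using *(3) by (simp add: k)
    qed
    have sm: "(single K \<Gamma> c q \<otimes>\<^bsub>A\<^esub> m) (q \<cdot>\<^bsub>\<Gamma>\<^esub> p) = c \<otimes>\<^bsub>K\<^esub> m p"
      if "(p, r) \<in> factorizations g'" for p r
      using that g' by (intro single_mult[OF c q _ _ m]) (auto simp: factorizations_def Cmp_arr)
    have "?r g = (\<Oplus>\<^bsub>K\<^esub>pq\<in>?s ` factorizations g'. (single K \<Gamma> c q \<otimes>\<^bsub>A\<^esub> m) (fst pq) \<otimes>\<^bsub>K\<^esub> x (snd pq))"
      unfolding mult_A[OF g] img ..
    also have "\<dots> = (\<Oplus>\<^bsub>K\<^esub>pq\<in>factorizations g'.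
        (single K \<Gamma> c q \<otimes>\<^bsub>A\<^esub> m) (fst (?s pq)) \<otimes>\<^bsub>K\<^esub> x (snd (?s pq)))"
      by (rule K.finsum_reindex[OF _ inj])
        (unfold img, use mult_A_term[OF mult_A_closed[OF single_closed[OF c] m] x] in auto)
    also have "\<dots> = (\<Oplus>\<^bsub>K\<^esub>pq\<in>factorizations g'. c \<otimes>\<^bsub>K\<^esub> (m (fst pq) \<otimes>\<^bsub>K\<^esub> x (snd pq)))"
      by (rule K.finsum_cong') (auto simp: sm, auto simp: factorizations_def app_A c m x K.m_assoc)
    also have "\<dots> = c \<otimes>\<^bsub>K\<^esub> (m \<otimes>\<^bsub>A\<^esub> x) g'"
      unfolding mult_A[OF g'(1)]
      by (rule K.finsum_rdistr[OF finite_factorizations c, symmetric])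
        (use mult_A_term[OF m x] in auto)
    also have "\<dots> = ?l g"
      using single_mult[OF c q g'(1,2) mult_A_closed[OF m x]] g'(3) by simp
    finally show ?thesis by simp
  next
    case False
    have "?r g = \<zero>\<^bsub>K\<^esub>" unfolding mult_A[OF g]
    proof (rule K.add.finprod_one_eqI)
      fix pq assume pq: "pq \<in> factorizations g"
      hence "(single K \<Gamma> c q \<otimes>\<^bsub>A\<^esub> m) (fst pq) = \<zero>\<^bsub>K\<^esub>"
        using False by (intro single_mult_off[OF c _ _ m]) (auto simp: factorizations_def Cmp_arr)
      thus "(single K \<Gamma> c q \<otimes>\<^bsub>A\<^esub> m) (fst pq) \<otimes>\<^bsub>K\<^esub> x (snd pq) = \<zero>\<^bsub>K\<^esub>"
        using pq x by (auto simp: factorizations_def app_A)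
    qed
    thus ?thesis using single_mult_off[OF c g False mult_A_closed[OF m x]] by simp
  qed
qed (intro mult_A_closed single_closed assms)+

text \<open>Modules over the groupoid algebra are \<open>K\<close>-spaces through these multiples of its unit.\<close>

definition scalar :: "'k \<Rightarrow> 'a \<Rightarrow> 'k" where
  "scalar c = c \<odot>\<^bsub>A\<^esub> \<one>\<^bsub>A\<^esub>"

lemma scalar_app:
  "\<lbrakk>c \<in> carrier K; g \<in> Arr \<Gamma>\<rbrakk> \<Longrightarrow> scalar c g = (if g \<in> Ide \<Gamma> ` Obj \<Gamma> then c else \<zero>\<^bsub>K\<^esub>)"
  by (simp add: scalar_def groupoid_algebra_def)

lemma scalar_closed: "c \<in> carrier K \<Longrightarrow> scalar c \<in> carrier A"
  by (auto simp: scalar_def groupoid_algebra_def)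

lemma scalar_mult:
  assumes c: "c \<in> carrier K" and m: "m \<in> carrier A" and g: "g \<in> Arr \<Gamma>"
  shows "(scalar c \<otimes>\<^bsub>A\<^esub> m) g = c \<otimes>\<^bsub>K\<^esub> m g"
proof -
  let ?i = "(Ide \<Gamma> (Cod \<Gamma> g), g)"
  have i: "?i \<in> factorizations g"
    using g Cod_closed by (auto simp: factorizations_def Ide_arr Ide_left_arr)
  have "(scalar c \<otimes>\<^bsub>A\<^esub> m) g = scalar c (fst ?i) \<otimes>\<^bsub>K\<^esub> m (snd ?i)"
    unfolding mult_A[OF g]
  proof (rule K.finsum_single[OF finite_factorizations i])
    show "scalar c (fst k) \<otimes>\<^bsub>K\<^esub> m (snd k) = \<zero>\<^bsub>K\<^esub>" if "k \<in> factorizations g" "k \<noteq> ?i" for k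
    proof (cases "fst k \<in> Ide \<Gamma> ` Obj \<Gamma>")
      case True
      then obtain y where y: "y \<in> Obj \<Gamma>" "fst k = Ide \<Gamma> y" by auto
      hence "y = Cod \<Gamma> (snd k)" "snd k \<in> Arr \<Gamma>" "fst k \<cdot>\<^bsub>\<Gamma>\<^esub> snd k = g"
        using that(1) by (auto simp: factorizations_def Ide_arr)
      hence "k = ?i" using y by (cases k) (auto simp: Ide_left_arr)
      thus ?thesis using that(2) by simp
    next
      case False
      thus ?thesis using that(1) c m by (auto simp: factorizations_def scalar_app app_A)
    qed
  qed (rule mult_A_term[OF scalar_closed[OF c] m i])
  thus ?thesis using c g by (simp add: scalar_app Ide_arr Cod_closed)
qed

lemma scalar_mult_assoc:
  assumes c: "c \<in> carrier K" and m: "m \<in> carrier A" and x: "x \<in> carrier A"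
  shows "scalar c \<otimes>\<^bsub>A\<^esub> (m \<otimes>\<^bsub>A\<^esub> x) = (scalar c \<otimes>\<^bsub>A\<^esub> m) \<otimes>\<^bsub>A\<^esub> x" (is "?l = ?r")
proof (rule A_eqI)
  fix g assume g: "g \<in> Arr \<Gamma>"
  have "?r g = (\<Oplus>\<^bsub>K\<^esub>pq\<in>factorizations g. c \<otimes>\<^bsub>K\<^esub> (m (fst pq) \<otimes>\<^bsub>K\<^esub> x (snd pq)))"
    unfolding mult_A[OF g]
    by (rule K.finsum_cong') (auto simp: factorizations_def scalar_mult app_A c m x K.m_assoc)
  also have "\<dots> = c \<otimes>\<^bsub>K\<^esub> (m \<otimes>\<^bsub>A\<^esub> x) g"
    unfolding mult_A[OF g]
    by (rule K.finsum_rdistr[OF finite_factorizations c, symmetric]) (use mult_A_term[OF m x] in auto)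
  also have "\<dots> = ?l g" by (simp add: scalar_mult[OF c mult_A_closed[OF m x] g])
  finally show "?l g = ?r g" by simp
qed (intro mult_A_closed scalar_closed assms)+

lemma single_mult_single:
  assumes "c \<in> carrier K" "c' \<in> carrier K" "q \<in> Arr \<Gamma>" "p \<in> Arr \<Gamma>" "Cod \<Gamma> p = Dom \<Gamma> q"
  shows "single K \<Gamma> c q \<otimes>\<^bsub>A\<^esub> single K \<Gamma> c' p = single K \<Gamma> (c \<otimes>\<^bsub>K\<^esub> c') (q \<cdot>\<^bsub>\<Gamma>\<^esub> p)" (is "?l = ?r")
proof (rule A_eqI)
  fix g assume g: "g \<in> Arr \<Gamma>"
  show "?l g = ?r g"
  proof (cases "Cod \<Gamma> g = Cod \<Gamma> q")
    case True
    then obtain g' where g': "g' \<in> Arr \<Gamma>" "Cod \<Gamma> g' = Dom \<Gamma> q" "q \<cdot>\<^bsub>\<Gamma>\<^esub> g' = g"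
      using left_division[OF assms(3) g] by blast
    have "?l g = c \<otimes>\<^bsub>K\<^esub> single K \<Gamma> c' p g'"
      using single_mult[OF assms(1,3) g'(1,2) single_closed[OF assms(2)]] g'(3) by simp
    moreover have "g' = p \<longleftrightarrow> g = q \<cdot>\<^bsub>\<Gamma>\<^esub> p"
      using left_cancel[OF assms(3) g'(1) assms(4) g'(2) assms(5)] g'(3) by auto
    ultimately show ?thesis using g g' assms by (auto simp: single_def)
  next
    case False
    hence "g \<noteq> q \<cdot>\<^bsub>\<Gamma>\<^esub> p" using assms by (auto simp: Cmp_arr)
    thus ?thesis using single_mult_off[OF assms(1) g False single_closed[OF assms(2)]] g
      by (simp add: single_def)
  qed
qed (intro mult_A_closed single_closed assms K.m_closed)+

lemma scalar_mult_single:
  assumes "c \<in> carrier K" "p \<in> Arr \<Gamma>"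
  shows "scalar c \<otimes>\<^bsub>A\<^esub> single K \<Gamma> \<one>\<^bsub>K\<^esub> p = single K \<Gamma> c p"
  using assms
  by (intro A_eqI mult_A_closed scalar_closed single_closed K.one_closed)
    (auto simp: scalar_mult single_closed, auto simp: single_def)

end

section \<open>Recognizing an induced representation\<close>

text \<open>The data that identify \<open>\<pi>'\<close> as the representation induced by \<open>\<pi>\<close>. Together with \<open>j\<close>, the arrows
  in \<open>P s\<close> present \<open>\<pi>'(s)\<close> as the direct sum of the spaces \<open>\<pi>(t)\<close> over the arrows \<open>p : t \<rightarrow> s\<close> in
  \<open>P s\<close>: the inclusion of the summand of \<open>p\<close> is \<open>\<pi>'(p) \<circ> j\<close> and the projection onto it is \<open>pr p\<close>.
  Through the injective maps \<open>j\<close>, the operators of \<open>\<pi>\<close> inherit linearity and functoriality from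
  those of \<open>\<pi>'\<close>.\<close>

locale induction_data = representation K \<Gamma> \<pi>' + \<Delta>: category \<Delta>
  for K :: "('k, 'r) ring_scheme" and \<Gamma> :: "('o, 'a, 'z) category_scheme"
    and \<Delta> :: "('o, 'a, 'y) category_scheme" and \<pi>' :: "('o, 'a, 'k, 'w) representation" +
  fixes \<pi> :: "('o, 'a, 'k, 'v) representation"
    and j :: "'o \<Rightarrow> 'v \<Rightarrow> 'w" and P :: "'o \<Rightarrow> 'a set" and pr :: "'a \<Rightarrow> 'w \<Rightarrow> 'v"
  assumes finite_arrows: "finite (Arr \<Gamma>)"
    and Obj_sub: "Obj \<Delta> \<subseteq> Obj \<Gamma>" and Arr_sub: "Arr \<Delta> \<subseteq> Arr \<Gamma>"
    and Dom_sub: "d \<in> Arr \<Delta> \<Longrightarrow> Dom \<Delta> d = Dom \<Gamma> d"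
    and Cod_sub: "d \<in> Arr \<Delta> \<Longrightarrow> Cod \<Delta> d = Cod \<Gamma> d"
    and Ide_sub: "t \<in> Obj \<Delta> \<Longrightarrow> Ide \<Delta> t = Ide \<Gamma> t"
    and \<pi>_module: "t \<in> Obj \<Delta> \<Longrightarrow> module K (space \<pi> t)"
    and \<pi>_closed: "\<lbrakk>d \<in> Arr \<Delta>; v \<in> carrier (space \<pi> (Dom \<Gamma> d))\<rbrakk> \<Longrightarrow>
        rmap \<pi> d v \<in> carrier (space \<pi> (Cod \<Gamma> d))"
    and j_linear: "t \<in> Obj \<Delta> \<Longrightarrow> j t \<in> linear_maps K (space \<pi> t) (space \<pi>' t)"
    and j_inj: "t \<in> Obj \<Delta> \<Longrightarrow> inj_on (j t) (carrier (space \<pi> t))"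
    and j_equivariant: "\<lbrakk>d \<in> Arr \<Delta>; v \<in> carrier (space \<pi> (Dom \<Gamma> d))\<rbrakk> \<Longrightarrow>
        j (Cod \<Gamma> d) (rmap \<pi> d v) = rmap \<pi>' d (j (Dom \<Gamma> d) v)"
    and P_arr: "\<lbrakk>s \<in> Obj \<Gamma>; p \<in> P s\<rbrakk> \<Longrightarrow> p \<in> Arr \<Gamma> \<and> Cod \<Gamma> p = s \<and> Dom \<Gamma> p \<in> Obj \<Delta>"
    and P_factor: "\<lbrakk>g \<in> Arr \<Gamma>; Dom \<Gamma> g \<in> Obj \<Delta>\<rbrakk> \<Longrightarrow>
        \<exists>p\<in>P (Cod \<Gamma> g). \<exists>d\<in>Arr \<Delta>. Cod \<Gamma> d = Dom \<Gamma> p \<and> p \<cdot>\<^bsub>\<Gamma>\<^esub> d = g"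
    and pr_closed: "\<lbrakk>s \<in> Obj \<Gamma>; p \<in> P s; w \<in> carrier (space \<pi>' s)\<rbrakk> \<Longrightarrow>
        pr p w \<in> carrier (space \<pi> (Dom \<Gamma> p))"
    and pr_add: "\<lbrakk>s \<in> Obj \<Gamma>; p \<in> P s; w \<in> carrier (space \<pi>' s); w' \<in> carrier (space \<pi>' s)\<rbrakk> \<Longrightarrow>
        pr p (w \<oplus>\<^bsub>space \<pi>' s\<^esub> w') = pr p w \<oplus>\<^bsub>space \<pi> (Dom \<Gamma> p)\<^esub> pr p w'"
    and pr_same: "\<lbrakk>s \<in> Obj \<Gamma>; p \<in> P s; v \<in> carrier (space \<pi> (Dom \<Gamma> p))\<rbrakk> \<Longrightarrow>
        pr p (rmap \<pi>' p (j (Dom \<Gamma> p) v)) = v"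
    and pr_other: "\<lbrakk>s \<in> Obj \<Gamma>; p \<in> P s; p' \<in> P s; p \<noteq> p'; v \<in> carrier (space \<pi> (Dom \<Gamma> p'))\<rbrakk> \<Longrightarrow>
        pr p (rmap \<pi>' p' (j (Dom \<Gamma> p') v)) = \<zero>\<^bsub>space \<pi> (Dom \<Gamma> p)\<^esub>"
    and pr_joint: "\<lbrakk>s \<in> Obj \<Gamma>; w \<in> carrier (space \<pi>' s);
        \<And>p. p \<in> P s \<Longrightarrow> pr p w = \<zero>\<^bsub>space \<pi> (Dom \<Gamma> p)\<^esub>\<rbrakk> \<Longrightarrow> w = \<zero>\<^bsub>space \<pi>' s\<^esub>"
begin

abbreviation "U t \<equiv> carrier (space \<pi> t)"
abbreviation "W s \<equiv> carrier (space \<pi>' s)"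

sublocale finite_groupoid K \<Gamma>
  by (simp add: finite_groupoid_def finite_groupoid_axioms_def field_axioms groupoid_axioms finite_arrows)

abbreviation "B \<equiv> groupoid_algebra K \<Delta>"
abbreviation "\<iota> \<equiv> groupoid_algebra_inclusion K \<Delta> \<Gamma>"
abbreviation "N \<equiv> rep_module \<Delta> \<pi>"

lemma finite_Arr_\<Delta>: "finite (Arr \<Delta>)"
  using Arr_sub finite_arrows finite_subset by blast

lemma finite_P: "s \<in> Obj \<Gamma> \<Longrightarrow> finite (P s)"
  by (rule finite_subset[OF _ finite_arrows]) (use P_arr in blast)

lemma \<pi>_abelian: "t \<in> Obj \<Delta> \<Longrightarrow> abelian_group (space \<pi> t)"
  using \<pi>_module module.axioms(2) by blast

lemma \<pi>'_abelian: "s \<in> Obj \<Gamma> \<Longrightarrow> abelian_group (space \<pi>' s)"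
  using space_module module.axioms(2) by blast

lemma Dom_\<Delta>: "d \<in> Arr \<Delta> \<Longrightarrow> Dom \<Gamma> d \<in> Obj \<Delta>"
  using \<Delta>.Dom_closed Dom_sub by fastforce

lemma Cod_\<Delta>: "d \<in> Arr \<Delta> \<Longrightarrow> Cod \<Gamma> d \<in> Obj \<Delta>"
  using \<Delta>.Cod_closed Cod_sub by fastforce

lemma j_closed: "\<lbrakk>t \<in> Obj \<Delta>; v \<in> U t\<rbrakk> \<Longrightarrow> j t v \<in> W t"
  using j_linear[of t] by (auto simp: linear_maps_def)

lemma j_add: "\<lbrakk>t \<in> Obj \<Delta>; v \<in> U t; w \<in> U t\<rbrakk> \<Longrightarrow>
    j t (v \<oplus>\<^bsub>space \<pi> t\<^esub> w) = j t v \<oplus>\<^bsub>space \<pi>' t\<^esub> j t w"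
  using j_linear by (auto simp: linear_maps_def)

lemma j_smult: "\<lbrakk>t \<in> Obj \<Delta>; c \<in> carrier K; v \<in> U t\<rbrakk> \<Longrightarrow>
    j t (c \<odot>\<^bsub>space \<pi> t\<^esub> v) = c \<odot>\<^bsub>space \<pi>' t\<^esub> j t v"
  using j_linear by (auto simp: linear_maps_def)

lemma rmap_closed: "\<lbrakk>p \<in> Arr \<Gamma>; w \<in> W (Dom \<Gamma> p)\<rbrakk> \<Longrightarrow>
    rmap \<pi>' p w \<in> W (Cod \<Gamma> p)"
  using rmap_linear[of p "Dom \<Gamma> p" "Cod \<Gamma> p"] by (auto simp: linear_maps_def homs_def)

lemma rmap_add: "\<lbrakk>p \<in> Arr \<Gamma>; w \<in> W (Dom \<Gamma> p); w' \<in> W (Dom \<Gamma> p)\<rbrakk> \<Longrightarrow>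
    rmap \<pi>' p (w \<oplus>\<^bsub>space \<pi>' (Dom \<Gamma> p)\<^esub> w') = rmap \<pi>' p w \<oplus>\<^bsub>space \<pi>' (Cod \<Gamma> p)\<^esub> rmap \<pi>' p w'"
  using rmap_linear[of p "Dom \<Gamma> p" "Cod \<Gamma> p"] by (auto simp: linear_maps_def homs_def)

lemma rmap_smult: "\<lbrakk>p \<in> Arr \<Gamma>; c \<in> carrier K; w \<in> W (Dom \<Gamma> p)\<rbrakk> \<Longrightarrow>
    rmap \<pi>' p (c \<odot>\<^bsub>space \<pi>' (Dom \<Gamma> p)\<^esub> w) = c \<odot>\<^bsub>space \<pi>' (Cod \<Gamma> p)\<^esub> rmap \<pi>' p w"
  using rmap_linear[of p "Dom \<Gamma> p" "Cod \<Gamma> p"] by (auto simp: linear_maps_def homs_def)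

lemma rmap_Cmp_arr: "\<lbrakk>a \<in> Arr \<Gamma>; b \<in> Arr \<Gamma>; Dom \<Gamma> b = Cod \<Gamma> a; w \<in> W (Dom \<Gamma> a)\<rbrakk> \<Longrightarrow>
    rmap \<pi>' (b \<cdot>\<^bsub>\<Gamma>\<^esub> a) w = rmap \<pi>' b (rmap \<pi>' a w)"
  using rmap_Cmp[of a "Dom \<Gamma> a" "Cod \<Gamma> a" b "Cod \<Gamma> b" w] by (auto simp: homs_def)

text \<open>The maps \<open>j\<close> are injective, so the unit law of \<open>\<pi>'\<close> passes to \<open>\<pi>\<close>.\<close>

lemma \<pi>_Ide:
  assumes "t \<in> Obj \<Delta>" "v \<in> U t" shows "rmap \<pi> (Ide \<Gamma> t) v = v"
proof -
  have t: "t \<in> Obj \<Gamma>" "Ide \<Gamma> t \<in> Arr \<Delta>"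
    using assms Obj_sub \<Delta>.Ide_arr Ide_sub by fastforce+
  have "j t (rmap \<pi> (Ide \<Gamma> t) v) = j t v"
    using j_equivariant[OF t(2)] assms t rmap_Ide[OF t(1) j_closed] by (simp add: Ide_arr)
  thus ?thesis
    using j_inj[OF assms(1)] \<pi>_closed[OF t(2)] assms t(1) by (auto simp: inj_on_def Ide_arr)
qed

abbreviation "\<delta> t v \<equiv> (\<lambda>x\<in>Obj \<Delta>. if x = t then v else \<zero>\<^bsub>space \<pi> x\<^esub>)"

lemma carrier_N: "carrier N = (\<Pi>\<^sub>E x\<in>Obj \<Delta>. U x)"
  by (simp add: rep_module_def)

lemma add_N: "v \<oplus>\<^bsub>N\<^esub> w = (\<lambda>x\<in>Obj \<Delta>. v x \<oplus>\<^bsub>space \<pi> x\<^esub> w x)"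
  by (simp add: rep_module_def)

lemma app_N: "\<lbrakk>n \<in> carrier N; t \<in> Obj \<Delta>\<rbrakk> \<Longrightarrow> n t \<in> U t"
  by (auto simp: carrier_N)

lemma N_eqI: "\<lbrakk>n \<in> carrier N; n' \<in> carrier N; \<And>t. t \<in> Obj \<Delta> \<Longrightarrow> n t = n' t\<rbrakk> \<Longrightarrow> n = n'"
  unfolding carrier_N by (rule PiE_ext)

lemma zero_\<pi>: "t \<in> Obj \<Delta> \<Longrightarrow> \<zero>\<^bsub>space \<pi> t\<^esub> \<in> U t"
  by (rule abelian_monoid.zero_closed[OF abelian_group.axioms(1)[OF \<pi>_abelian]])

lemma \<delta>_closed: "v \<in> U t \<Longrightarrow> \<delta> t v \<in> carrier N"
  by (auto simp: carrier_N zero_\<pi>)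

lemma carrier_B: "carrier B = Arr \<Delta> \<rightarrow>\<^sub>E carrier K"
  by (simp add: groupoid_algebra_def)

lemma app_B: "\<lbrakk>b \<in> carrier B; d \<in> Arr \<Delta>\<rbrakk> \<Longrightarrow> b d \<in> carrier K"
  by (auto simp: carrier_B)

lemma smult_\<pi>_closed: "\<lbrakk>t \<in> Obj \<Delta>; c \<in> carrier K; v \<in> U t\<rbrakk> \<Longrightarrow> c \<odot>\<^bsub>space \<pi> t\<^esub> v \<in> U t"
  by (rule module.smult_closed[OF \<pi>_module])

lemma smult_N_term:
  "\<lbrakk>b \<in> carrier B; n \<in> carrier N; d \<in> Arr \<Delta>\<rbrakk> \<Longrightarrow>
    b d \<odot>\<^bsub>space \<pi> (Cod \<Gamma> d)\<^esub> rmap \<pi> d (n (Dom \<Gamma> d)) \<in> U (Cod \<Gamma> d)"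
  by (intro smult_\<pi>_closed \<pi>_closed Cod_\<Delta> app_B app_N Dom_\<Delta>)

lemma smult_N:
  assumes "y \<in> Obj \<Delta>" "b \<in> carrier B" "n \<in> carrier N"
  shows "(b \<odot>\<^bsub>N\<^esub> n) y =
    (\<Oplus>\<^bsub>space \<pi> y\<^esub>g\<in>{g \<in> Arr \<Delta>. Cod \<Gamma> g = y}. b g \<odot>\<^bsub>space \<pi> y\<^esub> rmap \<pi> g (n (Dom \<Gamma> g)))"
proof -
  interpret Y: abelian_group "space \<pi> y" by (rule \<pi>_abelian[OF assms(1)])
  have "(b \<odot>\<^bsub>N\<^esub> n) y =
    (\<Oplus>\<^bsub>space \<pi> y\<^esub>g\<in>{g \<in> Arr \<Delta>. Cod \<Delta> g = y}. b g \<odot>\<^bsub>space \<pi> y\<^esub> rmap \<pi> g (n (Dom \<Delta> g)))"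
    using assms by (simp add: rep_module_def)
  also have "\<dots> = (\<Oplus>\<^bsub>space \<pi> y\<^esub>g\<in>{g \<in> Arr \<Delta>. Cod \<Gamma> g = y}. b g \<odot>\<^bsub>space \<pi> y\<^esub> rmap \<pi> g (n (Dom \<Gamma> g)))"
    by (rule Y.finsum_cong') (use Dom_sub Cod_sub smult_N_term[OF assms(2,3)] in auto)
  finally show ?thesis .
qed

lemma smult_N_closed:
  assumes "b \<in> carrier B" "n \<in> carrier N" shows "b \<odot>\<^bsub>N\<^esub> n \<in> carrier N"
proof -
  have "(b \<odot>\<^bsub>N\<^esub> n) y \<in> U y" if y: "y \<in> Obj \<Delta>" for y
    unfolding smult_N[OF y assms]
    by (rule abelian_monoid.finsum_closed[OF abelian_group.axioms(1)[OF \<pi>_abelian[OF y]]])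
      (use smult_N_term[OF assms] in auto)
  thus ?thesis by (auto simp: carrier_N rep_module_def)
qed

lemma add_N_closed: "\<lbrakk>n \<in> carrier N; n' \<in> carrier N\<rbrakk> \<Longrightarrow> n \<oplus>\<^bsub>N\<^esub> n' \<in> carrier N"
  unfolding carrier_N add_N
  by (auto intro!: abelian_monoid.a_closed[OF abelian_group.axioms(1)[OF \<pi>_abelian]])

lemma single_B: "c \<in> carrier K \<Longrightarrow> single K \<Delta> c d \<in> carrier B"
  by (auto simp: carrier_B single_def)

lemma single_smult_N:
  assumes c: "c \<in> carrier K" and d: "d \<in> Arr \<Delta>" and n: "n \<in> carrier N"
  shows "single K \<Delta> c d \<odot>\<^bsub>N\<^esub> n = \<delta> (Cod \<Gamma> d) (c \<odot>\<^bsub>space \<pi> (Cod \<Gamma> d)\<^esub> rmap \<pi> d (n (Dom \<Gamma> d)))"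
    (is "?l = ?r")
proof (rule N_eqI)
  have v: "c \<odot>\<^bsub>space \<pi> (Cod \<Gamma> d)\<^esub> rmap \<pi> d (n (Dom \<Gamma> d)) \<in> U (Cod \<Gamma> d)"
    by (intro smult_\<pi>_closed \<pi>_closed Cod_\<Delta> app_N Dom_\<Delta> assms)
  show "?r \<in> carrier N" by (rule \<delta>_closed[OF v])
  show "?l \<in> carrier N" by (intro smult_N_closed single_B c n)
  fix y assume y: "y \<in> Obj \<Delta>"
  interpret Y: module K "space \<pi> y" by (rule \<pi>_module[OF y])
  let ?f = "\<lambda>g. single K \<Delta> c d g \<odot>\<^bsub>space \<pi> y\<^esub> rmap \<pi> g (n (Dom \<Gamma> g))"
  have z: "?f g = \<zero>\<^bsub>space \<pi> y\<^esub>" if "g \<in> Arr \<Delta>" "Cod \<Gamma> g = y" "g \<noteq> d" for g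
    using that Y.smult_l_null[OF \<pi>_closed[OF that(1) app_N[OF n Dom_\<Delta>[OF that(1)]], unfolded that(2)]]
    by (simp add: single_def)
  show "?l y = ?r y"
  proof (cases "y = Cod \<Gamma> d")
    case True
    have "?l y = ?f d" unfolding smult_N[OF y single_B[OF c] n]
      by (rule Y.finsum_single) (use z True d v finite_Arr_\<Delta> in \<open>auto simp: single_def\<close>)
    thus ?thesis using d y True by (simp add: single_def)
  next
    case False
    have "?l y = \<zero>\<^bsub>space \<pi> y\<^esub>" unfolding smult_N[OF y single_B[OF c] n]
      by (rule Y.M.add.finprod_one_eqI) (use z False in auto)
    thus ?thesis using y False by simp
  qed
qed

lemma one_B: "\<one>\<^bsub>B\<^esub> \<in> carrier B"
  by (auto simp: groupoid_algebra_def)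

lemma one_smult_N:
  assumes n: "n \<in> carrier N" shows "\<one>\<^bsub>B\<^esub> \<odot>\<^bsub>N\<^esub> n = n"
proof (rule N_eqI)
  show "\<one>\<^bsub>B\<^esub> \<odot>\<^bsub>N\<^esub> n \<in> carrier N" by (intro smult_N_closed one_B n)
  fix y assume y: "y \<in> Obj \<Delta>"
  interpret Y: module K "space \<pi> y" by (rule \<pi>_module[OF y])
  let ?f = "\<lambda>g. \<one>\<^bsub>B\<^esub> g \<odot>\<^bsub>space \<pi> y\<^esub> rmap \<pi> g (n (Dom \<Gamma> g))"
  have i: "Ide \<Gamma> y \<in> Arr \<Delta>" "Dom \<Gamma> (Ide \<Gamma> y) = y" "Cod \<Gamma> (Ide \<Gamma> y) = y"
    using y \<Delta>.Ide_arr(1)[OF y] Ide_sub[OF y] Obj_sub Ide_arr by auto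
  have one: "\<one>\<^bsub>B\<^esub> (Ide \<Gamma> y) = \<one>\<^bsub>K\<^esub>"
    using i y imageI[OF y, of "Ide \<Delta>"] Ide_sub[OF y] by (simp add: groupoid_algebra_def)
  have "(\<one>\<^bsub>B\<^esub> \<odot>\<^bsub>N\<^esub> n) y = ?f (Ide \<Gamma> y)" unfolding smult_N[OF y one_B n]
  proof (rule Y.finsum_single)
    show "?f g = \<zero>\<^bsub>space \<pi> y\<^esub>" if g: "g \<in> {g \<in> Arr \<Delta>. Cod \<Gamma> g = y}" "g \<noteq> Ide \<Gamma> y" for g
    proof -
      have "g \<notin> Ide \<Delta> ` Obj \<Delta>" using g Ide_sub Ide_arr Obj_sub by auto
      hence "\<one>\<^bsub>B\<^esub> g = \<zero>\<^bsub>K\<^esub>" using g by (simp add: groupoid_algebra_def)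
      thus ?thesis using g \<pi>_closed[OF _ app_N[OF n Dom_\<Delta>], of g] by auto
    qed
  qed (use y i one finite_Arr_\<Delta> app_N[OF n y] \<pi>_Ide in auto)
  thus "(\<one>\<^bsub>B\<^esub> \<odot>\<^bsub>N\<^esub> n) y = n y" using one i app_N[OF n y] \<pi>_Ide[OF y] by simp
qed (rule n)

lemma \<iota>_app: "g \<in> Arr \<Gamma> \<Longrightarrow> \<iota> b g = (if g \<in> Arr \<Delta> then b g else \<zero>\<^bsub>K\<^esub>)"
  by (simp add: groupoid_algebra_inclusion_def)

lemma \<iota>_closed: "b \<in> carrier B \<Longrightarrow> \<iota> b \<in> carrier A"
  by (auto simp: groupoid_algebra_inclusion_def carrier_A app_B)

lemma \<iota>_single: "\<iota> (single K \<Delta> c d) = single K \<Gamma> c d" if "d \<in> Arr \<Delta>"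
  using that Arr_sub by (auto simp: groupoid_algebra_inclusion_def single_def fun_eq_iff)

sublocale tensor_product A B \<iota> N
  by unfold_locales (intro add_A_closed mult_A_closed \<iota>_closed add_N_closed smult_N_closed; assumption)+

text \<open>The tensor \<open>e\<^sub>p \<otimes> v\<close>, where \<open>v\<close> lies in the summand of \<open>N\<close> at the source of \<open>p\<close>.\<close>

definition \<tau> :: "'a \<Rightarrow> 'v \<Rightarrow> (('a \<Rightarrow> 'k) \<times> ('o \<Rightarrow> 'v) \<Rightarrow>\<^sub>0 int) set" where
  "\<tau> p v = tens (single K \<Gamma> \<one>\<^bsub>K\<^esub> p) (\<delta> (Dom \<Gamma> p) v)"

lemma \<tau>_closed: "v \<in> U (Dom \<Gamma> p) \<Longrightarrow> \<tau> p v \<in> carrier T"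
  unfolding \<tau>_def by (intro tens_closed single_closed \<delta>_closed one_closed)

lemma \<tau>_add:
  assumes "Dom \<Gamma> p \<in> Obj \<Delta>" "v \<in> U (Dom \<Gamma> p)" "w \<in> U (Dom \<Gamma> p)"
  shows "\<tau> p (v \<oplus>\<^bsub>space \<pi> (Dom \<Gamma> p)\<^esub> w) = \<tau> p v \<oplus>\<^bsub>T\<^esub> \<tau> p w"
proof -
  have "\<delta> (Dom \<Gamma> p) (v \<oplus>\<^bsub>space \<pi> (Dom \<Gamma> p)\<^esub> w) = \<delta> (Dom \<Gamma> p) v \<oplus>\<^bsub>N\<^esub> \<delta> (Dom \<Gamma> p) w"
    using zero_\<pi>
    by (auto simp: add_N fun_eq_iff abelian_monoid.l_zero[OF abelian_group.axioms(1)[OF \<pi>_abelian]])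
  thus ?thesis unfolding \<tau>_def
    using assms by (simp add: tens_add_right single_closed \<delta>_closed)
qed

text \<open>The factor \<open>e\<^sub>d\<close> of \<open>e\<^sub>p e\<^sub>d\<close> moves across the tensor sign.\<close>

lemma tens_single:
  assumes "c \<in> carrier K" "p \<in> Arr \<Gamma>" "d \<in> Arr \<Delta>" "Cod \<Gamma> d = Dom \<Gamma> p" "n \<in> carrier N"
  shows "tens (single K \<Gamma> c (p \<cdot>\<^bsub>\<Gamma>\<^esub> d)) n =
    \<tau> p (c \<odot>\<^bsub>space \<pi> (Dom \<Gamma> p)\<^esub> rmap \<pi> d (n (Dom \<Gamma> d)))"
proof -
  have d: "d \<in> Arr \<Gamma>" using assms Arr_sub by blast
  have "single K \<Gamma> c (p \<cdot>\<^bsub>\<Gamma>\<^esub> d) = single K \<Gamma> \<one>\<^bsub>K\<^esub> p \<otimes>\<^bsub>A\<^esub> \<iota> (single K \<Delta> c d)"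
    using assms d by (simp add: \<iota>_single single_mult_single)
  hence "tens (single K \<Gamma> c (p \<cdot>\<^bsub>\<Gamma>\<^esub> d)) n = tens (single K \<Gamma> \<one>\<^bsub>K\<^esub> p)
      (\<delta> (Cod \<Gamma> d) (c \<odot>\<^bsub>space \<pi> (Cod \<Gamma> d)\<^esub> rmap \<pi> d (n (Dom \<Gamma> d))))"
    using assms tens_balanced[OF single_closed[OF one_closed] single_B[OF assms(1)] assms(5), of p d]
    by (simp add: single_smult_N)
  thus ?thesis unfolding \<tau>_def assms(4) .
qed

lemma tens_zero: "n \<in> carrier N \<Longrightarrow> tens \<zero>\<^bsub>A\<^esub> n = \<zero>\<^bsub>T\<^esub>"
proof -
  assume n: "n \<in> carrier N"
  have z: "\<zero>\<^bsub>A\<^esub> \<in> carrier A" by (auto simp: zero_A carrier_A)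
  have "tens \<zero>\<^bsub>A\<^esub> n \<oplus>\<^bsub>T\<^esub> tens \<zero>\<^bsub>A\<^esub> n = tens \<zero>\<^bsub>A\<^esub> n"
    using tens_add_left[OF z z n] by (simp add: add_A zero_A cong: restrict_cong)
  thus ?thesis
    using T.add.l_cancel_one[OF tens_closed[OF z n] tens_closed[OF z n]] by simp
qed

text \<open>As the unit of \<open>B\<close> acts as the identity on \<open>n\<close>, it can be moved to the left factor, where it
  annihilates every \<open>e\<^sub>p\<close> whose source is outside \<open>\<Delta>\<close>.\<close>

lemma tens_single_off:
  assumes "c \<in> carrier K" "p \<in> Arr \<Gamma>" "Dom \<Gamma> p \<notin> Obj \<Delta>" "n \<in> carrier N"
  shows "tens (single K \<Gamma> c p) n = \<zero>\<^bsub>T\<^esub>"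
proof -
  let ?m = "single K \<Gamma> c p"
  have z: "\<zero>\<^bsub>A\<^esub> \<in> carrier A" by (auto simp: zero_A carrier_A)
  have "?m \<otimes>\<^bsub>A\<^esub> \<iota> \<one>\<^bsub>B\<^esub> = \<zero>\<^bsub>A\<^esub>"
  proof (rule A_eqI)
    fix g assume g: "g \<in> Arr \<Gamma>"
    show "(?m \<otimes>\<^bsub>A\<^esub> \<iota> \<one>\<^bsub>B\<^esub>) g = \<zero>\<^bsub>A\<^esub> g"
    proof (cases "Cod \<Gamma> g = Cod \<Gamma> p")
      case True
      then obtain r where r: "r \<in> Arr \<Gamma>" "Cod \<Gamma> r = Dom \<Gamma> p" "p \<cdot>\<^bsub>\<Gamma>\<^esub> r = g"
        using left_division[OF assms(2) g] by blast
      hence "r \<notin> Arr \<Delta>" using assms(3) Cod_\<Delta>[of r] by auto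
      thus ?thesis
        using single_mult[OF assms(1,2) r(1,2) \<iota>_closed[OF one_B]] r assms g by (simp add: \<iota>_app zero_A)
    next
      case False
      thus ?thesis using single_mult_off[OF assms(1) g _ \<iota>_closed[OF one_B]] g by (simp add: zero_A)
    qed
  qed (intro mult_A_closed single_closed assms \<iota>_closed one_B z)+
  hence "tens ?m n = tens \<zero>\<^bsub>A\<^esub> n"
    using tens_balanced[OF single_closed[OF assms(1)] one_B assms(4), of p] assms by (simp add: one_smult_N)
  also have "\<dots> = \<zero>\<^bsub>T\<^esub>" by (rule tens_zero[OF assms(4)])
  finally show ?thesis .
qed

lemma Ide_\<Delta>: "t \<in> Obj \<Delta> \<Longrightarrow> Ide \<Gamma> t \<in> Arr \<Delta> \<and> Dom \<Gamma> (Ide \<Gamma> t) = t \<and> Cod \<Gamma> (Ide \<Gamma> t) = t"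
  using \<Delta>.Ide_arr(1)[of t] Ide_sub[of t] Obj_sub Ide_arr by auto

lemma \<tau>_zero:
  assumes "Dom \<Gamma> p \<in> Obj \<Delta>" shows "\<tau> p \<zero>\<^bsub>space \<pi> (Dom \<Gamma> p)\<^esub> = \<zero>\<^bsub>T\<^esub>"
  by (rule additive_zero[OF \<pi>_abelian[OF assms] abelian_group_T])
    (use \<tau>_closed \<tau>_add[OF assms] in auto)

lemma basis_smult:
  assumes "q \<in> Arr \<Gamma>"
  shows "(\<lambda>S. basis_elt K \<Gamma> q \<odot>\<^bsub>T\<^esub> S) \<in> carrier T \<rightarrow> carrier T"
    and "\<And>x y. \<lbrakk>x \<in> carrier T; y \<in> carrier T\<rbrakk> \<Longrightarrow>
      basis_elt K \<Gamma> q \<odot>\<^bsub>T\<^esub> (x \<oplus>\<^bsub>T\<^esub> y) = basis_elt K \<Gamma> q \<odot>\<^bsub>T\<^esub> x \<oplus>\<^bsub>T\<^esub> basis_elt K \<Gamma> q \<odot>\<^bsub>T\<^esub> y"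
    and "\<And>m n. \<lbrakk>m \<in> carrier A; n \<in> carrier N\<rbrakk> \<Longrightarrow>
      basis_elt K \<Gamma> q \<odot>\<^bsub>T\<^esub> tens m n = tens (basis_elt K \<Gamma> q \<otimes>\<^bsub>A\<^esub> m) n"
proof -
  note * = mult_A_closed[OF single_closed[OF one_closed]] mult_A_distrib[OF single_closed[OF one_closed]]
    single_mult_assoc[OF one_closed assms _ \<iota>_closed]
  show "(\<lambda>S. basis_elt K \<Gamma> q \<odot>\<^bsub>T\<^esub> S) \<in> carrier T \<rightarrow> carrier T"
    unfolding basis_elt_single by (rule smult_additive(1)) (rule *; assumption)+
  show "basis_elt K \<Gamma> q \<odot>\<^bsub>T\<^esub> (x \<oplus>\<^bsub>T\<^esub> y) = basis_elt K \<Gamma> q \<odot>\<^bsub>T\<^esub> x \<oplus>\<^bsub>T\<^esub> basis_elt K \<Gamma> q \<odot>\<^bsub>T\<^esub> y"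
    if "x \<in> carrier T" "y \<in> carrier T" for x y
    unfolding basis_elt_single by (rule smult_additive(2)[OF _ _ _ that]) (rule *; assumption)+
  show "basis_elt K \<Gamma> q \<odot>\<^bsub>T\<^esub> tens m n = tens (basis_elt K \<Gamma> q \<otimes>\<^bsub>A\<^esub> m) n"
    if "m \<in> carrier A" "n \<in> carrier N" for m n
    unfolding basis_elt_single by (rule smult_additive(3)[OF _ _ _ that]) (rule *; assumption)+
qed

lemma scalar_smult:
  assumes "c \<in> carrier K"
  shows "(\<lambda>S. scalar c \<odot>\<^bsub>T\<^esub> S) \<in> carrier T \<rightarrow> carrier T"
    and "\<And>x y. \<lbrakk>x \<in> carrier T; y \<in> carrier T\<rbrakk> \<Longrightarrow>
      scalar c \<odot>\<^bsub>T\<^esub> (x \<oplus>\<^bsub>T\<^esub> y) = scalar c \<odot>\<^bsub>T\<^esub> x \<oplus>\<^bsub>T\<^esub> scalar c \<odot>\<^bsub>T\<^esub> y"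
    and "\<And>m n. \<lbrakk>m \<in> carrier A; n \<in> carrier N\<rbrakk> \<Longrightarrow>
      scalar c \<odot>\<^bsub>T\<^esub> tens m n = tens (scalar c \<otimes>\<^bsub>A\<^esub> m) n"
proof -
  note * = mult_A_closed[OF scalar_closed[OF assms]] mult_A_distrib[OF scalar_closed[OF assms]]
    scalar_mult_assoc[OF assms _ \<iota>_closed]
  show "(\<lambda>S. scalar c \<odot>\<^bsub>T\<^esub> S) \<in> carrier T \<rightarrow> carrier T"
    by (rule smult_additive(1)) (rule *; assumption)+
  show "scalar c \<odot>\<^bsub>T\<^esub> (x \<oplus>\<^bsub>T\<^esub> y) = scalar c \<odot>\<^bsub>T\<^esub> x \<oplus>\<^bsub>T\<^esub> scalar c \<odot>\<^bsub>T\<^esub> y"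
    if "x \<in> carrier T" "y \<in> carrier T" for x y
    by (rule smult_additive(2)[OF _ _ _ that]) (rule *; assumption)+
  show "scalar c \<odot>\<^bsub>T\<^esub> tens m n = tens (scalar c \<otimes>\<^bsub>A\<^esub> m) n"
    if "m \<in> carrier A" "n \<in> carrier N" for m n
    by (rule smult_additive(3)[OF _ _ _ that]) (rule *; assumption)+
qed

lemma basis_smult_\<tau>:
  assumes "q \<in> Arr \<Gamma>" "p \<in> Arr \<Gamma>" "Cod \<Gamma> p = Dom \<Gamma> q" "v \<in> U (Dom \<Gamma> p)"
  shows "basis_elt K \<Gamma> q \<odot>\<^bsub>T\<^esub> \<tau> p v = \<tau> (q \<cdot>\<^bsub>\<Gamma>\<^esub> p) v"
proof -
  have "basis_elt K \<Gamma> q \<odot>\<^bsub>T\<^esub> \<tau> p v = tens (basis_elt K \<Gamma> q \<otimes>\<^bsub>A\<^esub> single K \<Gamma> \<one>\<^bsub>K\<^esub> p) (\<delta> (Dom \<Gamma> p) v)"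
    unfolding \<tau>_def by (rule basis_smult(3)[OF assms(1) single_closed[OF one_closed] \<delta>_closed[OF assms(4)]])
  thus ?thesis
    using assms by (simp add: \<tau>_def basis_elt_single single_mult_single Cmp_arr)
qed

lemma scalar_smult_\<tau>:
  assumes "c \<in> carrier K" "p \<in> Arr \<Gamma>" "Dom \<Gamma> p \<in> Obj \<Delta>" "v \<in> U (Dom \<Gamma> p)"
  shows "scalar c \<odot>\<^bsub>T\<^esub> \<tau> p v = \<tau> p (c \<odot>\<^bsub>space \<pi> (Dom \<Gamma> p)\<^esub> v)"
proof -
  let ?i = "Ide \<Gamma> (Dom \<Gamma> p)"
  have "scalar c \<odot>\<^bsub>T\<^esub> \<tau> p v = tens (scalar c \<otimes>\<^bsub>A\<^esub> single K \<Gamma> \<one>\<^bsub>K\<^esub> p) (\<delta> (Dom \<Gamma> p) v)"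
    unfolding \<tau>_def by (rule scalar_smult(3)[OF assms(1) single_closed[OF one_closed] \<delta>_closed[OF assms(4)]])
  also have "\<dots> = tens (single K \<Gamma> c (p \<cdot>\<^bsub>\<Gamma>\<^esub> ?i)) (\<delta> (Dom \<Gamma> p) v)"
    using assms by (simp add: scalar_mult_single Ide_right_arr)
  also have "\<dots> = \<tau> p (c \<odot>\<^bsub>space \<pi> (Dom \<Gamma> p)\<^esub> v)"
    using tens_single[OF assms(1,2) _ _ \<delta>_closed[OF assms(4)], of ?i] Ide_\<Delta>[OF assms(3)]
      \<pi>_Ide[OF assms(3,4)] assms(3) by simp
  finally show ?thesis .
qed

definition families :: "'o \<Rightarrow> ('a \<Rightarrow> 'v) set" where
  "families s = (\<Pi> p\<in>P s. U (Dom \<Gamma> p))"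

definition assemble :: "'o \<Rightarrow> ('a \<Rightarrow> 'v) \<Rightarrow> (('a \<Rightarrow> 'k) \<times> ('o \<Rightarrow> 'v) \<Rightarrow>\<^sub>0 int) set" where
  "assemble s v = (\<Oplus>\<^bsub>T\<^esub>p\<in>P s. \<tau> p (v p))"

text \<open>The value at \<open>s\<close> of the induced representation.\<close>

definition E :: "'o \<Rightarrow> (('a \<Rightarrow> 'k) \<times> ('o \<Rightarrow> 'v) \<Rightarrow>\<^sub>0 int) set set" where
  "E s = (\<lambda>x. basis_elt K \<Gamma> (Ide \<Gamma> s) \<odot>\<^bsub>T\<^esub> x) ` carrier T"

lemma families_app: "\<lbrakk>v \<in> families s; p \<in> P s\<rbrakk> \<Longrightarrow> v p \<in> U (Dom \<Gamma> p)"
  by (auto simp: families_def)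

lemma assemble_closed: "v \<in> families s \<Longrightarrow> assemble s v \<in> carrier T"
  unfolding assemble_def by (rule T.finsum_closed) (auto intro: \<tau>_closed families_app)

lemma assemble_minus:
  assumes s: "s \<in> Obj \<Gamma>" and v: "v \<in> families s" and w: "w \<in> families s"
  shows "\<exists>u\<in>families s. assemble s v \<ominus>\<^bsub>T\<^esub> assemble s w = assemble s u"
proof
  let ?u = "\<lambda>p. v p \<ominus>\<^bsub>space \<pi> (Dom \<Gamma> p)\<^esub> w p"
  have ab: "abelian_group (space \<pi> (Dom \<Gamma> p))" if "p \<in> P s" for p
    using that P_arr[OF s] \<pi>_abelian by blast
  show u: "?u \<in> families s"
    unfolding families_def using ab v w by (auto intro!: abelian_group.minus_closed dest: families_app)
  have "\<tau> p (v p) = \<tau> p (?u p) \<oplus>\<^bsub>T\<^esub> \<tau> p (w p)" if p: "p \<in> P s" for p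
  proof -
    interpret Q: abelian_group "space \<pi> (Dom \<Gamma> p)" by (rule ab[OF p])
    have c: "v p \<in> U (Dom \<Gamma> p)" "w p \<in> U (Dom \<Gamma> p)"
      using v w p families_app by blast+
    hence "v p = ?u p \<oplus>\<^bsub>space \<pi> (Dom \<Gamma> p)\<^esub> w p"
      by (simp add: Q.minus_eq Q.a_assoc Q.l_neg)
    thus ?thesis
      using \<tau>_add[of p "?u p" "w p"] P_arr[OF s p] families_app[OF u p] c by simp
  qed
  hence "assemble s v = (\<Oplus>\<^bsub>T\<^esub>p\<in>P s. \<tau> p (?u p) \<oplus>\<^bsub>T\<^esub> \<tau> p (w p))"
    unfolding assemble_def
    by (intro T.finsum_cong') (auto intro!: \<tau>_closed families_app[OF u] families_app[OF w])
  also have "\<dots> = assemble s ?u \<oplus>\<^bsub>T\<^esub> assemble s w"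
    unfolding assemble_def
    by (intro T.finsum_addf) (auto intro!: \<tau>_closed families_app[OF u] families_app[OF w])
  finally show "assemble s v \<ominus>\<^bsub>T\<^esub> assemble s w = assemble s ?u"
    using assemble_closed[OF u] assemble_closed[OF w]
    by (simp add: T.minus_eq T.a_assoc T.r_neg)
qed

lemma zero_family: "s \<in> Obj \<Gamma> \<Longrightarrow> (\<lambda>p. \<zero>\<^bsub>space \<pi> (Dom \<Gamma> p)\<^esub>) \<in> families s"
  using P_arr zero_\<pi> by (auto simp: families_def)

lemma zero_assembled:
  assumes s: "s \<in> Obj \<Gamma>" shows "\<zero>\<^bsub>T\<^esub> \<in> assemble s ` families s"
proof -
  have "assemble s (\<lambda>p. \<zero>\<^bsub>space \<pi> (Dom \<Gamma> p)\<^esub>) = \<zero>\<^bsub>T\<^esub>"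
    unfolding assemble_def
    by (rule T.add.finprod_one_eqI) (use P_arr[OF s] \<tau>_zero in auto)
  thus ?thesis using zero_family[OF s] by (metis imageI)
qed

text \<open>An arrow \<open>g\<close> from \<open>\<Delta>\<close> factors as \<open>pd\<close> with \<open>p\<close> in \<open>P s\<close>, so \<open>e\<^sub>g \<otimes> n\<close> equals \<open>e\<^sub>p \<otimes> \<pi>(d)n\<close>; all
  other arrows contribute zero.\<close>

lemma single_assembled:
  assumes g: "g \<in> Arr \<Gamma>" "Cod \<Gamma> g = s" and c: "c \<in> carrier K" and n: "n \<in> carrier N"
  shows "tens (single K \<Gamma> c g) n \<in> assemble s ` families s"
proof -
  have s: "s \<in> Obj \<Gamma>" using g Cod_closed by blast
  show ?thesis
  proof (cases "Dom \<Gamma> g \<in> Obj \<Delta>")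
    case True
    then obtain p d where pd: "p \<in> P s" "d \<in> Arr \<Delta>" "Cod \<Gamma> d = Dom \<Gamma> p" "p \<cdot>\<^bsub>\<Gamma>\<^esub> d = g"
      using P_factor[OF g(1)] g(2) by blast
    have p: "p \<in> Arr \<Gamma>" "Dom \<Gamma> p \<in> Obj \<Delta>" using P_arr[OF s pd(1)] by auto
    define w where "w = c \<odot>\<^bsub>space \<pi> (Dom \<Gamma> p)\<^esub> rmap \<pi> d (n (Dom \<Gamma> d))"
    have w: "w \<in> U (Dom \<Gamma> p)"
      unfolding w_def using \<pi>_closed[OF pd(2) app_N[OF n Dom_\<Delta>[OF pd(2)]]] pd(3)
      by (intro smult_\<pi>_closed p c) simp
    define u where "u = (\<lambda>p'. if p' = p then w else \<zero>\<^bsub>space \<pi> (Dom \<Gamma> p')\<^esub>)"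
    have u: "u \<in> families s" using w P_arr[OF s] zero_\<pi> by (auto simp: families_def u_def)
    have "assemble s u = \<tau> p (u p)"
      unfolding assemble_def
      by (rule T.finsum_single[OF finite_P[OF s] pd(1)])
        (use \<tau>_closed[OF families_app[OF u pd(1)]] P_arr[OF s] \<tau>_zero in \<open>auto simp: u_def\<close>)
    also have "\<dots> = tens (single K \<Gamma> c g) n"
      using tens_single[OF c p(1) pd(2,3) n] pd(4) by (simp add: u_def w_def)
    finally show ?thesis using u by (metis imageI)
  next
    case False
    thus ?thesis using tens_single_off[OF c g(1) False n] zero_assembled[OF s] by simp
  qed
qed

lemma assemble_add:
  assumes s: "s \<in> Obj \<Gamma>" and x: "x \<in> assemble s ` families s" and y: "y \<in> assemble s ` families s"
  shows "x \<oplus>\<^bsub>T\<^esub> y \<in> assemble s ` families s"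
proof -
  have m: "\<And>x y. \<lbrakk>x \<in> assemble s ` families s; y \<in> assemble s ` families s\<rbrakk> \<Longrightarrow>
      x \<ominus>\<^bsub>T\<^esub> y \<in> assemble s ` families s"
    using assemble_minus[OF s] by fastforce
  have c: "x \<in> carrier T" "y \<in> carrier T" using x y assemble_closed by auto
  have "x \<oplus>\<^bsub>T\<^esub> y = x \<ominus>\<^bsub>T\<^esub> (\<zero>\<^bsub>T\<^esub> \<ominus>\<^bsub>T\<^esub> y)" using c by (simp add: T.minus_eq)
  thus ?thesis using m[OF x m[OF zero_assembled[OF s] y]] by simp
qed

text \<open>Basis elements are split off from \<open>a\<close> one at a time, by induction on its support.\<close>

lemma tens_assembled:
  assumes s: "s \<in> Obj \<Gamma>" and n: "n \<in> carrier N"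
    and fin: "finite S" "S \<subseteq> {g \<in> Arr \<Gamma>. Cod \<Gamma> g = s}"
    and a: "a \<in> carrier A" "\<And>g. \<lbrakk>g \<in> Arr \<Gamma>; g \<notin> S\<rbrakk> \<Longrightarrow> a g = \<zero>\<^bsub>K\<^esub>"
  shows "tens a n \<in> assemble s ` families s"
  using fin a
proof (induction S arbitrary: a rule: finite_induct)
  case empty
  have "a = \<zero>\<^bsub>A\<^esub>"
    by (rule A_eqI) (use empty in \<open>auto simp: zero_A carrier_A\<close>)
  thus ?case using tens_zero[OF n] zero_assembled[OF s] by simp
next
  case (insert g S)
  define a' where "a' = (\<lambda>h\<in>Arr \<Gamma>. if h = g then \<zero>\<^bsub>K\<^esub> else a h)"
  have g: "g \<in> Arr \<Gamma>" "Cod \<Gamma> g = s" "a g \<in> carrier K" using insert.prems by (auto simp: app_A)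
  have a': "a' \<in> carrier A" using insert.prems(2) by (auto simp: carrier_A a'_def)
  have "a = single K \<Gamma> (a g) g \<oplus>\<^bsub>A\<^esub> a'"
  proof (rule A_eqI[OF insert.prems(2) add_A_closed[OF single_closed[OF g(3)] a']])
    show "a h = (single K \<Gamma> (a g) g \<oplus>\<^bsub>A\<^esub> a') h" if "h \<in> Arr \<Gamma>" for h
      using that g(3) app_A[OF insert.prems(2) that] by (simp add: add_A single_def a'_def)
  qed
  hence "tens a n = tens (single K \<Gamma> (a g) g) n \<oplus>\<^bsub>T\<^esub> tens a' n"
    using tens_add_left[OF single_closed[OF g(3)] a' n, of g] by simp
  moreover have "tens a' n \<in> assemble s ` families s"
  proof (rule insert.IH[OF _ a'])
    show "a' h = \<zero>\<^bsub>K\<^esub>" if "h \<in> Arr \<Gamma>" "h \<notin> S" for h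
      using that insert.prems(3)[of h] by (simp add: a'_def)
  qed (use insert.prems in simp)
  ultimately show ?case using assemble_add[OF s single_assembled[OF g(1,2,3) n]] by simp
qed

lemma basis_assemble:
  assumes q: "q \<in> Arr \<Gamma>" and v: "v \<in> families (Dom \<Gamma> q)"
  shows "basis_elt K \<Gamma> q \<odot>\<^bsub>T\<^esub> assemble (Dom \<Gamma> q) v = (\<Oplus>\<^bsub>T\<^esub>p\<in>P (Dom \<Gamma> q). \<tau> (q \<cdot>\<^bsub>\<Gamma>\<^esub> p) (v p))"
proof -
  have s: "Dom \<Gamma> q \<in> Obj \<Gamma>" using q Dom_closed by blast
  have "basis_elt K \<Gamma> q \<odot>\<^bsub>T\<^esub> assemble (Dom \<Gamma> q) v
      = (\<Oplus>\<^bsub>T\<^esub>p\<in>P (Dom \<Gamma> q). basis_elt K \<Gamma> q \<odot>\<^bsub>T\<^esub> \<tau> p (v p))"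
    unfolding assemble_def
    by (rule additive_finsum[OF abelian_group_T abelian_group_T basis_smult(1,2)[OF q]])
      (auto intro!: \<tau>_closed families_app[OF v])
  also have "\<dots> = (\<Oplus>\<^bsub>T\<^esub>p\<in>P (Dom \<Gamma> q). \<tau> (q \<cdot>\<^bsub>\<Gamma>\<^esub> p) (v p))"
  proof (rule T.finsum_cong'[OF refl])
    show "(\<lambda>p. \<tau> (q \<cdot>\<^bsub>\<Gamma>\<^esub> p) (v p)) \<in> P (Dom \<Gamma> q) \<rightarrow> carrier T"
      using P_arr[OF s] q families_app[OF v] by (auto intro!: \<tau>_closed simp: Cmp_arr)
    show "basis_elt K \<Gamma> q \<odot>\<^bsub>T\<^esub> \<tau> p (v p) = \<tau> (q \<cdot>\<^bsub>\<Gamma>\<^esub> p) (v p)" if "p \<in> P (Dom \<Gamma> q)" for p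
      using P_arr[OF s that] families_app[OF v that] by (intro basis_smult_\<tau> q) simp_all
  qed
  finally show ?thesis .
qed

text \<open>Multiplication by \<open>e\<^sub>s\<close> cuts the support of \<open>a\<close> down to the arrows into \<open>s\<close>, and it fixes every
  tensor \<open>e\<^sub>p \<otimes> v\<close> with such a \<open>p\<close>.\<close>

lemma E_eq:
  assumes s: "s \<in> Obj \<Gamma>" shows "E s = assemble s ` families s"
proof (intro equalityI subsetI)
  note i = Ide_arr[OF s]
  fix y assume "y \<in> E s"
  then obtain x where x: "x \<in> carrier T" "y = basis_elt K \<Gamma> (Ide \<Gamma> s) \<odot>\<^bsub>T\<^esub> x" by (auto simp: E_def)
  have "basis_elt K \<Gamma> (Ide \<Gamma> s) \<odot>\<^bsub>T\<^esub> x \<in> assemble s ` families s"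
    using x(1)
  proof (induction rule: T_induct)
    case zero
    have "basis_elt K \<Gamma> (Ide \<Gamma> s) \<odot>\<^bsub>T\<^esub> \<zero>\<^bsub>T\<^esub> = \<zero>\<^bsub>T\<^esub>"
      by (rule additive_zero[OF abelian_group_T abelian_group_T basis_smult(1,2)[OF i(1)]])
    thus ?case using zero_assembled[OF s] by metis
  next
    case (minus x y)
    then obtain v w where "v \<in> families s" "w \<in> families s"
      "basis_elt K \<Gamma> (Ide \<Gamma> s) \<odot>\<^bsub>T\<^esub> x = assemble s v" "basis_elt K \<Gamma> (Ide \<Gamma> s) \<odot>\<^bsub>T\<^esub> y = assemble s w"
      by blast
    thus ?case
      using additive_minus[OF abelian_group_T abelian_group_T basis_smult(1,2)[OF i(1)] minus(1,2)]
        assemble_minus[OF s, of v w] by (metis imageI)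
  next
    case (tens m n)
    let ?a = "basis_elt K \<Gamma> (Ide \<Gamma> s) \<otimes>\<^bsub>A\<^esub> m"
    have "tens ?a n \<in> assemble s ` families s"
    proof (rule tens_assembled[OF s tens(2), of "{g \<in> Arr \<Gamma>. Cod \<Gamma> g = s}"])
      show "?a g = \<zero>\<^bsub>K\<^esub>" if "g \<in> Arr \<Gamma>" "g \<notin> {g \<in> Arr \<Gamma>. Cod \<Gamma> g = s}" for g
        unfolding basis_elt_single using that i by (intro single_mult_off tens one_closed) auto
      show "?a \<in> carrier A" unfolding basis_elt_single by (intro mult_A_closed single_closed tens one_closed)
    qed (use finite_Arr in auto)
    thus ?case unfolding basis_smult(3)[OF i(1) tens] .
  qed
  thus "y \<in> assemble s ` families s" unfolding x(2) .
next
  note i = Ide_arr[OF s]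
  fix y assume "y \<in> assemble s ` families s"
  then obtain v where v: "v \<in> families s" "y = assemble s v" by auto
  have "basis_elt K \<Gamma> (Ide \<Gamma> s) \<odot>\<^bsub>T\<^esub> assemble s v = (\<Oplus>\<^bsub>T\<^esub>p\<in>P s. \<tau> (Ide \<Gamma> s \<cdot>\<^bsub>\<Gamma>\<^esub> p) (v p))"
    using basis_assemble[OF i(1)] v i by simp
  also have "\<dots> = assemble s v" unfolding assemble_def
  proof (rule T.finsum_cong'[OF refl])
    show "(\<lambda>p. \<tau> p (v p)) \<in> P s \<rightarrow> carrier T" using families_app[OF v(1)] \<tau>_closed by blast
    show "\<tau> (Ide \<Gamma> s \<cdot>\<^bsub>\<Gamma>\<^esub> p) (v p) = \<tau> p (v p)" if "p \<in> P s" for p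
      using P_arr[OF s that] by (simp add: Ide_left_arr)
  qed
  finally show "y \<in> E s" unfolding E_def v(2) by (metis assemble_closed[OF v(1)] imageI)
qed

end

context induction_data
begin

definition fibre :: "'o \<Rightarrow> 'a set" where
  "fibre s = {p \<in> Arr \<Gamma>. Cod \<Gamma> p = s \<and> Dom \<Gamma> p \<in> Obj \<Delta>}"

lemma finite_fibre: "finite (fibre s)"
  unfolding fibre_def using finite_arrows by simp

definition value_at :: "('o \<Rightarrow> 'v) \<Rightarrow> 'a \<Rightarrow> 'w" where
  "value_at n p = rmap \<pi>' p (j (Dom \<Gamma> p) (n (Dom \<Gamma> p)))"

lemma value_at_closed: "\<lbrakk>n \<in> carrier N; p \<in> fibre s\<rbrakk> \<Longrightarrow> value_at n p \<in> W s"
  unfolding value_at_def fibre_def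
  using rmap_closed[of p "j (Dom \<Gamma> p) (n (Dom \<Gamma> p))"] j_closed app_N by auto

lemma value_at_add:
  assumes "n \<in> carrier N" "n' \<in> carrier N" "p \<in> fibre s"
  shows "value_at (n \<oplus>\<^bsub>N\<^esub> n') p = value_at n p \<oplus>\<^bsub>space \<pi>' s\<^esub> value_at n' p"
proof -
  have p: "p \<in> Arr \<Gamma>" "Dom \<Gamma> p \<in> Obj \<Delta>" "s = Cod \<Gamma> p" using assms by (auto simp: fibre_def)
  show ?thesis
    unfolding value_at_def p(3)
    using p assms by (simp add: add_N j_add app_N rmap_add j_closed)
qed

text \<open>The prospective image of \<open>a \<otimes> n\<close> in \<open>\<pi>'(s)\<close>.\<close>

definition pairing :: "'o \<Rightarrow> ('a \<Rightarrow> 'k) \<Rightarrow> ('o \<Rightarrow> 'v) \<Rightarrow> 'w" where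
  "pairing s a n = (\<Oplus>\<^bsub>space \<pi>' s\<^esub>p\<in>fibre s. a p \<odot>\<^bsub>space \<pi>' s\<^esub> value_at n p)"

lemma fibre_app: "\<lbrakk>a \<in> carrier A; p \<in> fibre s\<rbrakk> \<Longrightarrow> a p \<in> carrier K"
  by (simp add: app_A fibre_def)

lemma pairing_term:
  assumes "s \<in> Obj \<Gamma>" "a \<in> carrier A" "n \<in> carrier N" "p \<in> fibre s"
  shows "a p \<odot>\<^bsub>space \<pi>' s\<^esub> value_at n p \<in> W s"
  by (rule module.smult_closed[OF space_module[OF assms(1)] fibre_app[OF assms(2,4)] value_at_closed[OF assms(3,4)]])

lemma pairing_closed:
  assumes "s \<in> Obj \<Gamma>" "a \<in> carrier A" "n \<in> carrier N"
  shows "pairing s a n \<in> W s"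
  unfolding pairing_def
  by (rule abelian_monoid.finsum_closed[OF abelian_group.axioms(1)[OF \<pi>'_abelian[OF assms(1)]]])
    (use pairing_term[OF assms] in blast)

lemma pairing_add_left:
  assumes s: "s \<in> Obj \<Gamma>" and a: "a \<in> carrier A" "a' \<in> carrier A" and n: "n \<in> carrier N"
  shows "pairing s (a \<oplus>\<^bsub>A\<^esub> a') n = pairing s a n \<oplus>\<^bsub>space \<pi>' s\<^esub> pairing s a' n"
proof -
  interpret S: module K "space \<pi>' s" by (rule space_module[OF s])
  have "pairing s (a \<oplus>\<^bsub>A\<^esub> a') n = (\<Oplus>\<^bsub>space \<pi>' s\<^esub>p\<in>fibre s.
      a p \<odot>\<^bsub>space \<pi>' s\<^esub> value_at n p \<oplus>\<^bsub>space \<pi>' s\<^esub> a' p \<odot>\<^bsub>space \<pi>' s\<^esub> value_at n p)"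
    unfolding pairing_def
  proof (rule S.M.finsum_cong'[OF refl])
    show "(a \<oplus>\<^bsub>A\<^esub> a') p \<odot>\<^bsub>space \<pi>' s\<^esub> value_at n p =
        a p \<odot>\<^bsub>space \<pi>' s\<^esub> value_at n p \<oplus>\<^bsub>space \<pi>' s\<^esub> a' p \<odot>\<^bsub>space \<pi>' s\<^esub> value_at n p"
      if p: "p \<in> fibre s" for p
    proof -
      have "(a \<oplus>\<^bsub>A\<^esub> a') p = a p \<oplus>\<^bsub>K\<^esub> a' p" using p by (simp add: add_A fibre_def)
      thus ?thesis
        using S.smult_l_distr[OF fibre_app[OF a(1) p] fibre_app[OF a(2) p] value_at_closed[OF n p]] by simp
    qed
  qed (use pairing_term[OF s] a n in auto)
  also have "\<dots> = pairing s a n \<oplus>\<^bsub>space \<pi>' s\<^esub> pairing s a' n"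
    unfolding pairing_def by (rule S.M.finsum_addf) (use pairing_term[OF s] a n in auto)
  finally show ?thesis .
qed

lemma pairing_add_right:
  assumes s: "s \<in> Obj \<Gamma>" and a: "a \<in> carrier A" and n: "n \<in> carrier N" "n' \<in> carrier N"
  shows "pairing s a (n \<oplus>\<^bsub>N\<^esub> n') = pairing s a n \<oplus>\<^bsub>space \<pi>' s\<^esub> pairing s a n'"
proof -
  interpret S: module K "space \<pi>' s" by (rule space_module[OF s])
  have "pairing s a (n \<oplus>\<^bsub>N\<^esub> n') = (\<Oplus>\<^bsub>space \<pi>' s\<^esub>p\<in>fibre s.
      a p \<odot>\<^bsub>space \<pi>' s\<^esub> value_at n p \<oplus>\<^bsub>space \<pi>' s\<^esub> a p \<odot>\<^bsub>space \<pi>' s\<^esub> value_at n' p)"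
    unfolding pairing_def
  proof (rule S.M.finsum_cong'[OF refl])
    show "a p \<odot>\<^bsub>space \<pi>' s\<^esub> value_at (n \<oplus>\<^bsub>N\<^esub> n') p =
        a p \<odot>\<^bsub>space \<pi>' s\<^esub> value_at n p \<oplus>\<^bsub>space \<pi>' s\<^esub> a p \<odot>\<^bsub>space \<pi>' s\<^esub> value_at n' p"
      if p: "p \<in> fibre s" for p
      unfolding value_at_add[OF n p]
      by (rule S.smult_r_distr[OF fibre_app[OF a p] value_at_closed[OF n(1) p] value_at_closed[OF n(2) p]])
  qed (use pairing_term[OF s] a n in auto)
  also have "\<dots> = pairing s a n \<oplus>\<^bsub>space \<pi>' s\<^esub> pairing s a n'"
    unfolding pairing_def by (rule S.M.finsum_addf) (use pairing_term[OF s] a n in auto)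
  finally show ?thesis .
qed

definition subfactorizations :: "'a \<Rightarrow> ('a \<times> 'a) set" where
  "subfactorizations g = {(p, d) \<in> factorizations g. d \<in> Arr \<Delta>}"

lemma subfactorizationsD:
  assumes "(q, d) \<in> subfactorizations p" "p \<in> fibre s"
  shows "d \<in> Arr \<Delta>" "d \<in> Arr \<Gamma>" "Cod \<Gamma> d = Dom \<Gamma> q" "q \<cdot>\<^bsub>\<Gamma>\<^esub> d = p" "q \<in> fibre s" "Dom \<Gamma> p = Dom \<Gamma> d"
  using assms Cod_\<Delta>[of d] by (auto simp: subfactorizations_def factorizations_def fibre_def Cmp_arr)

lemma value_at_Cmp:
  assumes n: "n \<in> carrier N" and q: "q \<in> fibre s" and d: "d \<in> Arr \<Delta>" "Cod \<Gamma> d = Dom \<Gamma> q"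
  shows "rmap \<pi>' q (j (Dom \<Gamma> q) (rmap \<pi> d (n (Dom \<Gamma> d)))) = value_at n (q \<cdot>\<^bsub>\<Gamma>\<^esub> d)"
proof -
  have d': "d \<in> Arr \<Gamma>" "Dom \<Gamma> d \<in> Obj \<Delta>" and q': "q \<in> Arr \<Gamma>"
    using d q Arr_sub Dom_\<Delta> by (auto simp: fibre_def)
  have "rmap \<pi>' q (j (Dom \<Gamma> q) (rmap \<pi> d (n (Dom \<Gamma> d)))) = rmap \<pi>' q (rmap \<pi>' d (j (Dom \<Gamma> d) (n (Dom \<Gamma> d))))"
    using j_equivariant[OF d(1) app_N[OF n d'(2)]] d(2) by simp
  also have "\<dots> = rmap \<pi>' (q \<cdot>\<^bsub>\<Gamma>\<^esub> d) (j (Dom \<Gamma> d) (n (Dom \<Gamma> d)))"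
    using rmap_Cmp_arr[OF d'(1) q' d(2)[symmetric] j_closed[OF d'(2) app_N[OF n d'(2)]]] by simp
  finally show ?thesis using d' q' d(2) by (simp add: value_at_def Cmp_arr)
qed

text \<open>Both sides of the balancing identity expand to the sum of
  \<open>a(q) b(d) \<cdot> \<pi>'(qd) j(n)\<close> over the pairs of an arrow \<open>q\<close> into \<open>s\<close> and a composable arrow \<open>d\<close> of
  \<open>\<Delta>\<close>; the left one groups the pairs by the product \<open>qd\<close>, the right one by \<open>q\<close>.\<close>

lemma pairing_balanced:
  assumes s: "s \<in> Obj \<Gamma>" and a: "a \<in> carrier A" and b: "b \<in> carrier B" and n: "n \<in> carrier N"
  shows "pairing s (a \<otimes>\<^bsub>A\<^esub> \<iota> b) n = pairing s a (b \<odot>\<^bsub>N\<^esub> n)"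
proof -
  interpret S: module K "space \<pi>' s" by (rule space_module[OF s])
  let ?S = "space \<pi>' s"
  let ?t = "\<lambda>(q, d). (a q \<otimes>\<^bsub>K\<^esub> b d) \<odot>\<^bsub>?S\<^esub> value_at n (q \<cdot>\<^bsub>\<Gamma>\<^esub> d)"
  let ?X = "\<lambda>q. {q} \<times> {d \<in> Arr \<Delta>. Cod \<Gamma> d = Dom \<Gamma> q}"
  have fX: "finite (?X q)" for q using finite_Arr_\<Delta> by simp
  have fS: "finite (subfactorizations p)" for p
    unfolding subfactorizations_def using finite_factorizations by (rule rev_finite_subset) auto
  have union: "\<Union> (subfactorizations ` fibre s) = \<Union> (?X ` fibre s)"
  proof (intro equalityI subsetI)
    fix k assume "k \<in> \<Union> (subfactorizations ` fibre s)"
    then obtain p q d where "p \<in> fibre s" "k = (q, d)" "(q, d) \<in> subfactorizations p" by (cases k) auto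
    thus "k \<in> \<Union> (?X ` fibre s)" using subfactorizationsD by fastforce
  next
    fix k assume "k \<in> \<Union> (?X ` fibre s)"
    then obtain q d where k: "k = (q, d)" "q \<in> fibre s" "d \<in> Arr \<Delta>" "Cod \<Gamma> d = Dom \<Gamma> q" by auto
    hence "d \<in> Arr \<Gamma>" "Dom \<Gamma> d \<in> Obj \<Delta>" using Arr_sub Dom_\<Delta> by auto
    hence "q \<cdot>\<^bsub>\<Gamma>\<^esub> d \<in> fibre s" "k \<in> subfactorizations (q \<cdot>\<^bsub>\<Gamma>\<^esub> d)"
      using k by (auto simp: fibre_def subfactorizations_def factorizations_def Cmp_arr)
    thus "k \<in> \<Union> (subfactorizations ` fibre s)" by blast
  qed
  have tc: "?t k \<in> W s" if "k \<in> \<Union> (?X ` fibre s)" for k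
  proof -
    from that obtain q d where k: "k = (q, d)" "q \<in> fibre s" "d \<in> Arr \<Delta>" "Cod \<Gamma> d = Dom \<Gamma> q" by auto
    hence "d \<in> Arr \<Gamma>" "Dom \<Gamma> d \<in> Obj \<Delta>" using Arr_sub Dom_\<Delta> by auto
    hence "q \<cdot>\<^bsub>\<Gamma>\<^esub> d \<in> fibre s" using k by (auto simp: fibre_def Cmp_arr)
    thus ?thesis
      using k S.smult_closed[OF m_closed[OF fibre_app[OF a k(2)] app_B[OF b k(3)]] value_at_closed[OF n]] by simp
  qed
  \<comment> \<open>The left side, grouped by products; pairs with \<open>d\<close> outside \<open>\<Delta>\<close> vanish under \<open>\<iota>\<close>.\<close>
  have "pairing s (a \<otimes>\<^bsub>A\<^esub> \<iota> b) n = (\<Oplus>\<^bsub>?S\<^esub>p\<in>fibre s. finsum ?S ?t (subfactorizations p))"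
    unfolding pairing_def
  proof (rule S.M.finsum_cong'[OF refl])
    show "(\<lambda>p. finsum ?S ?t (subfactorizations p)) \<in> fibre s \<rightarrow> W s"
      using tc[folded union] by (intro Pi_I S.M.finsum_closed) blast
    fix p assume p: "p \<in> fibre s"
    let ?v = "value_at n p"
    have v: "?v \<in> W s" by (rule value_at_closed[OF n p])
    have p': "p \<in> Arr \<Gamma>" using p by (simp add: fibre_def)
    note summand = mult_A_term[OF a \<iota>_closed[OF b]]
    have "(a \<otimes>\<^bsub>A\<^esub> \<iota> b) p \<odot>\<^bsub>?S\<^esub> ?v
        = (\<Oplus>\<^bsub>K\<^esub>qd\<in>factorizations p. a (fst qd) \<otimes>\<^bsub>K\<^esub> \<iota> b (snd qd)) \<odot>\<^bsub>?S\<^esub> ?v"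
      unfolding mult_A[OF p'] ..
    also have "\<dots> = (\<Oplus>\<^bsub>?S\<^esub>qd\<in>factorizations p. (a (fst qd) \<otimes>\<^bsub>K\<^esub> \<iota> b (snd qd)) \<odot>\<^bsub>?S\<^esub> ?v)"
      by (rule additive_finsum[OF abelian_group_axioms S.M.abelian_group_axioms])
        (use v summand S.smult_l_distr in auto)
    also have "\<dots> = finsum ?S ?t (subfactorizations p)"
    proof (rule S.M.add.finprod_mono_neutral_cong_right[OF finite_factorizations])
      show "subfactorizations p \<subseteq> factorizations p" by (auto simp: subfactorizations_def)
      show "(a (fst k) \<otimes>\<^bsub>K\<^esub> \<iota> b (snd k)) \<odot>\<^bsub>?S\<^esub> ?v = \<zero>\<^bsub>?S\<^esub>"
        if "k \<in> factorizations p - subfactorizations p" for k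
      proof -
        have "\<iota> b (snd k) = \<zero>\<^bsub>K\<^esub>" "fst k \<in> Arr \<Gamma>"
          using that by (auto simp: subfactorizations_def factorizations_def \<iota>_app split: if_splits)
        thus ?thesis using S.smult_l_null[OF v] app_A[OF a] by simp
      qed
      show "(a (fst k) \<otimes>\<^bsub>K\<^esub> \<iota> b (snd k)) \<odot>\<^bsub>?S\<^esub> ?v = ?t k" if "k \<in> subfactorizations p" for k
        using that subfactorizationsD[OF _ p, of "fst k" "snd k"]
        by (cases k) (simp add: \<iota>_app)
      show "(\<lambda>k. (a (fst k) \<otimes>\<^bsub>K\<^esub> \<iota> b (snd k)) \<odot>\<^bsub>?S\<^esub> ?v) \<in> factorizations p \<rightarrow> W s"
        using summand v by blast
    qed
    finally show "(a \<otimes>\<^bsub>A\<^esub> \<iota> b) p \<odot>\<^bsub>?S\<^esub> ?v = finsum ?S ?t (subfactorizations p)" .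
  qed
  also have "\<dots> = finsum ?S ?t (\<Union> (subfactorizations ` fibre s))"
  proof (rule S.M.add.finprod_UN_disjoint[OF finite_fibre fS, symmetric])
    show "pairwise (\<lambda>i k. disjnt (subfactorizations i) (subfactorizations k)) (fibre s)"
      by (auto simp: pairwise_def disjnt_def subfactorizations_def factorizations_def)
    show "?t k \<in> W s" if "p \<in> fibre s" "k \<in> subfactorizations p" for p k
      using tc[folded union] that by blast
  qed
  also have "\<dots> = (\<Oplus>\<^bsub>?S\<^esub>q\<in>fibre s. finsum ?S ?t (?X q))"
    unfolding union
  proof (rule S.M.add.finprod_UN_disjoint[OF finite_fibre fX])
    show "?t k \<in> W s" if "q \<in> fibre s" "k \<in> ?X q" for q k
      using tc that by blast
  qed (auto simp: pairwise_def disjnt_def)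
  also have "\<dots> = pairing s a (b \<odot>\<^bsub>N\<^esub> n)"
    unfolding pairing_def
  proof (rule S.M.finsum_cong'[OF refl, symmetric])
    show "(\<lambda>q. finsum ?S ?t (?X q)) \<in> fibre s \<rightarrow> W s"
      using tc by (intro Pi_I S.M.finsum_closed) blast
    fix q assume q: "q \<in> fibre s"
    hence q': "q \<in> Arr \<Gamma>" "Dom \<Gamma> q \<in> Obj \<Delta>" "Cod \<Gamma> q = s" "Dom \<Gamma> q \<in> Obj \<Gamma>"
      using Obj_sub by (auto simp: fibre_def)
    let ?D = "{d \<in> Arr \<Delta>. Cod \<Gamma> d = Dom \<Gamma> q}"
    let ?h = "\<lambda>v. a q \<odot>\<^bsub>?S\<^esub> rmap \<pi>' q (j (Dom \<Gamma> q) v)"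
    let ?f = "\<lambda>d. b d \<odot>\<^bsub>space \<pi> (Dom \<Gamma> q)\<^esub> rmap \<pi> d (n (Dom \<Gamma> d))"
    have hc: "?h \<in> U (Dom \<Gamma> q) \<rightarrow> W s"
      using rmap_closed[OF q'(1) j_closed[OF q'(2)]] fibre_app[OF a q] q'(3) by auto
    have fc: "?f \<in> ?D \<rightarrow> U (Dom \<Gamma> q)"
      using smult_N_term[OF b n] by fastforce
    have "a q \<odot>\<^bsub>?S\<^esub> value_at (b \<odot>\<^bsub>N\<^esub> n) q = ?h (finsum (space \<pi> (Dom \<Gamma> q)) ?f ?D)"
      unfolding value_at_def smult_N[OF q'(2) b n] ..
    also have "\<dots> = (\<Oplus>\<^bsub>?S\<^esub>d\<in>?D. ?h (?f d))"
    proof (rule additive_finsum[OF \<pi>_abelian[OF q'(2)] S.M.abelian_group_axioms hc _ fc])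
      fix x y assume xy: "x \<in> U (Dom \<Gamma> q)" "y \<in> U (Dom \<Gamma> q)"
      show "?h (x \<oplus>\<^bsub>space \<pi> (Dom \<Gamma> q)\<^esub> y) = ?h x \<oplus>\<^bsub>?S\<^esub> ?h y"
        using S.smult_r_distr[OF fibre_app[OF a q], of "rmap \<pi>' q (j (Dom \<Gamma> q) x)" "rmap \<pi>' q (j (Dom \<Gamma> q) y)"]
          rmap_closed[OF q'(1) j_closed[OF q'(2)]] xy q'(3)
        by (simp add: j_add[OF q'(2)] rmap_add[OF q'(1)] j_closed[OF q'(2)])
    qed
    also have "\<dots> = (\<Oplus>\<^bsub>?S\<^esub>d\<in>?D. ?t (q, d))"
    proof (rule S.M.finsum_cong'[OF refl])
      show "(\<lambda>d. ?t (q, d)) \<in> ?D \<rightarrow> W s" using tc q by blast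
      fix d assume d: "d \<in> ?D"
      hence d': "d \<in> Arr \<Delta>" "Cod \<Gamma> d = Dom \<Gamma> q" by auto
      have x: "rmap \<pi> d (n (Dom \<Gamma> d)) \<in> U (Dom \<Gamma> q)"
        using \<pi>_closed[OF d'(1) app_N[OF n Dom_\<Delta>[OF d'(1)]]] d'(2) by simp
      have "?h (?f d) = a q \<odot>\<^bsub>?S\<^esub> (b d \<odot>\<^bsub>?S\<^esub> rmap \<pi>' q (j (Dom \<Gamma> q) (rmap \<pi> d (n (Dom \<Gamma> d)))))"
        using j_smult[OF q'(2) app_B[OF b d'(1)] x] rmap_smult[OF q'(1) app_B[OF b d'(1)] j_closed[OF q'(2) x]] q'(3)
        by simp
      also have "\<dots> = ?t (q, d)"
        using S.smult_assoc1[OF fibre_app[OF a q] app_B[OF b d'(1)], of "rmap \<pi>' q (j (Dom \<Gamma> q) (rmap \<pi> d (n (Dom \<Gamma> d))))"]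
          rmap_closed[OF q'(1) j_closed[OF q'(2) x]] q'(3) value_at_Cmp[OF n q d'] by simp
      finally show "?h (?f d) = ?t (q, d)" .
    qed
    also have "\<dots> = finsum ?S ?t (Pair q ` ?D)"
      by (rule S.M.finsum_reindex[symmetric]) (use tc q in \<open>auto simp: inj_on_def\<close>)
    also have "Pair q ` ?D = ?X q" by auto
    finally show "a q \<odot>\<^bsub>?S\<^esub> value_at (b \<odot>\<^bsub>N\<^esub> n) q = finsum ?S ?t (?X q)" .
  qed
  finally show ?thesis .
qed

lemma ex_evaluation:
  assumes s: "s \<in> Obj \<Gamma>"
  shows "\<exists>\<beta>. \<beta> \<in> carrier T \<rightarrow> W s \<and>
    (\<forall>x\<in>carrier T. \<forall>y\<in>carrier T. \<beta> (x \<oplus>\<^bsub>T\<^esub> y) = \<beta> x \<oplus>\<^bsub>space \<pi>' s\<^esub> \<beta> y) \<and>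
    (\<forall>p\<in>fibre s. \<forall>v\<in>U (Dom \<Gamma> p). \<beta> (\<tau> p v) = rmap \<pi>' p (j (Dom \<Gamma> p) v))"
proof -
  interpret S: module K "space \<pi>' s" by (rule space_module[OF s])
  obtain \<beta> where \<beta>: "\<beta> \<in> carrier T \<rightarrow> W s"
    "\<And>x y. \<lbrakk>x \<in> carrier T; y \<in> carrier T\<rbrakk> \<Longrightarrow> \<beta> (x \<oplus>\<^bsub>T\<^esub> y) = \<beta> x \<oplus>\<^bsub>space \<pi>' s\<^esub> \<beta> y"
    "\<And>m n. \<lbrakk>m \<in> carrier A; n \<in> carrier N\<rbrakk> \<Longrightarrow> \<beta> (tens m n) = pairing s m n"
    by (rule lift[OF \<pi>'_abelian[OF s], of "pairing s"])
      (simp_all add: pairing_closed[OF s] pairing_add_left[OF s] pairing_add_right[OF s] pairing_balanced[OF s])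
  have "\<beta> (\<tau> p v) = rmap \<pi>' p (j (Dom \<Gamma> p) v)"
    if p: "p \<in> fibre s" and v: "v \<in> U (Dom \<Gamma> p)" for p v
  proof -
    have p': "p \<in> Arr \<Gamma>" "Dom \<Gamma> p \<in> Obj \<Delta>" using p by (auto simp: fibre_def)
    let ?n = "\<delta> (Dom \<Gamma> p) v"
    have n: "?n \<in> carrier N" by (rule \<delta>_closed[OF v])
    have "\<beta> (\<tau> p v) = pairing s (single K \<Gamma> \<one>\<^bsub>K\<^esub> p) ?n"
      unfolding \<tau>_def by (rule \<beta>(3)[OF single_closed[OF one_closed] n])
    also have "\<dots> = single K \<Gamma> \<one>\<^bsub>K\<^esub> p p \<odot>\<^bsub>space \<pi>' s\<^esub> value_at ?n p"
      unfolding pairing_def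
    proof (rule S.finsum_single[OF finite_fibre p])
      show "single K \<Gamma> \<one>\<^bsub>K\<^esub> p k \<odot>\<^bsub>space \<pi>' s\<^esub> value_at ?n k = \<zero>\<^bsub>space \<pi>' s\<^esub>"
        if "k \<in> fibre s" "k \<noteq> p" for k
        using S.smult_l_null[OF value_at_closed[OF n that(1)]] that by (simp add: single_def fibre_def)
    qed (rule pairing_term[OF s single_closed[OF one_closed] n p])
    also have "\<dots> = value_at ?n p"
      using S.smult_one[OF value_at_closed[OF n p]] p' by (simp add: single_def)
    also have "\<dots> = rmap \<pi>' p (j (Dom \<Gamma> p) v)" using p' by (simp add: value_at_def)
    finally show ?thesis .
  qed
  with \<beta>(1,2) show ?thesis by (intro exI[of _ \<beta>]) simp
qed

text \<open>The map that \<open>pairing\<close> induces on the tensor product. On the subspace \<open>E s\<close> it is determined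
  by these properties.\<close>

definition evaluation :: "'o \<Rightarrow> (('a \<Rightarrow> 'k) \<times> ('o \<Rightarrow> 'v) \<Rightarrow>\<^sub>0 int) set \<Rightarrow> 'w" where
  "evaluation s = (SOME \<beta>. \<beta> \<in> carrier T \<rightarrow> W s \<and>
    (\<forall>x\<in>carrier T. \<forall>y\<in>carrier T. \<beta> (x \<oplus>\<^bsub>T\<^esub> y) = \<beta> x \<oplus>\<^bsub>space \<pi>' s\<^esub> \<beta> y) \<and>
    (\<forall>p\<in>fibre s. \<forall>v\<in>U (Dom \<Gamma> p). \<beta> (\<tau> p v) = rmap \<pi>' p (j (Dom \<Gamma> p) v)))"

lemma evaluation:
  assumes s: "s \<in> Obj \<Gamma>"
  shows evaluation_closed: "evaluation s \<in> carrier T \<rightarrow> W s"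
    and evaluation_add: "\<And>x y. \<lbrakk>x \<in> carrier T; y \<in> carrier T\<rbrakk> \<Longrightarrow>
      evaluation s (x \<oplus>\<^bsub>T\<^esub> y) = evaluation s x \<oplus>\<^bsub>space \<pi>' s\<^esub> evaluation s y"
    and evaluation_\<tau>: "\<And>p v. \<lbrakk>p \<in> fibre s; v \<in> U (Dom \<Gamma> p)\<rbrakk> \<Longrightarrow>
      evaluation s (\<tau> p v) = rmap \<pi>' p (j (Dom \<Gamma> p) v)"
proof -
  note * = someI_ex[OF ex_evaluation[OF s], folded evaluation_def]
  show "evaluation s \<in> carrier T \<rightarrow> W s" using * by (rule conjunct1)
  show "evaluation s (x \<oplus>\<^bsub>T\<^esub> y) = evaluation s x \<oplus>\<^bsub>space \<pi>' s\<^esub> evaluation s y"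
    if "x \<in> carrier T" "y \<in> carrier T" for x y
    using *[THEN conjunct2, THEN conjunct1] that by simp
  show "evaluation s (\<tau> p v) = rmap \<pi>' p (j (Dom \<Gamma> p) v)"
    if "p \<in> fibre s" "v \<in> U (Dom \<Gamma> p)" for p v
    using *[THEN conjunct2, THEN conjunct2] that by simp
qed

lemma P_fibre: "\<lbrakk>s \<in> Obj \<Gamma>; p \<in> P s\<rbrakk> \<Longrightarrow> p \<in> fibre s"
  using P_arr by (simp add: fibre_def)

definition spread :: "'o \<Rightarrow> ('a \<Rightarrow> 'v) \<Rightarrow> 'w" where
  "spread s v = (\<Oplus>\<^bsub>space \<pi>' s\<^esub>p\<in>P s. rmap \<pi>' p (j (Dom \<Gamma> p) (v p)))"

lemma spread_term:
  assumes "s \<in> Obj \<Gamma>" "p \<in> P s" "v \<in> U (Dom \<Gamma> p)"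
  shows "rmap \<pi>' p (j (Dom \<Gamma> p) v) \<in> W s"
  using rmap_closed[of p] j_closed P_arr[OF assms(1,2)] assms(3) by auto

lemma spread_closed:
  assumes s: "s \<in> Obj \<Gamma>" and v: "v \<in> families s"
  shows "spread s v \<in> W s"
  unfolding spread_def
  by (rule abelian_monoid.finsum_closed[OF abelian_group.axioms(1)[OF \<pi>'_abelian[OF s]]])
    (use spread_term[OF s] families_app[OF v] in blast)

lemma evaluation_\<tau>_sum:
  assumes s: "s \<in> Obj \<Gamma>" and f: "\<And>p. p \<in> I \<Longrightarrow> f p \<in> fibre s"
    and v: "\<And>p. p \<in> I \<Longrightarrow> v p \<in> U (Dom \<Gamma> (f p))"
  shows "evaluation s (\<Oplus>\<^bsub>T\<^esub>p\<in>I. \<tau> (f p) (v p)) = (\<Oplus>\<^bsub>space \<pi>' s\<^esub>p\<in>I. rmap \<pi>' (f p) (j (Dom \<Gamma> (f p)) (v p)))"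
proof -
  interpret S: module K "space \<pi>' s" by (rule space_module[OF s])
  have "evaluation s (\<Oplus>\<^bsub>T\<^esub>p\<in>I. \<tau> (f p) (v p)) = (\<Oplus>\<^bsub>space \<pi>' s\<^esub>p\<in>I. evaluation s (\<tau> (f p) (v p)))"
    by (rule additive_finsum[OF abelian_group_T \<pi>'_abelian[OF s] evaluation_closed[OF s] evaluation_add[OF s]])
      (use \<tau>_closed v in auto)
  also have "\<dots> = (\<Oplus>\<^bsub>space \<pi>' s\<^esub>p\<in>I. rmap \<pi>' (f p) (j (Dom \<Gamma> (f p)) (v p)))"
  proof (rule S.M.finsum_cong'[OF refl])
    show "evaluation s (\<tau> (f p) (v p)) = rmap \<pi>' (f p) (j (Dom \<Gamma> (f p)) (v p))" if "p \<in> I" for p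
      by (rule evaluation_\<tau>[OF s f[OF that] v[OF that]])
    show "(\<lambda>p. rmap \<pi>' (f p) (j (Dom \<Gamma> (f p)) (v p))) \<in> I \<rightarrow> W s"
    proof
      fix p assume p: "p \<in> I"
      show "rmap \<pi>' (f p) (j (Dom \<Gamma> (f p)) (v p)) \<in> W s"
        unfolding evaluation_\<tau>[OF s f[OF p] v[OF p], symmetric]
        by (rule funcset_mem[OF evaluation_closed[OF s] \<tau>_closed[OF v[OF p]]])
    qed
  qed
  finally show ?thesis .
qed

lemma evaluation_assemble:
  assumes s: "s \<in> Obj \<Gamma>" and v: "v \<in> families s"
  shows "evaluation s (assemble s v) = spread s v"
  unfolding assemble_def spread_def
  by (rule evaluation_\<tau>_sum[OF s P_fibre[OF s] families_app[OF v]])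

lemma pr_spread:
  assumes s: "s \<in> Obj \<Gamma>" and v: "v \<in> families s" and p: "p \<in> P s"
  shows "pr p (spread s v) = v p"
proof -
  have Q: "abelian_group (space \<pi> (Dom \<Gamma> p))" using P_arr[OF s p] \<pi>_abelian by blast
  then interpret Q: abelian_group "space \<pi> (Dom \<Gamma> p)" .
  have "pr p (spread s v) = (\<Oplus>\<^bsub>space \<pi> (Dom \<Gamma> p)\<^esub>p'\<in>P s. pr p (rmap \<pi>' p' (j (Dom \<Gamma> p') (v p'))))"
    unfolding spread_def
    by (rule additive_finsum[OF \<pi>'_abelian[OF s] Q])
      (use pr_closed[OF s p] pr_add[OF s p] spread_term[OF s] families_app[OF v] in auto)
  also have "\<dots> = pr p (rmap \<pi>' p (j (Dom \<Gamma> p) (v p)))"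
  proof (rule Q.finsum_single[OF finite_P[OF s] p])
    show "pr p (rmap \<pi>' p (j (Dom \<Gamma> p) (v p))) \<in> U (Dom \<Gamma> p)"
      by (intro pr_closed[OF s p] spread_term[OF s p] families_app[OF v p])
    show "pr p (rmap \<pi>' k (j (Dom \<Gamma> k) (v k))) = \<zero>\<^bsub>space \<pi> (Dom \<Gamma> p)\<^esub>" if "k \<in> P s" "k \<noteq> p" for k
      by (rule pr_other[OF s p that(1) that(2)[symmetric] families_app[OF v that(1)]])
  qed
  also have "\<dots> = v p" by (rule pr_same[OF s p families_app[OF v p]])
  finally show ?thesis .
qed

text \<open>The difference between \<open>w\<close> and the sum reassembled from its projections is annihilated by all
  projections.\<close>

lemma ex_spread:
  assumes s: "s \<in> Obj \<Gamma>" and w: "w \<in> W s"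
  shows "\<exists>v\<in>families s. w = spread s v"
proof
  interpret S: module K "space \<pi>' s" by (rule space_module[OF s])
  let ?v = "\<lambda>p. pr p w"
  show v: "?v \<in> families s" using pr_closed[OF s _ w] by (simp add: families_def)
  have "w \<ominus>\<^bsub>space \<pi>' s\<^esub> spread s ?v = \<zero>\<^bsub>space \<pi>' s\<^esub>"
  proof (rule pr_joint[OF s S.M.minus_closed[OF w spread_closed[OF s v]]])
    fix p assume p: "p \<in> P s"
    have Q: "abelian_group (space \<pi> (Dom \<Gamma> p))" using P_arr[OF s p] \<pi>_abelian by blast
    then interpret Q: abelian_group "space \<pi> (Dom \<Gamma> p)" .
    have "pr p (w \<ominus>\<^bsub>space \<pi>' s\<^esub> spread s ?v) = pr p w \<ominus>\<^bsub>space \<pi> (Dom \<Gamma> p)\<^esub> pr p (spread s ?v)"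
      by (rule additive_minus[OF \<pi>'_abelian[OF s] Q _ _ w spread_closed[OF s v]])
        (use pr_closed[OF s p] pr_add[OF s p] in auto)
    thus "pr p (w \<ominus>\<^bsub>space \<pi>' s\<^esub> spread s ?v) = \<zero>\<^bsub>space \<pi> (Dom \<Gamma> p)\<^esub>"
      using pr_spread[OF s v p] pr_closed[OF s p w] by (simp add: Q.minus_eq Q.r_neg)
  qed
  moreover have "w = (w \<ominus>\<^bsub>space \<pi>' s\<^esub> spread s ?v) \<oplus>\<^bsub>space \<pi>' s\<^esub> spread s ?v"
    using w spread_closed[OF s v] by (simp add: S.M.minus_eq S.M.a_assoc S.M.l_neg)
  ultimately show "w = spread s ?v" using spread_closed[OF s v] by simp
qed

lemma E_closed: "s \<in> Obj \<Gamma> \<Longrightarrow> x \<in> E s \<Longrightarrow> x \<in> carrier T"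
  using E_eq assemble_closed by auto

text \<open>The projections recover a family from its sum, and every element is such a sum. So
  \<open>assemble\<close> and \<open>spread\<close> parametrize both sides by the same families, up to the values of a family
  outside \<open>P s\<close>.\<close>

lemma evaluation_bij:
  assumes s: "s \<in> Obj \<Gamma>" shows "bij_betw (evaluation s) (E s) (W s)"
  unfolding bij_betw_def
proof
  show "inj_on (evaluation s) (E s)"
  proof (rule inj_onI)
    fix x y assume "x \<in> E s" "y \<in> E s" and eq: "evaluation s x = evaluation s y"
    then obtain v w where v: "v \<in> families s" "x = assemble s v" and w: "w \<in> families s" "y = assemble s w"
      using E_eq[OF s] by auto
    have "v p = w p" if "p \<in> P s" for p
      using eq pr_spread[OF s v(1) that] pr_spread[OF s w(1) that]
      by (simp add: v w evaluation_assemble[OF s])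
    thus "x = y" unfolding v(2) w(2) assemble_def
      by (intro T.finsum_cong'[OF refl]) (use \<tau>_closed families_app[OF w(1)] in \<open>blast, simp\<close>)
  qed
  show "evaluation s ` E s = W s"
  proof (intro equalityI subsetI)
    fix w assume "w \<in> W s"
    then obtain v where "v \<in> families s" "w = spread s v" using ex_spread[OF s] by blast
    thus "w \<in> evaluation s ` E s"
      using evaluation_assemble[OF s] E_eq[OF s] by (metis imageI)
  qed (use evaluation_closed[OF s] E_closed[OF s] in auto)
qed

lemma evaluation_basis:
  assumes q: "q \<in> Arr \<Gamma>" and x: "x \<in> E (Dom \<Gamma> q)"
  shows "basis_elt K \<Gamma> q \<odot>\<^bsub>T\<^esub> x \<in> E (Cod \<Gamma> q)"
    and "evaluation (Cod \<Gamma> q) (basis_elt K \<Gamma> q \<odot>\<^bsub>T\<^esub> x) = rmap \<pi>' q (evaluation (Dom \<Gamma> q) x)"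
proof -
  let ?s = "Dom \<Gamma> q" and ?s' = "Cod \<Gamma> q"
  have s: "?s \<in> Obj \<Gamma>" "?s' \<in> Obj \<Gamma>" using q Dom_closed Cod_closed by auto
  obtain v where v: "v \<in> families ?s" "x = assemble ?s v" using x E_eq[OF s(1)] by auto
  note i = Ide_arr[OF s(2)]
  have qp: "q \<cdot>\<^bsub>\<Gamma>\<^esub> p \<in> fibre ?s'" "Dom \<Gamma> (q \<cdot>\<^bsub>\<Gamma>\<^esub> p) = Dom \<Gamma> p" "p \<in> Arr \<Gamma>" "Cod \<Gamma> p = Dom \<Gamma> q"
    "Dom \<Gamma> p \<in> Obj \<Delta>" if "p \<in> P ?s" for p
    using P_arr[OF s(1) that] q by (auto simp: fibre_def Cmp_arr)
  have bx: "basis_elt K \<Gamma> q \<odot>\<^bsub>T\<^esub> x = (\<Oplus>\<^bsub>T\<^esub>p\<in>P ?s. \<tau> (q \<cdot>\<^bsub>\<Gamma>\<^esub> p) (v p))"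
    unfolding v(2) by (rule basis_assemble[OF q v(1)])
  have tc: "(\<lambda>p. \<tau> (q \<cdot>\<^bsub>\<Gamma>\<^esub> p) (v p)) \<in> P ?s \<rightarrow> carrier T"
    using \<tau>_closed families_app[OF v(1)] qp(2) by fastforce
  have "basis_elt K \<Gamma> (Ide \<Gamma> ?s') \<odot>\<^bsub>T\<^esub> (basis_elt K \<Gamma> q \<odot>\<^bsub>T\<^esub> x)
      = (\<Oplus>\<^bsub>T\<^esub>p\<in>P ?s. basis_elt K \<Gamma> (Ide \<Gamma> ?s') \<odot>\<^bsub>T\<^esub> \<tau> (q \<cdot>\<^bsub>\<Gamma>\<^esub> p) (v p))"
    unfolding bx by (rule additive_finsum[OF abelian_group_T abelian_group_T basis_smult(1,2)[OF i(1)] tc])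
  also have "\<dots> = basis_elt K \<Gamma> q \<odot>\<^bsub>T\<^esub> x" unfolding bx
  proof (rule T.finsum_cong'[OF refl tc])
    fix p assume p: "p \<in> P ?s"
    have "Ide \<Gamma> ?s' \<cdot>\<^bsub>\<Gamma>\<^esub> (q \<cdot>\<^bsub>\<Gamma>\<^esub> p) = q \<cdot>\<^bsub>\<Gamma>\<^esub> p"
      using qp(1)[OF p] by (intro Ide_left_arr) (auto simp: fibre_def)
    thus "basis_elt K \<Gamma> (Ide \<Gamma> ?s') \<odot>\<^bsub>T\<^esub> \<tau> (q \<cdot>\<^bsub>\<Gamma>\<^esub> p) (v p) = \<tau> (q \<cdot>\<^bsub>\<Gamma>\<^esub> p) (v p)"
      using basis_smult_\<tau>[OF i(1), of "q \<cdot>\<^bsub>\<Gamma>\<^esub> p" "v p"] qp[OF p] families_app[OF v(1) p] i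
      by (simp add: fibre_def)
  qed
  finally have "basis_elt K \<Gamma> q \<odot>\<^bsub>T\<^esub> x
      = basis_elt K \<Gamma> (Ide \<Gamma> ?s') \<odot>\<^bsub>T\<^esub> (basis_elt K \<Gamma> q \<odot>\<^bsub>T\<^esub> x)" ..
  moreover have "basis_elt K \<Gamma> q \<odot>\<^bsub>T\<^esub> x \<in> carrier T"
    unfolding bx by (rule T.finsum_closed[OF tc])
  ultimately show "basis_elt K \<Gamma> q \<odot>\<^bsub>T\<^esub> x \<in> E ?s'" unfolding E_def by (rule image_eqI)
  have "evaluation ?s' (basis_elt K \<Gamma> q \<odot>\<^bsub>T\<^esub> x)
      = (\<Oplus>\<^bsub>space \<pi>' ?s'\<^esub>p\<in>P ?s. rmap \<pi>' (q \<cdot>\<^bsub>\<Gamma>\<^esub> p) (j (Dom \<Gamma> (q \<cdot>\<^bsub>\<Gamma>\<^esub> p)) (v p)))"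
    unfolding bx by (rule evaluation_\<tau>_sum[OF s(2)]) (use qp families_app[OF v(1)] in simp_all)
  also have "\<dots> = (\<Oplus>\<^bsub>space \<pi>' ?s'\<^esub>p\<in>P ?s. rmap \<pi>' q (rmap \<pi>' p (j (Dom \<Gamma> p) (v p))))"
  proof (rule abelian_monoid.finsum_cong'[OF abelian_group.axioms(1)[OF \<pi>'_abelian[OF s(2)]] refl])
    show "rmap \<pi>' (q \<cdot>\<^bsub>\<Gamma>\<^esub> p) (j (Dom \<Gamma> (q \<cdot>\<^bsub>\<Gamma>\<^esub> p)) (v p)) = rmap \<pi>' q (rmap \<pi>' p (j (Dom \<Gamma> p) (v p)))"
      if p: "p \<in> P ?s" for p
      using rmap_Cmp_arr[OF qp(3)[OF p] q qp(4)[OF p, symmetric] j_closed[OF qp(5)[OF p] families_app[OF v(1) p]]]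
        qp(2)[OF p] by simp
    show "(\<lambda>p. rmap \<pi>' q (rmap \<pi>' p (j (Dom \<Gamma> p) (v p)))) \<in> P ?s \<rightarrow> W ?s'"
      using rmap_closed[OF q] spread_term[OF s(1)] families_app[OF v(1)] by simp
  qed
  also have "\<dots> = rmap \<pi>' q (spread ?s v)"
    unfolding spread_def
    by (rule additive_finsum[OF \<pi>'_abelian[OF s(1)] \<pi>'_abelian[OF s(2)], symmetric])
      (use rmap_closed[OF q] rmap_add[OF q] spread_term[OF s(1)] families_app[OF v(1)] in auto)
  finally show "evaluation ?s' (basis_elt K \<Gamma> q \<odot>\<^bsub>T\<^esub> x) = rmap \<pi>' q (evaluation ?s x)"
    unfolding v(2) evaluation_assemble[OF s(1) v(1)] .
qed

lemma evaluation_scalar: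
  assumes s: "s \<in> Obj \<Gamma>" and c: "c \<in> carrier K" and x: "x \<in> E s"
  shows "scalar c \<odot>\<^bsub>T\<^esub> x \<in> E s"
    and "evaluation s (scalar c \<odot>\<^bsub>T\<^esub> x) = c \<odot>\<^bsub>space \<pi>' s\<^esub> evaluation s x"
proof -
  interpret S: module K "space \<pi>' s" by (rule space_module[OF s])
  obtain v where v: "v \<in> families s" "x = assemble s v" using x E_eq[OF s] by auto
  let ?u = "\<lambda>p. c \<odot>\<^bsub>space \<pi> (Dom \<Gamma> p)\<^esub> v p"
  have u: "?u \<in> families s"
    using smult_\<pi>_closed[OF _ c] families_app[OF v(1)] P_arr[OF s] by (simp add: families_def)
  have "scalar c \<odot>\<^bsub>T\<^esub> x = (\<Oplus>\<^bsub>T\<^esub>p\<in>P s. scalar c \<odot>\<^bsub>T\<^esub> \<tau> p (v p))"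
    unfolding v(2) assemble_def
    by (rule additive_finsum[OF abelian_group_T abelian_group_T scalar_smult(1,2)[OF c]])
      (use \<tau>_closed[OF families_app[OF v(1)]] in auto)
  also have "\<dots> = assemble s ?u" unfolding assemble_def
  proof (rule T.finsum_cong'[OF refl])
    show "(\<lambda>p. \<tau> p (?u p)) \<in> P s \<rightarrow> carrier T" using \<tau>_closed families_app[OF u] by blast
    show "scalar c \<odot>\<^bsub>T\<^esub> \<tau> p (v p) = \<tau> p (?u p)" if "p \<in> P s" for p
      using scalar_smult_\<tau>[OF c] P_arr[OF s that] families_app[OF v(1) that] by blast
  qed
  finally have cx: "scalar c \<odot>\<^bsub>T\<^esub> x = assemble s ?u" .
  show "scalar c \<odot>\<^bsub>T\<^esub> x \<in> E s" unfolding cx E_eq[OF s] using u by (rule imageI)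
  have "evaluation s (scalar c \<odot>\<^bsub>T\<^esub> x) = spread s ?u" unfolding cx by (rule evaluation_assemble[OF s u])
  also have "\<dots> = (\<Oplus>\<^bsub>space \<pi>' s\<^esub>p\<in>P s. c \<odot>\<^bsub>space \<pi>' s\<^esub> rmap \<pi>' p (j (Dom \<Gamma> p) (v p)))"
    unfolding spread_def
  proof (rule S.M.finsum_cong'[OF refl])
    show "(\<lambda>p. c \<odot>\<^bsub>space \<pi>' s\<^esub> rmap \<pi>' p (j (Dom \<Gamma> p) (v p))) \<in> P s \<rightarrow> W s"
      using S.smult_closed[OF c] spread_term[OF s] families_app[OF v(1)] by blast
    fix p assume p: "p \<in> P s"
    have p': "p \<in> Arr \<Gamma>" "Cod \<Gamma> p = s" "Dom \<Gamma> p \<in> Obj \<Delta>" using P_arr[OF s p] by auto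
    show "rmap \<pi>' p (j (Dom \<Gamma> p) (?u p)) = c \<odot>\<^bsub>space \<pi>' s\<^esub> rmap \<pi>' p (j (Dom \<Gamma> p) (v p))"
      using j_smult[OF p'(3) c families_app[OF v(1) p]]
        rmap_smult[OF p'(1) c j_closed[OF p'(3) families_app[OF v(1) p]]] p'(2) by simp
  qed
  also have "\<dots> = c \<odot>\<^bsub>space \<pi>' s\<^esub> spread s v"
    unfolding spread_def
    by (rule additive_finsum[OF S.M.abelian_group_axioms S.M.abelian_group_axioms, symmetric])
      (use S.smult_closed[OF c] S.smult_r_distr[OF c] spread_term[OF s] families_app[OF v(1)] in auto)
  finally show "evaluation s (scalar c \<odot>\<^bsub>T\<^esub> x) = c \<odot>\<^bsub>space \<pi>' s\<^esub> evaluation s x"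
    unfolding v(2) evaluation_assemble[OF s v(1)] .
qed

abbreviation "Ind \<equiv> induced_representation K \<Delta> \<Gamma> \<pi>"

lemma Ind_simps:
  "carrier (space Ind s) = E s" "\<zero>\<^bsub>space Ind s\<^esub> = \<zero>\<^bsub>T\<^esub>"
  "x \<oplus>\<^bsub>space Ind s\<^esub> y = x \<oplus>\<^bsub>T\<^esub> y" "c \<odot>\<^bsub>space Ind s\<^esub> x = scalar c \<odot>\<^bsub>T\<^esub> x"
  "rmap Ind q x = basis_elt K \<Gamma> q \<odot>\<^bsub>T\<^esub> x"
  by (simp_all add: induced_representation_def module_rep_def E_def scalar_def)

lemma Ind_module:
  assumes s: "s \<in> Obj \<Gamma>" shows "module K (space Ind s)"
proof (rule module_by_coordinates[where I = "{()}" and N = "\<lambda>_. space \<pi>' s" and ev = "\<lambda>_. evaluation s"])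
  show "cring K" by (rule is_cring)
  show "module K (space \<pi>' s)" by (rule space_module[OF s])
  show "x = y" if "x \<in> carrier (space Ind s)" "y \<in> carrier (space Ind s)"
      "\<And>i. i \<in> {()} \<Longrightarrow> evaluation s x = evaluation s y" for x y
    using that evaluation_bij[OF s] by (auto simp: Ind_simps bij_betw_def inj_on_def)
  show "\<zero>\<^bsub>space Ind s\<^esub> \<in> carrier (space Ind s)"
    unfolding Ind_simps E_eq[OF s] by (rule zero_assembled[OF s])
  show "evaluation s \<zero>\<^bsub>space Ind s\<^esub> = \<zero>\<^bsub>space \<pi>' s\<^esub>"
    unfolding Ind_simps
    by (rule additive_zero[OF abelian_group_T \<pi>'_abelian[OF s] evaluation_closed[OF s] evaluation_add[OF s]])
  show "x \<oplus>\<^bsub>space Ind s\<^esub> y \<in> carrier (space Ind s)"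
    if "x \<in> carrier (space Ind s)" "y \<in> carrier (space Ind s)" for x y
    using that unfolding Ind_simps E_eq[OF s] by (rule assemble_add[OF s])
  show "evaluation s x \<in> W s" if "x \<in> carrier (space Ind s)" for x
    using that evaluation_closed[OF s] E_closed[OF s] by (auto simp: Ind_simps)
qed (unfold Ind_simps, use evaluation_add[OF s] E_closed[OF s] evaluation_scalar[OF s] in simp_all)

text \<open>Each identity is checked after the injective map \<open>evaluation\<close>, where it becomes one of \<open>\<pi>'\<close>.\<close>

lemma Ind_representation: "representation K \<Gamma> Ind"
proof -
  have inj: "x = y" if "s \<in> Obj \<Gamma>" "x \<in> E s" "y \<in> E s" "evaluation s x = evaluation s y" for s x y
    using evaluation_bij[OF that(1)] that(2-) by (auto simp: bij_betw_def inj_on_def)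
  have cl: "evaluation s x \<in> W s" if "s \<in> Obj \<Gamma>" "x \<in> E s" for s x
    using evaluation_closed[OF that(1)] E_closed[OF that] by auto
  have add: "x \<oplus>\<^bsub>T\<^esub> y \<in> E s" if "s \<in> Obj \<Gamma>" "x \<in> E s" "y \<in> E s" for s x y
    using that assemble_add E_eq by simp
  show ?thesis
  proof (intro representation.intro field_axioms groupoid_axioms representation_axioms.intro)
    show "module K (space Ind x)" if "x \<in> Obj \<Gamma>" for x by (rule Ind_module[OF that])
  next
    fix a x y assume "a \<in> homs \<Gamma> x y"
    hence a: "a \<in> Arr \<Gamma>" "Dom \<Gamma> a = x" "Cod \<Gamma> a = y" by (auto simp: homs_def)
    have o: "x \<in> Obj \<Gamma>" "y \<in> Obj \<Gamma>" using a Dom_closed Cod_closed by auto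
    have e: "basis_elt K \<Gamma> a \<odot>\<^bsub>T\<^esub> v \<in> E y" if "v \<in> E x" for v
      using evaluation_basis(1)[OF a(1)] a that by simp
    have "basis_elt K \<Gamma> a \<odot>\<^bsub>T\<^esub> (scalar c \<odot>\<^bsub>T\<^esub> v) = scalar c \<odot>\<^bsub>T\<^esub> (basis_elt K \<Gamma> a \<odot>\<^bsub>T\<^esub> v)"
      if c: "c \<in> carrier K" and v: "v \<in> E x" for c v
    proof (rule inj[OF o(2)])
      show "evaluation y (basis_elt K \<Gamma> a \<odot>\<^bsub>T\<^esub> (scalar c \<odot>\<^bsub>T\<^esub> v))
          = evaluation y (scalar c \<odot>\<^bsub>T\<^esub> (basis_elt K \<Gamma> a \<odot>\<^bsub>T\<^esub> v))"
        using evaluation_basis(2)[OF a(1)] a evaluation_scalar[OF o(1) c v] evaluation_scalar(2)[OF o(2) c e[OF v]]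
          rmap_smult[OF a(1) c] cl[OF o(1) v] v by simp
    qed (intro e evaluation_scalar(1) o c v)+
    moreover have "basis_elt K \<Gamma> a \<odot>\<^bsub>T\<^esub> (v \<oplus>\<^bsub>T\<^esub> w) = basis_elt K \<Gamma> a \<odot>\<^bsub>T\<^esub> v \<oplus>\<^bsub>T\<^esub> basis_elt K \<Gamma> a \<odot>\<^bsub>T\<^esub> w"
      if "v \<in> E x" "w \<in> E x" for v w
      by (rule basis_smult(2)[OF a(1)]) (use E_closed[OF o(1)] that in auto)
    ultimately show "rmap Ind a \<in> linear_maps K (space Ind x) (space Ind y)"
      using e by (simp add: linear_maps_def Ind_simps)
  next
    fix x v assume x: "x \<in> Obj \<Gamma>" and v: "v \<in> carrier (space Ind x)"
    note i = Ide_arr[OF x]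
    have v': "v \<in> E x" using v by (simp add: Ind_simps)
    show "rmap Ind (Ide \<Gamma> x) v = v" unfolding Ind_simps
      by (rule inj[OF x _ v'])
        (use evaluation_basis[OF i(1)] i v' rmap_Ide[OF x cl[OF x v']] in simp_all)
  next
    fix a x y b z v
    assume "a \<in> homs \<Gamma> x y" "b \<in> homs \<Gamma> y z" and v: "v \<in> carrier (space Ind x)"
    hence ab: "a \<in> Arr \<Gamma>" "Dom \<Gamma> a = x" "Cod \<Gamma> a = y" "b \<in> Arr \<Gamma>" "Dom \<Gamma> b = y" "Cod \<Gamma> b = z"
      by (auto simp: homs_def)
    have o: "x \<in> Obj \<Gamma>" "y \<in> Obj \<Gamma>" "z \<in> Obj \<Gamma>" using ab Dom_closed Cod_closed by auto
    have c: "b \<cdot>\<^bsub>\<Gamma>\<^esub> a \<in> Arr \<Gamma>" "Dom \<Gamma> (b \<cdot>\<^bsub>\<Gamma>\<^esub> a) = x" "Cod \<Gamma> (b \<cdot>\<^bsub>\<Gamma>\<^esub> a) = z"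
      using ab by (simp_all add: Cmp_arr)
    have v': "v \<in> E x" using v by (simp add: Ind_simps)
    note ea = evaluation_basis[OF ab(1), unfolded ab(2,3), OF v']
    note eb = evaluation_basis[OF ab(4), unfolded ab(5,6), OF ea(1)]
    note ec = evaluation_basis[OF c(1), unfolded c(2,3), OF v']
    show "rmap Ind (b \<cdot>\<^bsub>\<Gamma>\<^esub> a) v = rmap Ind b (rmap Ind a v)" unfolding Ind_simps
      by (rule inj[OF o(3) ec(1) eb(1)])
        (use ea(2) eb(2) ec(2) rmap_Cmp_arr[OF ab(1,4)] ab cl[OF o(1) v'] in simp)
  qed
qed

theorem isomorphic_induced: "isomorphic_representations K \<Gamma> \<pi>' Ind"
proof -
  \<comment> \<open>The isomorphism goes from \<open>\<pi>'\<close> to the induced representation, so it inverts \<open>evaluation\<close>.\<close>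
  define \<theta> where "\<theta> s = inv_into (E s) (evaluation s)" for s
  have \<theta>: "\<theta> s w \<in> E s" "evaluation s (\<theta> s w) = w" if "s \<in> Obj \<Gamma>" "w \<in> W s" for s w
    using evaluation_bij[OF that(1)] that(2) unfolding \<theta>_def bij_betw_def
    by (auto intro: inv_into_into f_inv_into_f)
  have \<theta>I: "\<theta> s w = x" if "s \<in> Obj \<Gamma>" "x \<in> E s" "evaluation s x = w" for s w x
    using evaluation_bij[OF that(1)] that(2,3) unfolding \<theta>_def bij_betw_def
    by (auto intro: inv_into_f_f)
  have lin: "\<theta> s \<in> linear_maps K (space \<pi>' s) (space Ind s)"
    and bij: "bij_betw (\<theta> s) (W s) (carrier (space Ind s))" if s: "s \<in> Obj \<Gamma>" for s
  proof -
    have "\<theta> s (v \<oplus>\<^bsub>space \<pi>' s\<^esub> w) = \<theta> s v \<oplus>\<^bsub>T\<^esub> \<theta> s w"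
      if "v \<in> W s" "w \<in> W s" for v w
    proof (rule \<theta>I[OF s])
      show "\<theta> s v \<oplus>\<^bsub>T\<^esub> \<theta> s w \<in> E s"
        using \<theta>(1)[OF s] that unfolding E_eq[OF s] by (intro assemble_add[OF s])
      show "evaluation s (\<theta> s v \<oplus>\<^bsub>T\<^esub> \<theta> s w) = v \<oplus>\<^bsub>space \<pi>' s\<^esub> w"
        using evaluation_add[OF s E_closed[OF s \<theta>(1)[OF s]] E_closed[OF s \<theta>(1)[OF s]]] \<theta>(2)[OF s] that by simp
    qed
    moreover have "\<theta> s (c \<odot>\<^bsub>space \<pi>' s\<^esub> v) = scalar c \<odot>\<^bsub>T\<^esub> \<theta> s v"
      if "c \<in> carrier K" "v \<in> W s" for c v
      by (rule \<theta>I[OF s]) (use evaluation_scalar[OF s that(1) \<theta>(1)[OF s that(2)]] \<theta>(2)[OF s that(2)] in simp_all)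
    ultimately show "\<theta> s \<in> linear_maps K (space \<pi>' s) (space Ind s)"
      using \<theta>(1)[OF s] by (simp add: linear_maps_def Ind_simps)
    show "bij_betw (\<theta> s) (W s) (carrier (space Ind s))"
      unfolding Ind_simps \<theta>_def by (rule bij_betw_inv_into[OF evaluation_bij[OF s]])
  qed
  have "\<theta> (Cod \<Gamma> a) (rmap \<pi>' a v) = rmap Ind a (\<theta> (Dom \<Gamma> a) v)"
    if a: "a \<in> Arr \<Gamma>" and v: "v \<in> W (Dom \<Gamma> a)" for a v
  proof -
    note e = evaluation_basis[OF a \<theta>(1)[OF Dom_closed[OF a] v]]
    show ?thesis unfolding Ind_simps
      by (rule \<theta>I[OF Cod_closed[OF a] e(1)]) (simp only: e(2) \<theta>(2)[OF Dom_closed[OF a] v])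
  qed
  thus ?thesis
    unfolding isomorphic_representations_def
    using representation_axioms Ind_representation lin bij
    by (intro conjI exI[of _ \<theta>]) (auto intro: representation.intro field_axioms groupoid_axioms)
qed

end

section \<open>Linear categories and categorical traces\<close>

context category
begin

lemma homs_arr: "a \<in> homs C x y \<longleftrightarrow> a \<in> Arr C \<and> Dom C a = x \<and> Cod C a = y"
  by (auto simp: homs_def)

lemma inverse_arrow_eq:
  assumes "inverse_arrows C a b" shows "inverse_arrow C a = b"
  unfolding inverse_arrow_def
proof (rule the_equality, rule assms)
  fix b' assume "inverse_arrows C a b'"
  hence b': "b' \<in> Arr C" "Dom C b' = Cod C a" "Cod C b' = Dom C a" "b' \<cdot> a = Ide C (Dom C a)"
    by (auto simp: inverse_arrows_def homs_def)
  have b: "a \<in> Arr C" "b \<in> Arr C" "Dom C b = Cod C a" "Cod C b = Dom C a" "a \<cdot> b = Ide C (Cod C a)"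
    using assms by (auto simp: inverse_arrows_def homs_def)
  have "b' = b' \<cdot> (a \<cdot> b)" using Ide_right_arr[OF b'(1,2)] by (simp only: b(5))
  also have "\<dots> = (b' \<cdot> a) \<cdot> b" using b b' by (intro Cmp_assoc_arr[symmetric]) simp_all
  also have "\<dots> = b" unfolding b'(4) by (rule Ide_left_arr[OF b(2,4)])
  finally show "b' = b" .
qed

lemma iso_arr:
  assumes "a \<in> isos C x y"
  shows "a \<in> Arr C" "Dom C a = x" "Cod C a = y"
    "inverse_arrow C a \<in> Arr C" "Dom C (inverse_arrow C a) = y" "Cod C (inverse_arrow C a) = x"
    "inverse_arrow C a \<cdot> a = Ide C x" "a \<cdot> inverse_arrow C a = Ide C y"
proof -
  obtain b where b: "a \<in> homs C x y" "inverse_arrows C a b" using assms by (auto simp: isos_def)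
  show "a \<in> Arr C" "Dom C a = x" "Cod C a = y"
    "inverse_arrow C a \<in> Arr C" "Dom C (inverse_arrow C a) = y" "Cod C (inverse_arrow C a) = x"
    "inverse_arrow C a \<cdot> a = Ide C x" "a \<cdot> inverse_arrow C a = Ide C y"
    using b by (auto simp: inverse_arrow_eq[OF b(2)] homs_def inverse_arrows_def)
qed

lemma iso_Cmp_inverse:
  assumes a: "a \<in> isos C x y" and b: "b \<in> Arr C"
  shows "Cod C b = x \<Longrightarrow> inverse_arrow C a \<cdot> (a \<cdot> b) = b"
    and "Cod C b = y \<Longrightarrow> a \<cdot> (inverse_arrow C a \<cdot> b) = b"
proof -
  note i = iso_arr[OF a]
  show "inverse_arrow C a \<cdot> (a \<cdot> b) = b" if bx: "Cod C b = x"
  proof -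
    have "inverse_arrow C a \<cdot> (a \<cdot> b) = (inverse_arrow C a \<cdot> a) \<cdot> b"
      by (rule Cmp_assoc_arr[OF b i(1,4), symmetric]) (simp_all add: i bx)
    also have "\<dots> = b" unfolding i(7) by (rule Ide_left_arr[OF b bx])
    finally show ?thesis .
  qed
  show "a \<cdot> (inverse_arrow C a \<cdot> b) = b" if bx: "Cod C b = y"
  proof -
    have "a \<cdot> (inverse_arrow C a \<cdot> b) = (a \<cdot> inverse_arrow C a) \<cdot> b"
      by (rule Cmp_assoc_arr[OF b i(4,1), symmetric]) (simp_all add: i bx)
    also have "\<dots> = b" unfolding i(8) by (rule Ide_left_arr[OF b bx])
    finally show ?thesis .
  qed
qed

lemma iso_cancel_left:
  assumes a: "a \<in> isos C x y" and b: "b \<in> Arr C" "Cod C b = x" and c: "c \<in> Arr C" "Cod C c = x"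
    and eq: "a \<cdot> b = a \<cdot> c"
  shows "b = c"
proof -
  have "b = inverse_arrow C a \<cdot> (a \<cdot> b)" by (rule iso_Cmp_inverse(1)[OF a b, symmetric])
  also have "\<dots> = c" unfolding eq by (rule iso_Cmp_inverse(1)[OF a c])
  finally show ?thesis .
qed

lemma iso_cancel_right:
  assumes a: "a \<in> isos C x y" and b: "b \<in> Arr C" "Dom C b = y" and c: "c \<in> Arr C" "Dom C c = y"
    and eq: "b \<cdot> a = c \<cdot> a"
  shows "b = c"
proof -
  note i = iso_arr[OF a]
  have *: "(d \<cdot> a) \<cdot> inverse_arrow C a = d" if d: "d \<in> Arr C" "Dom C d = y" for d
  proof -
    have "(d \<cdot> a) \<cdot> inverse_arrow C a = d \<cdot> (a \<cdot> inverse_arrow C a)"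
      by (rule Cmp_assoc_arr[OF i(4,1) d(1)]) (simp_all add: i d)
    also have "\<dots> = d" unfolding i(8) by (rule Ide_right_arr[OF d])
    finally show ?thesis .
  qed
  have "b = (b \<cdot> a) \<cdot> inverse_arrow C a" by (rule *[OF b, symmetric])
  also have "\<dots> = c" unfolding eq by (rule *[OF c])
  finally show ?thesis .
qed

lemma isosI:
  "\<lbrakk>a \<in> Arr C; Dom C a = x; Cod C a = y; b \<in> Arr C; Dom C b = y; Cod C b = x;
    b \<cdot> a = Ide C x; a \<cdot> b = Ide C y\<rbrakk> \<Longrightarrow> a \<in> isos C x y"
  by (auto simp: isos_def homs_def inverse_arrows_def)

lemma iso_inverse: "a \<in> isos C x y \<Longrightarrow> inverse_arrow C a \<in> isos C y x"
  by (rule isosI[where b = a]) (simp_all add: iso_arr)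

end

lemma (in cat_functor) amap_arr:
  assumes "a \<in> Arr C"
  shows "amap F a \<in> Arr D" "Dom D (amap F a) = omap F (Dom C a)" "Cod D (amap F a) = omap F (Cod C a)"
  using amap_closed[of a "Dom C a" "Cod C a"] assms by (auto simp: homs_def)

lemma (in cat_functor) amap_Cmp_arr:
  "\<lbrakk>a \<in> Arr C; b \<in> Arr C; Dom C b = Cod C a\<rbrakk> \<Longrightarrow> amap F (b \<cdot>\<^bsub>C\<^esub> a) = amap F b \<cdot>\<^bsub>D\<^esub> amap F a"
  using amap_Cmp[of a "Dom C a" "Cod C a" b "Cod C b"] by (auto simp: homs_def)

lemma (in cat_functor) amap_iso:
  assumes a: "a \<in> isos C x y"
  shows "amap F a \<in> isos D (omap F x) (omap F y)"
    and "inverse_arrow D (amap F a) = amap F (inverse_arrow C a)"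
proof -
  note i = dom.iso_arr[OF a]
  have o: "x \<in> Obj C" "y \<in> Obj C" using i dom.Dom_closed dom.Cod_closed by auto
  have c: "amap F (inverse_arrow C a) \<cdot>\<^bsub>D\<^esub> amap F a = Ide D (omap F x)"
    "amap F a \<cdot>\<^bsub>D\<^esub> amap F (inverse_arrow C a) = Ide D (omap F y)"
    using i o by (simp_all add: amap_Cmp_arr[symmetric] amap_Ide)
  show "amap F a \<in> isos D (omap F x) (omap F y)"
    by (rule cod.isosI[where b = "amap F (inverse_arrow C a)"]) (use i c in \<open>simp_all add: amap_arr\<close>)
  show "inverse_arrow D (amap F a) = amap F (inverse_arrow C a)"
    by (rule cod.inverse_arrow_eq) (use i c in \<open>simp add: inverse_arrows_def homs_def amap_arr\<close>)
qed

context linear_category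
begin

lemma Zero_arr:
  assumes "x \<in> Obj C" "y \<in> Obj C"
  shows "Zero C x y \<in> Arr C" "Dom C (Zero C x y) = x" "Cod C (Zero C x y) = y"
  using abelian_monoid.zero_closed[OF abelian_group.axioms(1)[OF module.axioms(2)[OF hom_space[OF assms]]]]
  by (auto simp: hom_space_def homs_def)

lemma homs_Obj: "a \<in> homs C x y \<Longrightarrow> x \<in> Obj C" "a \<in> homs C x y \<Longrightarrow> y \<in> Obj C"
  using Dom_closed Cod_closed by (auto simp: homs_def)

lemma Add_closed:
  assumes "a \<in> homs C x y" "b \<in> homs C x y" shows "Add C a b \<in> homs C x y"
  using abelian_monoid.a_closed[OF abelian_group.axioms(1)[OF module.axioms(2)[OF hom_space[of x y]]], of a b]
    homs_Obj[OF assms(1)] assms by (auto simp: hom_space_def)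

lemma Scal_closed:
  assumes "c \<in> carrier K" "a \<in> homs C x y" shows "Scal C c a \<in> homs C x y"
  using module.smult_closed[OF hom_space[of x y], of c a] homs_Obj[OF assms(2)] assms
  by (auto simp: hom_space_def)

lemma Cmp_Add_left:
  "\<lbrakk>a \<in> homs C x y; b \<in> homs C y z; b' \<in> homs C y z\<rbrakk> \<Longrightarrow> Add C b b' \<cdot>\<^bsub>C\<^esub> a = Add C (b \<cdot>\<^bsub>C\<^esub> a) (b' \<cdot>\<^bsub>C\<^esub> a)"
  using Cmp_linear_left[of a x y z] homs_Obj[of b y z] by (auto simp: linear_maps_def hom_space_def)

lemma Cmp_Add_right:
  "\<lbrakk>b \<in> homs C y z; a \<in> homs C x y; a' \<in> homs C x y\<rbrakk> \<Longrightarrow> b \<cdot>\<^bsub>C\<^esub> Add C a a' = Add C (b \<cdot>\<^bsub>C\<^esub> a) (b \<cdot>\<^bsub>C\<^esub> a')"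
  using Cmp_linear_right[of b y z x] homs_Obj[of a x y] by (auto simp: linear_maps_def hom_space_def)

lemma Cmp_Scal_left:
  "\<lbrakk>a \<in> homs C x y; b \<in> homs C y z; c \<in> carrier K\<rbrakk> \<Longrightarrow> Scal C c b \<cdot>\<^bsub>C\<^esub> a = Scal C c (b \<cdot>\<^bsub>C\<^esub> a)"
  using Cmp_linear_left[of a x y z] homs_Obj[of b y z] by (auto simp: linear_maps_def hom_space_def)

lemma Cmp_Scal_right:
  "\<lbrakk>b \<in> homs C y z; a \<in> homs C x y; c \<in> carrier K\<rbrakk> \<Longrightarrow> b \<cdot>\<^bsub>C\<^esub> Scal C c a = Scal C c (b \<cdot>\<^bsub>C\<^esub> a)"
  using Cmp_linear_right[of b y z x] homs_Obj[of a x y] by (auto simp: linear_maps_def hom_space_def)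

lemma linear_maps_zero:
  assumes "module K M" "module K N" "h \<in> linear_maps K M N"
  shows "h \<zero>\<^bsub>M\<^esub> = \<zero>\<^bsub>N\<^esub>"
  by (rule additive_zero[OF module.axioms(2)[OF assms(1)] module.axioms(2)[OF assms(2)]])
    (use assms(3) in \<open>auto simp: linear_maps_def\<close>)

lemma Cmp_Zero_left:
  assumes "a \<in> Arr C" "z \<in> Obj C" "Cod C a = y"
  shows "Zero C y z \<cdot>\<^bsub>C\<^esub> a = Zero C (Dom C a) z"
  using linear_maps_zero[OF hom_space hom_space Cmp_linear_left[of a "Dom C a" y z]] assms Dom_closed Cod_closed
  by (auto simp: hom_space_def homs_def)

lemma Cmp_Zero_right:
  assumes "b \<in> Arr C" "x \<in> Obj C" "Dom C b = y"
  shows "b \<cdot>\<^bsub>C\<^esub> Zero C x y = Zero C x (Cod C b)"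
  using linear_maps_zero[OF hom_space hom_space Cmp_linear_right[of b y "Cod C b" x]] assms Dom_closed Cod_closed
  by (auto simp: hom_space_def homs_def)

lemma nat_trans_id_iff:
  "\<xi> \<in> nat_trans C C id_functor A \<longleftrightarrow>
    \<xi> \<in> extensional (Obj C) \<and> (\<forall>x\<in>Obj C. \<xi> x \<in> homs C x (omap A x)) \<and>
    (\<forall>a\<in>Arr C. amap A a \<cdot>\<^bsub>C\<^esub> \<xi> (Dom C a) = \<xi> (Cod C a) \<cdot>\<^bsub>C\<^esub> a)"
  by (auto simp: nat_trans_def id_functor_def PiE_def Pi_def)

lemma cat_trace_module:
  assumes "cat_functor C C A" shows "module K (cat_trace C A)"
proof -
  interpret A: cat_functor C C A by fact
  have homs: "\<xi> x \<in> homs C x (omap A x)" if "\<xi> \<in> nat_trans C C id_functor A" "x \<in> Obj C" for \<xi> x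
    using that by (simp add: nat_trans_id_iff)
  have nat: "amap A a \<cdot>\<^bsub>C\<^esub> \<xi> (Dom C a) = \<xi> (Cod C a) \<cdot>\<^bsub>C\<^esub> a"
    if "\<xi> \<in> nat_trans C C id_functor A" "a \<in> Arr C" for \<xi> a
    using that by (simp add: nat_trans_id_iff)
  have a: "a \<in> homs C (Dom C a) (Cod C a)" "amap A a \<in> homs C (omap A (Dom C a)) (omap A (Cod C a))"
    "Dom C a \<in> Obj C" "Cod C a \<in> Obj C" if "a \<in> Arr C" for a
    using that A.amap_arr Dom_closed Cod_closed by (auto simp: homs_def)
  show ?thesis
  proof (rule module_by_coordinates[where I = "Obj C" and N = "\<lambda>x. hom_space C x (omap A x)" and ev = "\<lambda>x \<xi>. \<xi> x"])
    show "cring K" by (rule is_cring)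
    show "module K (hom_space C x (omap A x))" if "x \<in> Obj C" for x
      by (rule hom_space[OF that A.omap_closed[OF that]])
    show "\<xi> = \<eta>" if "\<xi> \<in> carrier (cat_trace C A)" "\<eta> \<in> carrier (cat_trace C A)"
      "\<And>x. x \<in> Obj C \<Longrightarrow> \<xi> x = \<eta> x" for \<xi> \<eta>
      using that by (intro extensionalityI[of _ "Obj C"]) (auto simp: cat_trace_def nat_trans_id_iff)
    show "\<zero>\<^bsub>cat_trace C A\<^esub> \<in> carrier (cat_trace C A)"
      by (auto simp: cat_trace_def nat_trans_id_iff homs_def Zero_arr A.omap_closed A.amap_arr a
          Cmp_Zero_left Cmp_Zero_right)
    show "\<xi> \<oplus>\<^bsub>cat_trace C A\<^esub> \<eta> \<in> carrier (cat_trace C A)"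
      if "\<xi> \<in> carrier (cat_trace C A)" "\<eta> \<in> carrier (cat_trace C A)" for \<xi> \<eta>
    proof -
      from that have t: "\<xi> \<in> nat_trans C C id_functor A" "\<eta> \<in> nat_trans C C id_functor A"
        by (simp_all add: cat_trace_def)
      have "amap A b \<cdot>\<^bsub>C\<^esub> Add C (\<xi> (Dom C b)) (\<eta> (Dom C b)) = Add C (\<xi> (Cod C b)) (\<eta> (Cod C b)) \<cdot>\<^bsub>C\<^esub> b"
        if b: "b \<in> Arr C" for b
        using Cmp_Add_right[OF a(2)[OF b] homs[OF t(1) a(3)[OF b]] homs[OF t(2) a(3)[OF b]]]
          Cmp_Add_left[OF a(1)[OF b] homs[OF t(1) a(4)[OF b]] homs[OF t(2) a(4)[OF b]]]
        by (simp add: nat[OF t(1) b] nat[OF t(2) b])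
      thus ?thesis
        using homs[OF t(1)] homs[OF t(2)]
        by (simp add: cat_trace_def nat_trans_id_iff Add_closed a)
    qed
    show "c \<odot>\<^bsub>cat_trace C A\<^esub> \<xi> \<in> carrier (cat_trace C A)"
      if c: "c \<in> carrier K" and "\<xi> \<in> carrier (cat_trace C A)" for c \<xi>
    proof -
      from that have t: "\<xi> \<in> nat_trans C C id_functor A" by (simp add: cat_trace_def)
      have "amap A b \<cdot>\<^bsub>C\<^esub> Scal C c (\<xi> (Dom C b)) = Scal C c (\<xi> (Cod C b)) \<cdot>\<^bsub>C\<^esub> b" if b: "b \<in> Arr C" for b
        using Cmp_Scal_right[OF a(2)[OF b] homs[OF t a(3)[OF b]] c]
          Cmp_Scal_left[OF a(1)[OF b] homs[OF t a(4)[OF b]] c]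
        by (simp add: nat[OF t b])
      thus ?thesis using homs[OF t] by (simp add: cat_trace_def nat_trans_id_iff Scal_closed c a)
    qed
  qed (auto simp: cat_trace_def hom_space_def homs)
qed

end

lemma (in linear_functor) amap_Add:
  assumes "a \<in> homs C x y" "b \<in> homs C x y"
  shows "amap F (Add C a b) = Add D (amap F a) (amap F b)"
  using amap_linear[of x y] dom.homs_Obj[OF assms(1)] assms by (auto simp: linear_maps_def hom_space_def)

lemma (in linear_functor) amap_Scal:
  assumes "c \<in> carrier K" "a \<in> homs C x y"
  shows "amap F (Scal C c a) = Scal D c (amap F a)"
  using amap_linear[of x y] dom.homs_Obj[OF assms(2)] assms by (auto simp: linear_maps_def hom_space_def)

lemma (in linear_functor) amap_Zero:
  assumes "x \<in> Obj C" "y \<in> Obj C"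
  shows "amap F (Zero C x y) = Zero D (omap F x) (omap F y)"
  using dom.linear_maps_zero[OF dom.hom_space cod.hom_space amap_linear[OF assms]] assms omap_closed
  by (simp add: hom_space_def)

section \<open>The induced category\<close>

locale induction_setting =
  fixes K :: "('k, 'r) ring_scheme" and G :: "('g, 's) monoid_scheme" (structure) and H :: "'g set"
    and V :: "('o, 'a, 'k, 'z) linear_category_scheme" and \<rho> :: "('g, 'o, 'a) action"
  assumes group_G: "group G" and finite_G: "finite (carrier G)" and subgroup_H: "subgroup H G"
    and action_H: "linear_action K (G\<lparr>carrier := H\<rparr>) V \<rho>"
begin

sublocale G: group G by (rule group_G)

sublocale V: linear_category K V
  using action_H by (simp add: linear_action_def)

text \<open>\<open>F h\<close> and \<open>M h\<close> are the functor \<open>\<rho>(h)\<close> on objects and on arrows, \<open>\<mu>\<close> and \<open>\<epsilon>\<close> the coherence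
  isomorphisms \<open>\<phi>\<^bsub>g,h\<^esub>\<close> and \<open>\<phi>\<^sub>1\<close>.\<close>

abbreviation comp (infixr \<open>\<bullet>\<close> 70) where "b \<bullet> a \<equiv> b \<cdot>\<^bsub>V\<^esub> a"
abbreviation "F h \<equiv> omap (act \<rho> h)"
abbreviation "M h \<equiv> amap (act \<rho> h)"
abbreviation "\<mu> \<equiv> act_mult \<rho>"
abbreviation "\<epsilon> \<equiv> act_one \<rho>"
abbreviation "iv \<equiv> inverse_arrow V"

lemmas H_closed [simp, intro] = subgroup.m_closed[OF subgroup_H] subgroup.m_inv_closed[OF subgroup_H]
  subgroup.one_closed[OF subgroup_H]

lemma H_G [simp, intro]: "h \<in> H \<Longrightarrow> h \<in> carrier G"
  by (rule subgroup.mem_carrier[OF subgroup_H])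

lemma inv_H: "h \<in> H \<Longrightarrow> inv\<^bsub>G\<lparr>carrier := H\<rparr>\<^esub> h = inv h"
  by (rule G.m_inv_consistent[OF subgroup_H])

lemma act_functor: "h \<in> H \<Longrightarrow> linear_functor K V V (act \<rho> h)"
  using linear_action.act_functor[OF action_H] by simp

lemma act_cat_functor: "h \<in> H \<Longrightarrow> cat_functor V V (act \<rho> h)"
  using act_functor by (simp add: linear_functor_def)

lemma F_Obj [simp]: "\<lbrakk>h \<in> H; x \<in> Obj V\<rbrakk> \<Longrightarrow> F h x \<in> Obj V"
  by (rule cat_functor.omap_closed[OF act_cat_functor])

lemma M_arr [simp]:
  "\<lbrakk>h \<in> H; a \<in> Arr V\<rbrakk> \<Longrightarrow> M h a \<in> Arr V"
  "\<lbrakk>h \<in> H; a \<in> Arr V\<rbrakk> \<Longrightarrow> Dom V (M h a) = F h (Dom V a)"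
  "\<lbrakk>h \<in> H; a \<in> Arr V\<rbrakk> \<Longrightarrow> Cod V (M h a) = F h (Cod V a)"
  by (rule cat_functor.amap_arr[OF act_cat_functor]; assumption)+

lemma M_Cmp: "\<lbrakk>h \<in> H; a \<in> Arr V; b \<in> Arr V; Dom V b = Cod V a\<rbrakk> \<Longrightarrow> M h (b \<bullet> a) = M h b \<bullet> M h a"
  by (rule cat_functor.amap_Cmp_arr[OF act_cat_functor])

lemma M_Ide: "\<lbrakk>h \<in> H; x \<in> Obj V\<rbrakk> \<Longrightarrow> M h (Ide V x) = Ide V (F h x)"
  by (rule cat_functor.amap_Ide[OF act_cat_functor])

lemma M_iso: "\<lbrakk>h \<in> H; a \<in> isos V x y\<rbrakk> \<Longrightarrow> M h a \<in> isos V (F h x) (F h y)"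
  by (rule cat_functor.amap_iso(1)[OF act_cat_functor])

lemma M_inverse: "\<lbrakk>h \<in> H; a \<in> isos V x y\<rbrakk> \<Longrightarrow> iv (M h a) = M h (iv a)"
  by (rule cat_functor.amap_iso(2)[OF act_cat_functor])

lemma M_Zero: "\<lbrakk>h \<in> H; x \<in> Obj V; y \<in> Obj V\<rbrakk> \<Longrightarrow> M h (Zero V x y) = Zero V (F h x) (F h y)"
  by (rule linear_functor.amap_Zero[OF act_functor])

lemma M_Add: "\<lbrakk>h \<in> H; a \<in> homs V x y; b \<in> homs V x y\<rbrakk> \<Longrightarrow> M h (Add V a b) = Add V (M h a) (M h b)"
  by (rule linear_functor.amap_Add[OF act_functor])

lemma M_Scal: "\<lbrakk>h \<in> H; c \<in> carrier K; a \<in> homs V x y\<rbrakk> \<Longrightarrow> M h (Scal V c a) = Scal V c (M h a)"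
  by (rule linear_functor.amap_Scal[OF act_functor])

lemma \<mu>_iso: "\<lbrakk>g \<in> H; h \<in> H; x \<in> Obj V\<rbrakk> \<Longrightarrow> \<mu> g h x \<in> isos V (F g (F h x)) (F (g \<otimes> h) x)"
  using linear_action.act_mult_iso[OF action_H, of g h]
  by (simp add: nat_isos_def comp_functor_def)

lemma \<mu>_arr [simp]:
  assumes "g \<in> H" "h \<in> H" "x \<in> Obj V"
  shows "\<mu> g h x \<in> Arr V" "Dom V (\<mu> g h x) = F g (F h x)" "Cod V (\<mu> g h x) = F (g \<otimes> h) x"
  using V.iso_arr[OF \<mu>_iso[OF assms]] by simp_all

lemma \<mu>_nat:
  assumes "g \<in> H" "h \<in> H" "a \<in> Arr V"
  shows "M (g \<otimes> h) a \<bullet> \<mu> g h (Dom V a) = \<mu> g h (Cod V a) \<bullet> M g (M h a)"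
  using linear_action.act_mult_iso[OF action_H, of g h] assms
  by (simp add: nat_isos_def nat_trans_def comp_functor_def)

lemma \<epsilon>_iso: "x \<in> Obj V \<Longrightarrow> \<epsilon> x \<in> isos V (F \<one> x) x"
  using linear_action.act_one_iso[OF action_H]
  by (simp add: nat_isos_def id_functor_def)

lemma \<epsilon>_arr [simp]:
  assumes "x \<in> Obj V"
  shows "\<epsilon> x \<in> Arr V" "Dom V (\<epsilon> x) = F \<one> x" "Cod V (\<epsilon> x) = x"
  using V.iso_arr[OF \<epsilon>_iso[OF assms]] by simp_all

lemma \<epsilon>_nat: "a \<in> Arr V \<Longrightarrow> a \<bullet> \<epsilon> (Dom V a) = \<epsilon> (Cod V a) \<bullet> M \<one> a"
  using linear_action.act_one_iso[OF action_H]
  by (simp add: nat_isos_def nat_trans_def id_functor_def)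

lemma \<mu>_assoc: "\<lbrakk>g \<in> H; h \<in> H; l \<in> H; x \<in> Obj V\<rbrakk> \<Longrightarrow>
    \<mu> (g \<otimes> h) l x \<bullet> \<mu> g h (F l x) = \<mu> g (h \<otimes> l) x \<bullet> M g (\<mu> h l x)"
  using linear_action.act_assoc[OF action_H, of g h l x] by simp

lemma \<mu>_one_left: "\<lbrakk>g \<in> H; x \<in> Obj V\<rbrakk> \<Longrightarrow> \<mu> \<one> g x = \<epsilon> (F g x)"
  using linear_action.act_one_left[OF action_H, of g x] by simp

lemmas Dom_Obj [simp] = V.Dom_closed V.Cod_closed
lemmas Cmp_simps [simp] = V.Cmp_arr
lemmas assoc = V.Cmp_assoc_arr

lemma inv_mult_H: "\<lbrakk>g \<in> H; h \<in> H\<rbrakk> \<Longrightarrow> inv (g \<otimes> h) = inv h \<otimes> inv g"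
  by (simp add: G.inv_mult_group)

text \<open>An arrow of the induced category is a triple whose middle part \<open>cm\<close> is its family of
  components.\<close>

abbreviation "I \<equiv> ind_category G H V \<rho>"
abbreviation "objs \<equiv> ind_objs G H V \<rho>"
abbreviation "cm \<alpha> \<equiv> fst (snd \<alpha>)"

lemma I_simps:
  "Obj I = objs" "Arr I = ind_arrs G H V \<rho>" "Dom I \<alpha> = fst \<alpha>" "Cod I \<alpha> = snd (snd \<alpha>)"
  "Ide I x = (x, \<lambda>g\<in>carrier G. Ide V (fst x g), x)"
  "\<beta> \<cdot>\<^bsub>I\<^esub> \<alpha> = (fst \<alpha>, \<lambda>g\<in>carrier G. cm \<beta> g \<bullet> cm \<alpha> g, snd (snd \<beta>))"
  "Zero I x y = (x, \<lambda>g\<in>carrier G. Zero V (fst x g) (fst y g), y)"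
  "Add I \<alpha> \<beta> = (fst \<alpha>, \<lambda>g\<in>carrier G. Add V (cm \<alpha> g) (cm \<beta> g), snd (snd \<alpha>))"
  "Scal I c \<alpha> = (fst \<alpha>, \<lambda>g\<in>carrier G. Scal V c (cm \<alpha> g), snd (snd \<alpha>))"
  by (simp_all add: ind_category_def split_beta)

lemma objsD:
  assumes "x \<in> objs"
  shows obj_Obj: "\<And>g. g \<in> carrier G \<Longrightarrow> fst x g \<in> Obj V"
    and obj_iso: "\<And>g h. \<lbrakk>g \<in> carrier G; h \<in> H\<rbrakk> \<Longrightarrow> snd x g h \<in> isos V (fst x (g \<otimes> h)) (F (inv h) (fst x g))"
    and obj_one: "\<And>g. g \<in> carrier G \<Longrightarrow> snd x g \<one> = iv (\<epsilon> (fst x g))"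
    and obj_mult: "\<And>g h k. \<lbrakk>g \<in> carrier G; h \<in> H; k \<in> H\<rbrakk> \<Longrightarrow>
      snd x g (h \<otimes> k) = \<mu> (inv k) (inv h) (fst x g) \<bullet> M (inv k) (snd x g h) \<bullet> snd x (g \<otimes> h) k"
    and obj_ext: "fst x \<in> extensional (carrier G)" "snd x \<in> extensional (carrier G)"
      "\<And>g. g \<in> carrier G \<Longrightarrow> snd x g \<in> extensional H"
  using assms by (auto simp: ind_objs_def PiE_def Pi_def)

lemma objsI:
  assumes "fst x \<in> extensional (carrier G)" "snd x \<in> extensional (carrier G)"
      "\<And>g. g \<in> carrier G \<Longrightarrow> snd x g \<in> extensional H"
    and "\<And>g. g \<in> carrier G \<Longrightarrow> fst x g \<in> Obj V"
    and "\<And>g h. \<lbrakk>g \<in> carrier G; h \<in> H\<rbrakk> \<Longrightarrow> snd x g h \<in> isos V (fst x (g \<otimes> h)) (F (inv h) (fst x g))"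
    and "\<And>g. g \<in> carrier G \<Longrightarrow> snd x g \<one> = iv (\<epsilon> (fst x g))"
    and "\<And>g h k. \<lbrakk>g \<in> carrier G; h \<in> H; k \<in> H\<rbrakk> \<Longrightarrow>
      snd x g (h \<otimes> k) = \<mu> (inv k) (inv h) (fst x g) \<bullet> M (inv k) (snd x g h) \<bullet> snd x (g \<otimes> h) k"
  shows "x \<in> objs"
  using assms by (auto simp: ind_objs_def PiE_def Pi_def split_beta)

lemma obj_arr:
  assumes "x \<in> objs" "g \<in> carrier G" "h \<in> H"
  shows "snd x g h \<in> Arr V" "Dom V (snd x g h) = fst x (g \<otimes> h)" "Cod V (snd x g h) = F (inv h) (fst x g)"
  using V.iso_arr[OF obj_iso[OF assms]] by simp_all

lemma obj_eqI:
  assumes "x \<in> objs" "y \<in> objs" "\<And>g. g \<in> carrier G \<Longrightarrow> fst x g = fst y g"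
    and "\<And>g h. \<lbrakk>g \<in> carrier G; h \<in> H\<rbrakk> \<Longrightarrow> snd x g h = snd y g h"
  shows "x = y"
proof (rule prod_eqI)
  show "fst x = fst y" by (rule extensionalityI[OF obj_ext(1)[OF assms(1)] obj_ext(1)[OF assms(2)] assms(3)])
  show "snd x = snd y"
    by (rule extensionalityI[OF obj_ext(2)[OF assms(1)] obj_ext(2)[OF assms(2)]])
      (rule extensionalityI[OF obj_ext(3)[OF assms(1)] obj_ext(3)[OF assms(2)] assms(4)])
qed

lemma homs_I:
  "\<alpha> \<in> homs I x y \<longleftrightarrow> x \<in> objs \<and> y \<in> objs \<and> fst \<alpha> = x \<and> snd (snd \<alpha>) = y \<and>
    cm \<alpha> \<in> extensional (carrier G) \<and> (\<forall>g\<in>carrier G. cm \<alpha> g \<in> homs V (fst x g) (fst y g)) \<and>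
    (\<forall>g\<in>carrier G. \<forall>h\<in>H. M (inv h) (cm \<alpha> g) \<bullet> snd x g h = snd y g h \<bullet> cm \<alpha> (g \<otimes> h))"
  by (auto simp: homs_def I_simps ind_arrs_def PiE_def Pi_def)

lemma homs_I_D:
  assumes "\<alpha> \<in> homs I x y"
  shows "x \<in> objs" "y \<in> objs" "fst \<alpha> = x" "snd (snd \<alpha>) = y" "cm \<alpha> \<in> extensional (carrier G)"
    and "\<And>g. g \<in> carrier G \<Longrightarrow> cm \<alpha> g \<in> homs V (fst x g) (fst y g)"
    and "\<And>g. g \<in> carrier G \<Longrightarrow> cm \<alpha> g \<in> Arr V"
    and "\<And>g. g \<in> carrier G \<Longrightarrow> Dom V (cm \<alpha> g) = fst x g"
    and "\<And>g. g \<in> carrier G \<Longrightarrow> Cod V (cm \<alpha> g) = fst y g"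
    and "\<And>g h. \<lbrakk>g \<in> carrier G; h \<in> H\<rbrakk> \<Longrightarrow> M (inv h) (cm \<alpha> g) \<bullet> snd x g h = snd y g h \<bullet> cm \<alpha> (g \<otimes> h)"
  using assms by (auto simp: homs_I V.homs_arr)

lemma Arr_I_homs: "\<alpha> \<in> Arr I \<Longrightarrow> \<alpha> \<in> homs I (fst \<alpha>) (snd (snd \<alpha>))"
  by (simp add: homs_def I_simps)

lemma I_homs_Arr: "\<alpha> \<in> homs I x y \<Longrightarrow> \<alpha> \<in> Arr I"
  by (simp add: homs_def)

lemma hom_eqI:
  assumes "\<alpha> \<in> homs I x y" "\<beta> \<in> homs I x y" "\<And>g. g \<in> carrier G \<Longrightarrow> cm \<alpha> g = cm \<beta> g"
  shows "\<alpha> = \<beta>"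
proof -
  have "cm \<alpha> = cm \<beta>"
    by (rule extensionalityI[OF homs_I_D(5)[OF assms(1)] homs_I_D(5)[OF assms(2)] assms(3)])
  thus ?thesis using homs_I_D(3,4)[OF assms(1)] homs_I_D(3,4)[OF assms(2)] by (simp add: prod_eq_iff)
qed

lemma Ide_I: assumes x: "x \<in> objs" shows "Ide I x \<in> homs I x x"
  unfolding homs_I
  using x by (auto simp: I_simps V.homs_arr V.Ide_arr obj_Obj M_Ide V.Ide_left_arr V.Ide_right_arr obj_arr)

lemma Cmp_I:
  assumes a: "\<alpha> \<in> homs I x y" and b: "\<beta> \<in> homs I y z"
  shows "\<beta> \<cdot>\<^bsub>I\<^esub> \<alpha> \<in> homs I x z"
proof -
  note a = homs_I_D[OF a] and b = homs_I_D[OF b]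
  have "M (inv h) (cm \<beta> g \<bullet> cm \<alpha> g) \<bullet> snd x g h = snd z g h \<bullet> cm \<beta> (g \<otimes> h) \<bullet> cm \<alpha> (g \<otimes> h)"
    if g: "g \<in> carrier G" and h: "h \<in> H" for g h
  proof -
    have "M (inv h) (cm \<beta> g \<bullet> cm \<alpha> g) \<bullet> snd x g h = M (inv h) (cm \<beta> g) \<bullet> (M (inv h) (cm \<alpha> g) \<bullet> snd x g h)"
      using g h a(1-9) b(1-9) by (simp add: M_Cmp assoc obj_arr)
    also have "\<dots> = M (inv h) (cm \<beta> g) \<bullet> (snd y g h \<bullet> cm \<alpha> (g \<otimes> h))" by (simp only: a(10)[OF g h])
    also have "\<dots> = (M (inv h) (cm \<beta> g) \<bullet> snd y g h) \<bullet> cm \<alpha> (g \<otimes> h)"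
      using g h a(1-9) b(1-9) by (simp add: assoc obj_arr)
    also have "\<dots> = (snd z g h \<bullet> cm \<beta> (g \<otimes> h)) \<bullet> cm \<alpha> (g \<otimes> h)" by (simp only: b(10)[OF g h])
    also have "\<dots> = snd z g h \<bullet> cm \<beta> (g \<otimes> h) \<bullet> cm \<alpha> (g \<otimes> h)"
      using g h a(1-9) b(1-9) by (simp add: assoc obj_arr)
    finally show ?thesis .
  qed
  thus ?thesis unfolding homs_I using a b by (auto simp: I_simps V.homs_arr)
qed

sublocale I: category I
proof
  show "Dom I \<alpha> \<in> Obj I" "Cod I \<alpha> \<in> Obj I" if "\<alpha> \<in> Arr I" for \<alpha>
    using homs_I_D(1,2)[OF Arr_I_homs[OF that]] by (simp_all add: I_simps)
  show "Ide I x \<in> homs I x x" if "x \<in> Obj I" for x using Ide_I that by (simp add: I_simps)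
  show "\<beta> \<cdot>\<^bsub>I\<^esub> \<alpha> \<in> homs I x z" if "\<alpha> \<in> homs I x y" "\<beta> \<in> homs I y z" for \<alpha> \<beta> x y z
    by (rule Cmp_I[OF that])
  show "(\<gamma> \<cdot>\<^bsub>I\<^esub> \<beta>) \<cdot>\<^bsub>I\<^esub> \<alpha> = \<gamma> \<cdot>\<^bsub>I\<^esub> \<beta> \<cdot>\<^bsub>I\<^esub> \<alpha>"
    if "\<alpha> \<in> homs I w x" "\<beta> \<in> homs I x y" "\<gamma> \<in> homs I y z" for \<alpha> \<beta> \<gamma> w x y z
    using that[THEN homs_I_D(7)] that[THEN homs_I_D(8)] that[THEN homs_I_D(9)]
    by (simp add: I_simps assoc cong: restrict_cong)
  show "Ide I y \<cdot>\<^bsub>I\<^esub> \<alpha> = \<alpha>" if a: "\<alpha> \<in> homs I x y" for \<alpha> x y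
    by (rule hom_eqI[OF Cmp_I[OF a Ide_I[OF homs_I_D(2)[OF a]]] a])
      (use homs_I_D[OF a] in \<open>simp add: I_simps V.Ide_left_arr\<close>)
  show "\<alpha> \<cdot>\<^bsub>I\<^esub> Ide I x = \<alpha>" if a: "\<alpha> \<in> homs I x y" for \<alpha> x y
    by (rule hom_eqI[OF Cmp_I[OF Ide_I[OF homs_I_D(1)[OF a]] a] a])
      (use homs_I_D[OF a] in \<open>simp add: I_simps V.Ide_right_arr\<close>)
qed

lemma Zero_I: "\<lbrakk>x \<in> objs; y \<in> objs\<rbrakk> \<Longrightarrow> Zero I x y \<in> homs I x y"
  unfolding homs_I
  by (auto simp: I_simps V.homs_arr V.Zero_arr obj_Obj M_Zero V.Cmp_Zero_left V.Cmp_Zero_right obj_arr)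

lemma Add_I:
  assumes a: "\<alpha> \<in> homs I x y" and b: "\<beta> \<in> homs I x y" shows "Add I \<alpha> \<beta> \<in> homs I x y"
proof -
  note a = homs_I_D[OF a] and b = homs_I_D[OF b]
  have "M (inv h) (Add V (cm \<alpha> g) (cm \<beta> g)) \<bullet> snd x g h = snd y g h \<bullet> Add V (cm \<alpha> (g \<otimes> h)) (cm \<beta> (g \<otimes> h))"
    if g: "g \<in> carrier G" and h: "h \<in> H" for g h
  proof -
    have gh: "g \<otimes> h \<in> carrier G" and h': "inv h \<in> H" using g h by auto
    have u: "snd x g h \<in> homs V (fst x (g \<otimes> h)) (F (inv h) (fst x g))"
      "snd y g h \<in> homs V (fst y (g \<otimes> h)) (F (inv h) (fst y g))"
      using obj_arr[OF a(1) g h] obj_arr[OF a(2) g h] by (simp_all add: V.homs_arr)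
    have m: "M (inv h) (cm \<alpha> g) \<in> homs V (F (inv h) (fst x g)) (F (inv h) (fst y g))"
      "M (inv h) (cm \<beta> g) \<in> homs V (F (inv h) (fst x g)) (F (inv h) (fst y g))"
      using a b g h by (simp_all add: V.homs_arr)
    show ?thesis
      using M_Add[OF h' a(6)[OF g] b(6)[OF g]] V.Cmp_Add_left[OF u(1) m]
        V.Cmp_Add_right[OF u(2) a(6)[OF gh] b(6)[OF gh]] a(10)[OF g h] b(10)[OF g h] by simp
  qed
  thus ?thesis unfolding homs_I using a b V.Add_closed[OF a(6) b(6)] by (simp add: I_simps)
qed

lemma Scal_I:
  assumes c: "c \<in> carrier K" and a: "\<alpha> \<in> homs I x y" shows "Scal I c \<alpha> \<in> homs I x y"
proof -
  note a = homs_I_D[OF a]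
  have "M (inv h) (Scal V c (cm \<alpha> g)) \<bullet> snd x g h = snd y g h \<bullet> Scal V c (cm \<alpha> (g \<otimes> h))"
    if g: "g \<in> carrier G" and h: "h \<in> H" for g h
  proof -
    have gh: "g \<otimes> h \<in> carrier G" and h': "inv h \<in> H" using g h by auto
    have u: "snd x g h \<in> homs V (fst x (g \<otimes> h)) (F (inv h) (fst x g))"
      "snd y g h \<in> homs V (fst y (g \<otimes> h)) (F (inv h) (fst y g))"
      using obj_arr[OF a(1) g h] obj_arr[OF a(2) g h] by (simp_all add: V.homs_arr)
    have m: "M (inv h) (cm \<alpha> g) \<in> homs V (F (inv h) (fst x g)) (F (inv h) (fst y g))"
      using a g h by (simp add: V.homs_arr)
    show ?thesis
      using M_Scal[OF h' c a(6)[OF g]] V.Cmp_Scal_left[OF u(1) m c]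
        V.Cmp_Scal_right[OF u(2) a(6)[OF gh] c] a(10)[OF g h] by simp
  qed
  thus ?thesis unfolding homs_I using a V.Scal_closed[OF c a(6)] by (simp add: I_simps)
qed

sublocale I: linear_category K I
proof (intro linear_category.intro linear_category_axioms.intro V.field_axioms I.category_axioms)
  show "module K (hom_space I x y)" if "x \<in> Obj I" "y \<in> Obj I" for x y
  proof (rule module_by_coordinates[where I = "carrier G" and N = "\<lambda>g. hom_space V (fst x g) (fst y g)"
        and ev = "\<lambda>g \<alpha>. cm \<alpha> g"])
    have xy: "x \<in> objs" "y \<in> objs" using that by (simp_all add: I_simps)
    show "cring K" by (rule V.is_cring)
    show "module K (hom_space V (fst x g) (fst y g))" if "g \<in> carrier G" for g
      by (rule V.hom_space[OF obj_Obj[OF xy(1) that] obj_Obj[OF xy(2) that]])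
    show "\<alpha> = \<beta>" if "\<alpha> \<in> carrier (hom_space I x y)" "\<beta> \<in> carrier (hom_space I x y)"
      "\<And>g. g \<in> carrier G \<Longrightarrow> cm \<alpha> g = cm \<beta> g" for \<alpha> \<beta>
      using that by (intro hom_eqI) (auto simp: hom_space_def)
    show "\<zero>\<^bsub>hom_space I x y\<^esub> \<in> carrier (hom_space I x y)"
      using Zero_I[OF xy] by (simp add: hom_space_def)
  qed (simp_all add: hom_space_def Add_I Scal_I homs_I_D(6), simp_all add: I_simps)
  show "(\<lambda>\<beta>. \<beta> \<cdot>\<^bsub>I\<^esub> \<alpha>) \<in> linear_maps K (hom_space I y z) (hom_space I x z)"
    if a: "\<alpha> \<in> homs I x y" and z: "z \<in> Obj I" for \<alpha> x y z
  proof -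
    have "(Add I \<beta> \<beta>') \<cdot>\<^bsub>I\<^esub> \<alpha> = Add I (\<beta> \<cdot>\<^bsub>I\<^esub> \<alpha>) (\<beta>' \<cdot>\<^bsub>I\<^esub> \<alpha>)"
      if b: "\<beta> \<in> homs I y z" "\<beta>' \<in> homs I y z" for \<beta> \<beta>'
      by (rule hom_eqI[OF Cmp_I[OF a Add_I[OF b]] Add_I[OF Cmp_I[OF a b(1)] Cmp_I[OF a b(2)]]])
        (simp add: I_simps V.Cmp_Add_left[OF homs_I_D(6)[OF a] homs_I_D(6)[OF b(1)] homs_I_D(6)[OF b(2)]])
    moreover have "(Scal I c \<beta>) \<cdot>\<^bsub>I\<^esub> \<alpha> = Scal I c (\<beta> \<cdot>\<^bsub>I\<^esub> \<alpha>)"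
      if c: "c \<in> carrier K" and b: "\<beta> \<in> homs I y z" for c \<beta>
      by (rule hom_eqI[OF Cmp_I[OF a Scal_I[OF c b]] Scal_I[OF c Cmp_I[OF a b]]])
        (simp add: I_simps V.Cmp_Scal_left[OF homs_I_D(6)[OF a] homs_I_D(6)[OF b] c])
    ultimately show ?thesis using Cmp_I[OF a] by (simp add: linear_maps_def hom_space_def)
  qed
  show "(\<lambda>\<alpha>. \<beta> \<cdot>\<^bsub>I\<^esub> \<alpha>) \<in> linear_maps K (hom_space I x y) (hom_space I x z)"
    if b: "\<beta> \<in> homs I y z" and x: "x \<in> Obj I" for \<beta> x y z
  proof -
    have "\<beta> \<cdot>\<^bsub>I\<^esub> Add I \<alpha> \<alpha>' = Add I (\<beta> \<cdot>\<^bsub>I\<^esub> \<alpha>) (\<beta> \<cdot>\<^bsub>I\<^esub> \<alpha>')"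
      if a: "\<alpha> \<in> homs I x y" "\<alpha>' \<in> homs I x y" for \<alpha> \<alpha>'
      by (rule hom_eqI[OF Cmp_I[OF Add_I[OF a] b] Add_I[OF Cmp_I[OF a(1) b] Cmp_I[OF a(2) b]]])
        (simp add: I_simps V.Cmp_Add_right[OF homs_I_D(6)[OF b] homs_I_D(6)[OF a(1)] homs_I_D(6)[OF a(2)]])
    moreover have "\<beta> \<cdot>\<^bsub>I\<^esub> Scal I c \<alpha> = Scal I c (\<beta> \<cdot>\<^bsub>I\<^esub> \<alpha>)"
      if c: "c \<in> carrier K" and a: "\<alpha> \<in> homs I x y" for c \<alpha>
      by (rule hom_eqI[OF Cmp_I[OF Scal_I[OF c a] b] Scal_I[OF c Cmp_I[OF a b]]])
        (simp add: I_simps V.Cmp_Scal_right[OF homs_I_D(6)[OF b] homs_I_D(6)[OF a] c])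
    ultimately show ?thesis using Cmp_I[OF _ b] by (simp add: linear_maps_def hom_space_def)
  qed
qed

end

section \<open>The strict action on the induced category\<close>

lemma inertia_simps:
  "Obj (inertia G) = carrier G" "Arr (inertia G) = carrier G \<times> carrier G"
  "Dom (inertia G) p = fst p" "Cod (inertia G) p = snd p \<otimes>\<^bsub>G\<^esub> fst p \<otimes>\<^bsub>G\<^esub> inv\<^bsub>G\<^esub> snd p"
  "Ide (inertia G) u = (u, \<one>\<^bsub>G\<^esub>)"
  "q \<cdot>\<^bsub>inertia G\<^esub> p = (fst p, snd q \<otimes>\<^bsub>G\<^esub> snd p)"
  by (simp_all add: inertia_def split_beta)

context group
begin

lemma inertia_category: "category (inertia G)"
proof
  show "Dom (inertia G) a \<in> Obj (inertia G)" "Cod (inertia G) a \<in> Obj (inertia G)"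
    if "a \<in> Arr (inertia G)" for a
    using that by (auto simp: inertia_simps)
  show "Ide (inertia G) x \<in> homs (inertia G) x x" if "x \<in> Obj (inertia G)" for x
    using that by (auto simp: inertia_simps homs_def)
  show "b \<cdot>\<^bsub>inertia G\<^esub> a \<in> homs (inertia G) x z"
    if "a \<in> homs (inertia G) x y" "b \<in> homs (inertia G) y z" for a b x y z
    using that by (auto simp: inertia_simps homs_def inv_mult_group m_assoc)
qed (auto simp: inertia_simps homs_def m_assoc)

lemma inertia_groupoid: "groupoid (inertia G)"
proof (intro groupoid.intro inertia_category groupoid_axioms.intro)
  fix a assume a: "a \<in> Arr (inertia G)"
  then obtain u g where ug: "a = (u, g)" "u \<in> carrier G" "g \<in> carrier G" by (auto simp: inertia_simps)
  have "inv g \<otimes> (g \<otimes> u \<otimes> inv g) \<otimes> inv (inv g) = (inv g \<otimes> g) \<otimes> u \<otimes> (inv g \<otimes> g)"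
    using ug by (simp only: m_assoc inv_inv m_closed inv_closed)
  hence "inverse_arrows (inertia G) a (g \<otimes> u \<otimes> inv g, inv g)"
    using ug by (simp add: inverse_arrows_def homs_def inertia_simps)
  thus "\<exists>b. inverse_arrows (inertia G) a b" ..
qed

end

lemma (in category) Ide_inverse:
  assumes x: "x \<in> Obj C" shows "inverse_arrow C (Ide C x) = Ide C x"
  using Ide_arr[OF x] x by (intro inverse_arrow_eq) (simp add: inverse_arrows_def homs_def Ide_left_arr)

context induction_setting
begin

abbreviation "tr s \<equiv> ind_translate_obj G H s"
abbreviation "Act \<equiv> ind_action G H V \<rho>"
abbreviation "am s \<equiv> amap (act Act s)"
abbreviation "cI \<equiv> conj_map G I Act"
abbreviation "TI s \<equiv> cat_trace I (act Act s)"
abbreviation "\<chi>I \<equiv> cat_character G I Act"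

lemma tr_simps:
  "g \<in> carrier G \<Longrightarrow> fst (tr s x) g = fst x (inv s \<otimes> g)"
  "\<lbrakk>g \<in> carrier G; h \<in> H\<rbrakk> \<Longrightarrow> snd (tr s x) g h = snd x (inv s \<otimes> g) h"
  by (simp_all add: ind_translate_obj_def split_beta)

lemma tr_objs:
  assumes s: "s \<in> carrier G" and x: "x \<in> objs" shows "tr s x \<in> objs"
proof (rule objsI)
  show "fst (tr s x) \<in> extensional (carrier G)" "snd (tr s x) \<in> extensional (carrier G)"
    by (simp_all add: ind_translate_obj_def split_beta)
  show "snd (tr s x) g \<in> extensional H" if "g \<in> carrier G" for g
    using that by (simp add: ind_translate_obj_def split_beta)
qed (use s obj_Obj[OF x] obj_iso[OF x] obj_one[OF x] obj_mult[OF x] in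
    \<open>simp_all add: tr_simps G.m_assoc[symmetric]\<close>)

lemma tr_one: "x \<in> objs \<Longrightarrow> tr \<one> x = x"
  by (rule obj_eqI) (simp_all add: tr_objs tr_simps)

lemma tr_tr: "\<lbrakk>s \<in> carrier G; t \<in> carrier G; x \<in> objs\<rbrakk> \<Longrightarrow> tr s (tr t x) = tr (s \<otimes> t) x"
  by (rule obj_eqI) (simp_all add: tr_objs tr_simps G.inv_mult_group G.m_assoc)

lemma act_simps:
  "omap (act Act s) x = tr s x"
  "fst (am s \<alpha>) = tr s (fst \<alpha>)" "snd (snd (am s \<alpha>)) = tr s (snd (snd \<alpha>))"
  "cm (am s \<alpha>) = (\<lambda>g\<in>carrier G. cm \<alpha> (inv s \<otimes> g))"
  by (simp_all add: ind_action_def split_beta)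

lemma am_homs:
  assumes s: "s \<in> carrier G" and a: "\<alpha> \<in> homs I x y" shows "am s \<alpha> \<in> homs I (tr s x) (tr s y)"
  unfolding homs_I
  using homs_I_D[OF a] s tr_objs by (simp add: act_simps tr_simps G.m_assoc[symmetric])

lemma act_I_functor:
  assumes s: "s \<in> carrier G" shows "cat_functor I I (act Act s)"
proof (intro cat_functor.intro I.category_axioms cat_functor_axioms.intro)
  show "omap (act Act s) x \<in> Obj I" if "x \<in> Obj I" for x
    using that tr_objs[OF s] by (simp add: act_simps I_simps)
  show "am s \<alpha> \<in> homs I (omap (act Act s) x) (omap (act Act s) y)" if "\<alpha> \<in> homs I x y" for \<alpha> x y
    using am_homs[OF s that] by (simp add: act_simps)
  show "am s (Ide I x) = Ide I (omap (act Act s) x)" if "x \<in> Obj I" for x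
    by (rule hom_eqI[OF am_homs[OF s I.Ide_closed[OF that]]])
      (use that s tr_objs in \<open>simp_all add: act_simps I_simps Ide_I[unfolded I_simps] tr_simps\<close>)
  show "am s (\<beta> \<cdot>\<^bsub>I\<^esub> \<alpha>) = am s \<beta> \<cdot>\<^bsub>I\<^esub> am s \<alpha>" if a: "\<alpha> \<in> homs I x y" and b: "\<beta> \<in> homs I y z" for \<alpha> \<beta> x y z
    by (rule hom_eqI[OF am_homs[OF s Cmp_I[OF a b]] Cmp_I[OF am_homs[OF s a] am_homs[OF s b]]])
      (use s in \<open>simp add: act_simps I_simps\<close>)
qed

abbreviation "Tr s \<equiv> nat_trans I I id_functor (act Act s)"

lemma Tr_homs: "\<lbrakk>\<eta> \<in> Tr s; x \<in> objs\<rbrakk> \<Longrightarrow> \<eta> x \<in> homs I x (tr s x)"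
  by (simp add: I.nat_trans_id_iff act_simps I_simps)

lemma Tr_nat:
  assumes "\<eta> \<in> Tr s" "\<alpha> \<in> homs I x y" "g \<in> carrier G"
  shows "cm \<alpha> (inv s \<otimes> g) \<bullet> cm (\<eta> x) g = cm (\<eta> y) g \<bullet> cm \<alpha> g"
proof -
  have "am s \<alpha> \<cdot>\<^bsub>I\<^esub> \<eta> (Dom I \<alpha>) = \<eta> (Cod I \<alpha>) \<cdot>\<^bsub>I\<^esub> \<alpha>"
    using assms I_homs_Arr by (simp add: I.nat_trans_id_iff)
  hence "cm (am s \<alpha> \<cdot>\<^bsub>I\<^esub> \<eta> x) g = cm (\<eta> y \<cdot>\<^bsub>I\<^esub> \<alpha>) g"
    using homs_I_D(3,4)[OF assms(2)] by (simp add: I_simps)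
  thus ?thesis using assms(3) by (simp add: I_simps act_simps)
qed

lemma TrI:
  assumes s: "s \<in> carrier G" and "\<eta> \<in> extensional objs" and h: "\<And>x. x \<in> objs \<Longrightarrow> \<eta> x \<in> homs I x (tr s x)"
    and n: "\<And>\<alpha> x y g. \<lbrakk>\<alpha> \<in> homs I x y; g \<in> carrier G\<rbrakk> \<Longrightarrow>
      cm \<alpha> (inv s \<otimes> g) \<bullet> cm (\<eta> x) g = cm (\<eta> y) g \<bullet> cm \<alpha> g"
  shows "\<eta> \<in> Tr s"
  unfolding I.nat_trans_id_iff
proof (intro conjI ballI)
  fix \<alpha> assume "\<alpha> \<in> Arr I"
  from Arr_I_homs[OF this] obtain x y where a: "\<alpha> \<in> homs I x y" by blast
  note xy = homs_I_D(1,2)[OF a]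
  have "am s \<alpha> \<cdot>\<^bsub>I\<^esub> \<eta> x = \<eta> y \<cdot>\<^bsub>I\<^esub> \<alpha>"
    by (rule hom_eqI[OF Cmp_I[OF h[OF xy(1)] am_homs[OF s a]] Cmp_I[OF a h[OF xy(2)]]])
      (simp add: I_simps act_simps n[OF a])
  thus "am s \<alpha> \<cdot>\<^bsub>I\<^esub> \<eta> (Dom I \<alpha>) = \<eta> (Cod I \<alpha>) \<cdot>\<^bsub>I\<^esub> \<alpha>"
    using homs_I_D(3,4)[OF a] by (simp add: I_simps)
qed (use assms in \<open>simp_all add: I_simps act_simps\<close>)

lemma Tr_eqI:
  assumes "\<eta> \<in> Tr s" "\<theta> \<in> Tr s" "\<And>x g. \<lbrakk>x \<in> objs; g \<in> carrier G\<rbrakk> \<Longrightarrow> cm (\<eta> x) g = cm (\<theta> x) g"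
  shows "\<eta> = \<theta>"
proof (rule extensionalityI)
  show "\<eta> \<in> extensional objs" "\<theta> \<in> extensional objs"
    using assms by (simp_all add: I.nat_trans_id_iff I_simps)
  show "\<eta> x = \<theta> x" if x: "x \<in> objs" for x
    by (rule hom_eqI[OF Tr_homs[OF assms(1) x] Tr_homs[OF assms(2) x] assms(3)[OF x]])
qed

text \<open>As \<open>G\<close> acts strictly, all coherence isomorphisms in the conjugation map are identities.\<close>

lemma conj_I:
  assumes f: "f \<in> carrier G" and g: "g \<in> carrier G" and e: "\<eta> \<in> Tr f" and x: "x \<in> objs"
  shows "cI f g \<eta> x = am g (\<eta> (tr (inv g) x))"
proof -
  let ?z = "tr (inv g) x" and ?y = "tr (g \<otimes> f \<otimes> inv g) x"
  have z: "?z \<in> objs" and y: "?y \<in> objs" using f g x by (simp_all add: tr_objs)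
  have m: "am g (\<eta> ?z) \<in> homs I x ?y"
    using am_homs[OF g Tr_homs[OF e z]] f g x by (simp add: tr_tr tr_one tr_objs G.m_assoc)
  have i: "Ide I x \<in> homs I x x" "Ide I ?y \<in> homs I ?y ?y" using x y Ide_I by blast+
  have "act_mult3 G I Act g f (inv g) x = Ide I ?y \<cdot>\<^bsub>I\<^esub> Ide I ?y"
    using f g x z by (simp add: act_mult3_def ind_action_def tr_tr tr_objs)
  hence 1: "act_mult3 G I Act g f (inv g) x = Ide I ?y" by (simp add: I.Ide_left[OF i(2)])
  have 2: "inverse_arrow I (act_mult Act g (inv g) x) = Ide I x" "inverse_arrow I (act_one Act x) = Ide I x"
    using f g x I.Ide_inverse[of x] by (simp_all add: ind_action_def tr_one I_simps(1))
  have "cI f g \<eta> x =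
      Ide I ?y \<cdot>\<^bsub>I\<^esub> am g (\<eta> ?z) \<cdot>\<^bsub>I\<^esub> Ide I x \<cdot>\<^bsub>I\<^esub> Ide I x"
    using x by (simp add: conj_map_def 1 2 act_simps I_simps(1))
  thus ?thesis using I.Ide_left[OF i(1)] I.Ide_right[OF m] I.Ide_left[OF m] by simp
qed

lemma conj_cm:
  assumes "f \<in> carrier G" "g \<in> carrier G" "\<eta> \<in> Tr f" "x \<in> objs" "a \<in> carrier G"
  shows "cm (cI f g \<eta> x) a = cm (\<eta> (tr (inv g) x)) (inv g \<otimes> a)"
  using assms by (simp add: conj_I act_simps)

lemma conj_Tr:
  assumes f: "f \<in> carrier G" and g: "g \<in> carrier G" and e: "\<eta> \<in> Tr f"
  shows "cI f g \<eta> \<in> Tr (g \<otimes> f \<otimes> inv g)"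
proof (rule TrI)
  show "cI f g \<eta> \<in> extensional objs" by (simp add: conj_map_def I_simps(1))
  show "cI f g \<eta> x \<in> homs I x (tr (g \<otimes> f \<otimes> inv g) x)" if x: "x \<in> objs" for x
    using am_homs[OF g Tr_homs[OF e tr_objs[of "inv g" x]]] f g x
    by (simp add: conj_I[OF f g e x] tr_tr tr_one tr_objs G.m_assoc)
  show "cm \<alpha> (inv (g \<otimes> f \<otimes> inv g) \<otimes> a) \<bullet> cm (cI f g \<eta> x) a
      = cm (cI f g \<eta> y) a \<bullet> cm \<alpha> a"
    if al: "\<alpha> \<in> homs I x y" and a: "a \<in> carrier G" for \<alpha> x y a
  proof -
    note xy = homs_I_D(1,2)[OF al]
    have "cm (am (inv g) \<alpha>) (inv f \<otimes> (inv g \<otimes> a)) \<bullet> cm (\<eta> (tr (inv g) x)) (inv g \<otimes> a)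
        = cm (\<eta> (tr (inv g) y)) (inv g \<otimes> a) \<bullet> cm (am (inv g) \<alpha>) (inv g \<otimes> a)"
      by (rule Tr_nat[OF e am_homs[OF _ al]]) (use g a in simp_all)
    thus ?thesis
      using f g a xy by (simp add: conj_cm e act_simps G.inv_mult_group G.m_assoc[symmetric])
  qed
qed (use f g in simp)

lemma character_I:
  "space \<chi>I s = TI s"
  "rmap \<chi>I p = cI (fst p) (snd p)"
  by (simp_all add: cat_character_def split_beta)

lemma trace_I_simps:
  "carrier (TI s) = Tr s"
  "x \<in> objs \<Longrightarrow> (\<eta> \<oplus>\<^bsub>TI s\<^esub> \<theta>) x = Add I (\<eta> x) (\<theta> x)"
  "x \<in> objs \<Longrightarrow> (c \<odot>\<^bsub>TI s\<^esub> \<eta>) x = Scal I c (\<eta> x)"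
  "x \<in> objs \<Longrightarrow> \<zero>\<^bsub>TI s\<^esub> x = Zero I x (tr s x)"
  by (simp_all add: cat_trace_def I_simps(1) act_simps)

lemma trace_I_module: "s \<in> carrier G \<Longrightarrow> module K (TI s)"
  by (rule I.cat_trace_module[OF act_I_functor])

lemma trace_I_closed:
  assumes s: "s \<in> carrier G"
  shows "\<lbrakk>\<eta> \<in> Tr s; \<theta> \<in> Tr s\<rbrakk> \<Longrightarrow> \<eta> \<oplus>\<^bsub>TI s\<^esub> \<theta> \<in> Tr s"
    and "\<lbrakk>c \<in> carrier K; \<eta> \<in> Tr s\<rbrakk> \<Longrightarrow> c \<odot>\<^bsub>TI s\<^esub> \<eta> \<in> Tr s"
    and "\<zero>\<^bsub>TI s\<^esub> \<in> Tr s"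
proof -
  interpret T: module K "TI s" by (rule trace_I_module[OF s])
  show "\<lbrakk>\<eta> \<in> Tr s; \<theta> \<in> Tr s\<rbrakk> \<Longrightarrow> \<eta> \<oplus>\<^bsub>TI s\<^esub> \<theta> \<in> Tr s"
    using T.M.a_closed[of \<eta> \<theta>] by (simp only: trace_I_simps)
  show "\<lbrakk>c \<in> carrier K; \<eta> \<in> Tr s\<rbrakk> \<Longrightarrow> c \<odot>\<^bsub>TI s\<^esub> \<eta> \<in> Tr s"
    using T.smult_closed[of c \<eta>] by (simp only: trace_I_simps)
  show "\<zero>\<^bsub>TI s\<^esub> \<in> Tr s"
    using T.M.zero_closed by (simp only: trace_I_simps)
qed

text \<open>On components, conjugation by \<open>g\<close> only shifts indices by \<open>g\<^sup>-\<^sup>1\<close>, so functoriality reduces to the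
  group law.\<close>

lemma character_I_representation: "representation K (inertia G) \<chi>I"
proof (intro representation.intro V.field_axioms G.inertia_groupoid representation_axioms.intro)
  show "module K (space \<chi>I s)" if "s \<in> Obj (inertia G)" for s
    unfolding character_I using that by (intro trace_I_module) (simp add: inertia_simps)
next
  fix p s t assume "p \<in> homs (inertia G) s t"
  then obtain g where p: "p = (s, g)" "s \<in> carrier G" "g \<in> carrier G" "t = g \<otimes> s \<otimes> inv g"
    by (cases p) (auto simp: homs_def inertia_simps)
  have t: "t \<in> carrier G" using p by simp
  have "cI s g (\<eta> \<oplus>\<^bsub>TI s\<^esub> \<theta>) =
      cI s g \<eta> \<oplus>\<^bsub>TI t\<^esub> cI s g \<theta>"
    if e: "\<eta> \<in> Tr s" "\<theta> \<in> Tr s" for \<eta> \<theta>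
    by (rule Tr_eqI[of _ t])
      (use p(2,3) t conj_Tr[OF p(2,3), folded p(4)] e in
        \<open>simp_all add: trace_I_closed conj_cm trace_I_simps tr_objs I_simps\<close>)
  moreover have "cI s g (c \<odot>\<^bsub>TI s\<^esub> \<eta>) =
      c \<odot>\<^bsub>TI t\<^esub> cI s g \<eta>"
    if c: "c \<in> carrier K" and e: "\<eta> \<in> Tr s" for c \<eta>
    by (rule Tr_eqI[of _ t])
      (use p(2,3) t conj_Tr[OF p(2,3), folded p(4)] e c in
        \<open>simp_all add: trace_I_closed conj_cm trace_I_simps tr_objs I_simps\<close>)
  ultimately show "rmap \<chi>I p \<in>
      linear_maps K (space \<chi>I s) (space \<chi>I t)"
    using conj_Tr[OF p(2,3), folded p(4)]
    by (simp add: linear_maps_def character_I trace_I_simps p(1))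
next
  fix s \<eta> assume s: "s \<in> Obj (inertia G)" and e: "\<eta> \<in> carrier (space \<chi>I s)"
  have s': "s \<in> carrier G" and e': "\<eta> \<in> Tr s" using s e by (simp_all add: inertia_simps character_I trace_I_simps)
  have "cI s \<one> \<eta> = \<eta>"
    by (rule Tr_eqI[of _ s]) (use conj_Tr[OF s' G.one_closed e'] s' e' in \<open>simp_all add: conj_cm tr_one\<close>)
  thus "rmap \<chi>I (Ide (inertia G) s) \<eta> = \<eta>" by (simp add: character_I inertia_simps)
next
  fix p s t q u \<eta> assume *: "p \<in> homs (inertia G) s t" "q \<in> homs (inertia G) t u"
    "\<eta> \<in> carrier (space \<chi>I s)"
  obtain g where p: "p = (s, g)" "s \<in> carrier G" "g \<in> carrier G" "t = g \<otimes> s \<otimes> inv g"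
    using *(1) by (cases p) (auto simp: homs_def inertia_simps)
  obtain h where q: "q = (t, h)" "t \<in> carrier G" "h \<in> carrier G" "u = h \<otimes> t \<otimes> inv h"
    using *(2) by (cases q) (auto simp: homs_def inertia_simps)
  have e: "\<eta> \<in> Tr s" using *(3) by (simp add: character_I trace_I_simps)
  have u: "u = (h \<otimes> g) \<otimes> s \<otimes> inv (h \<otimes> g)" using p q by (simp add: G.m_assoc G.inv_mult_group)
  note c = conj_Tr[OF p(2,3) e, folded p(4)]
  have "cI s (h \<otimes> g) \<eta> = cI t h (cI s g \<eta>)"
  proof (rule Tr_eqI[of _ u])
    show "cI s (h \<otimes> g) \<eta> \<in> Tr u" unfolding u by (rule conj_Tr[OF p(2) _ e]) (use p q in simp)
    show "cI t h (cI s g \<eta>) \<in> Tr u"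
      unfolding q(4) by (rule conj_Tr[OF q(2,3) c])
  qed (use p(2,3) q(2,3) e c in \<open>simp add: conj_cm tr_tr tr_objs G.inv_mult_group G.m_assoc\<close>)
  thus "rmap \<chi>I (q \<cdot>\<^bsub>inertia G\<^esub> p) \<eta> =
      rmap \<chi>I q (rmap \<chi>I p \<eta>)"
    by (simp add: character_I inertia_simps p(1) q(1))
qed

end

section \<open>Arrows concentrated on one coset\<close>

context induction_setting
begin

lemma coset_iff:
  assumes "r \<in> carrier G" "g \<in> carrier G" "h \<in> H"
  shows "inv r \<otimes> (g \<otimes> h) \<in> H \<longleftrightarrow> inv r \<otimes> g \<in> H"
proof
  assume "inv r \<otimes> (g \<otimes> h) \<in> H"
  hence "inv r \<otimes> (g \<otimes> h) \<otimes> inv h \<in> H" using assms by blast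
  thus "inv r \<otimes> g \<in> H" using assms by (simp add: G.m_assoc)
next
  assume "inv r \<otimes> g \<in> H"
  hence "inv r \<otimes> g \<otimes> h \<in> H" using assms by blast
  thus "inv r \<otimes> (g \<otimes> h) \<in> H" using assms by (simp add: G.m_assoc)
qed

lemma coset_factor: "\<lbrakk>r \<in> carrier G; g \<in> carrier G\<rbrakk> \<Longrightarrow> r \<otimes> (inv r \<otimes> g) = g"
  by (simp add: G.m_assoc[symmetric])

text \<open>Compatibility with the invertible arrows \<open>u\<close> expresses the component at \<open>rh\<close> through the one
  at \<open>r\<close>.\<close>

lemma agree_on_coset:
  assumes a: "\<alpha> \<in> homs I x y" and b: "\<beta> \<in> homs I x y" and r: "r \<in> carrier G" and h: "h \<in> H"
    and eq: "cm \<alpha> r = cm \<beta> r"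
  shows "cm \<alpha> (r \<otimes> h) = cm \<beta> (r \<otimes> h)"
proof -
  have rh: "r \<otimes> h \<in> carrier G" using r h by simp
  note a' = homs_I_D[OF a] and b' = homs_I_D[OF b]
  show ?thesis
    by (rule V.iso_cancel_left[OF obj_iso[OF a'(2) r h]])
      (use a'(7-9)[OF rh] b'(7-9)[OF rh] a'(10)[OF r h] b'(10)[OF r h] eq in simp_all)
qed

lemma zero_on_coset:
  assumes a: "\<alpha> \<in> homs I x y" and r: "r \<in> carrier G" and h: "h \<in> H"
    and z: "cm \<alpha> r = Zero V (fst x r) (fst y r)"
  shows "cm \<alpha> (r \<otimes> h) = Zero V (fst x (r \<otimes> h)) (fst y (r \<otimes> h))"
  using agree_on_coset[OF a Zero_I[OF homs_I_D(1,2)[OF a]] r h] r h z by (simp add: I_simps)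

lemma coset_hom_eqI:
  assumes a: "\<alpha> \<in> homs I x y" and b: "\<beta> \<in> homs I x y" and r: "r \<in> carrier G"
    and eq: "cm \<alpha> r = cm \<beta> r"
    and za: "\<And>g. \<lbrakk>g \<in> carrier G; inv r \<otimes> g \<notin> H\<rbrakk> \<Longrightarrow> cm \<alpha> g = Zero V (fst x g) (fst y g)"
    and zb: "\<And>g. \<lbrakk>g \<in> carrier G; inv r \<otimes> g \<notin> H\<rbrakk> \<Longrightarrow> cm \<beta> g = Zero V (fst x g) (fst y g)"
  shows "\<alpha> = \<beta>"
proof (rule hom_eqI[OF a b])
  fix g assume g: "g \<in> carrier G"
  show "cm \<alpha> g = cm \<beta> g"
  proof (cases "inv r \<otimes> g \<in> H")
    case True
    show ?thesis using agree_on_coset[OF a b r True eq] coset_factor[OF r g] by simp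
  next
    case False
    thus ?thesis using za[OF g] zb[OF g] by simp
  qed
qed

text \<open>The arrow with component \<open>a\<close> at \<open>r\<close> that vanishes off the coset \<open>rH\<close>. The components on \<open>rH\<close> are
  the ones forced by compatibility with the isomorphisms \<open>u\<close>.\<close>

definition coset_arrow ::
  "('g, 'o, 'a) ind_obj \<Rightarrow> ('g, 'o, 'a) ind_obj \<Rightarrow> 'g \<Rightarrow> 'a \<Rightarrow> ('g, 'o, 'a) ind_arr" where
  "coset_arrow x y r a = (x, \<lambda>g\<in>carrier G.
     if inv r \<otimes> g \<in> H
     then iv (snd y r (inv r \<otimes> g)) \<bullet> M (inv (inv r \<otimes> g)) a \<bullet> snd x r (inv r \<otimes> g)
     else Zero V (fst x g) (fst y g), y)"

context
  fixes x y r a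
  assumes x: "x \<in> objs" and y: "y \<in> objs" and r: "r \<in> carrier G" and a: "a \<in> homs V (fst x r) (fst y r)"
begin

lemma coset_arrow_off:
  "\<lbrakk>g \<in> carrier G; inv r \<otimes> g \<notin> H\<rbrakk> \<Longrightarrow> cm (coset_arrow x y r a) g = Zero V (fst x g) (fst y g)"
  by (simp add: coset_arrow_def)

lemma coset_arrow_on:
  assumes h: "h \<in> H"
  shows "cm (coset_arrow x y r a) (r \<otimes> h) \<in> homs V (fst x (r \<otimes> h)) (fst y (r \<otimes> h))"
    and "snd y r h \<bullet> cm (coset_arrow x y r a) (r \<otimes> h) = M (inv h) a \<bullet> snd x r h"
proof -
  have "cm (coset_arrow x y r a) (r \<otimes> h) = iv (snd y r h) \<bullet> (M (inv h) a \<bullet> snd x r h)"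
    using r h by (simp add: coset_arrow_def G.m_assoc[symmetric])
  moreover have "M (inv h) a \<bullet> snd x r h \<in> Arr V" "Dom V (M (inv h) a \<bullet> snd x r h) = fst x (r \<otimes> h)"
    "Cod V (M (inv h) a \<bullet> snd x r h) = F (inv h) (fst y r)"
    using a r h obj_arr[OF x r h] by (simp_all add: V.homs_arr)
  ultimately show "cm (coset_arrow x y r a) (r \<otimes> h) \<in> homs V (fst x (r \<otimes> h)) (fst y (r \<otimes> h))"
    and "snd y r h \<bullet> cm (coset_arrow x y r a) (r \<otimes> h) = M (inv h) a \<bullet> snd x r h"
    using V.iso_arr[OF obj_iso[OF y r h]] V.iso_Cmp_inverse(2)[OF obj_iso[OF y r h]]
    by (simp_all add: V.homs_arr)
qed

text \<open>Compatibility at \<open>g = rh\<close> and \<open>k\<close> is obtained from the defining property of the components at \<open>rh\<close>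
  and \<open>rhk\<close>, which the cocycle identities for \<open>u\<^bsub>r,hk\<^esub>\<close> of source and target relate. Off \<open>rH\<close> both sides
  are zero.\<close>

lemma coset_arrow_homs: "coset_arrow x y r a \<in> homs I x y"
  unfolding homs_I
proof (intro conjI ballI x y)
  let ?c = "cm (coset_arrow x y r a)"
  show "fst (coset_arrow x y r a) = x" "snd (snd (coset_arrow x y r a)) = y" "?c \<in> extensional (carrier G)"
    by (simp_all add: coset_arrow_def)
  show h: "?c g \<in> homs V (fst x g) (fst y g)" if g: "g \<in> carrier G" for g
  proof (cases "inv r \<otimes> g \<in> H")
    case True
    show ?thesis using coset_arrow_on(1)[OF True] coset_factor[OF r g] by simp
  next
    case False
    thus ?thesis using coset_arrow_off[OF g] V.Zero_arr obj_Obj[OF x g] obj_Obj[OF y g] by (simp add: V.homs_arr)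
  qed
  fix g k assume g: "g \<in> carrier G" and k: "k \<in> H"
  have gk: "g \<otimes> k \<in> carrier G" and k': "inv k \<in> H" using g k by auto
  show "M (inv k) (?c g) \<bullet> snd x g k = snd y g k \<bullet> ?c (g \<otimes> k)"
  proof (cases "inv r \<otimes> g \<in> H")
    case True
    define h where "h = inv r \<otimes> g"
    have h: "h \<in> H" "r \<otimes> h = g" "r \<otimes> (h \<otimes> k) = g \<otimes> k" "h \<otimes> k \<in> H" "inv h \<in> H"
      using True coset_factor[OF r g] r g k unfolding h_def by (auto simp: G.m_assoc[symmetric])
    note xr = obj_Obj[OF x r] and yr = obj_Obj[OF y r]
    note ux = obj_arr[OF x r h(1)] obj_arr[OF x g k] and uy = obj_arr[OF y r h(1)] obj_arr[OF y g k]
    have aa: "a \<in> Arr V" "Dom V a = fst x r" "Cod V a = fst y r" using a by (auto simp: V.homs_arr)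
    have c: "?c g \<in> Arr V" "Dom V (?c g) = fst x g" "Cod V (?c g) = fst y g"
      using coset_arrow_on(1)[OF h(1)] h(2) by (auto simp: V.homs_arr)
    have c': "?c (g \<otimes> k) \<in> Arr V" "Dom V (?c (g \<otimes> k)) = fst x (g \<otimes> k)" "Cod V (?c (g \<otimes> k)) = fst y (g \<otimes> k)"
      using coset_arrow_on(1)[OF h(4)] h(3) by (auto simp: V.homs_arr)
    have cg: "snd y r h \<bullet> ?c g = M (inv h) a \<bullet> snd x r h"
      using coset_arrow_on(2)[OF h(1)] h(2) by simp
    let ?m = "\<lambda>z. \<mu> (inv k) (inv h) (fst z r)"
    note mult = obj_mult[OF x r h(1) k, unfolded h(2)] obj_mult[OF y r h(1) k, unfolded h(2)]
    \<comment> \<open>By the cocycle identity, \<open>u\<^bsub>r,hk\<^esub>\<close> of the target is \<open>u\<^bsub>g,k\<^esub>\<close> followed by this isomorphism.\<close>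
    have iso: "?m y \<bullet> M (inv k) (snd y r h) \<in> isos V (F (inv k) (fst y g)) (F (inv k \<otimes> inv h) (fst y r))"
    proof (rule V.isosI[where b = "M (inv k) (iv (snd y r h)) \<bullet> iv (?m y)"])
      note im = V.iso_arr[OF \<mu>_iso[OF k' h(5) yr]] and iu = V.iso_arr[OF M_iso[OF k' obj_iso[OF y r h(1), unfolded h(2)]]]
      note cm = V.iso_Cmp_inverse[OF \<mu>_iso[OF k' h(5) yr]]
        V.iso_Cmp_inverse[OF M_iso[OF k' obj_iso[OF y r h(1), unfolded h(2)]],
          unfolded M_inverse[OF k' obj_iso[OF y r h(1)]]]
      show "(M (inv k) (iv (snd y r h)) \<bullet> iv (?m y)) \<bullet> (?m y \<bullet> M (inv k) (snd y r h)) = Ide V (F (inv k) (fst y g))"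
        using im(1-6) iu(1-6) iu(7) cm(1) by (simp add: assoc M_inverse[OF k' obj_iso[OF y r h(1)]])
      show "(?m y \<bullet> M (inv k) (snd y r h)) \<bullet> (M (inv k) (iv (snd y r h)) \<bullet> iv (?m y)) = Ide V (F (inv k \<otimes> inv h) (fst y r))"
        using im(1-6) iu(1-6) im(8) cm(4) by (simp add: assoc M_inverse[OF k' obj_iso[OF y r h(1)]])
    qed (use k' h yr uy V.iso_arr[OF \<mu>_iso[OF k' h(5) yr]] V.iso_arr[OF obj_iso[OF y r h(1)]] in \<open>simp_all\<close>)
    show ?thesis
    proof (rule V.iso_cancel_left[OF iso])
      have "(?m y \<bullet> M (inv k) (snd y r h)) \<bullet> (M (inv k) (?c g) \<bullet> snd x g k)
          = ?m y \<bullet> M (inv k) (snd y r h \<bullet> ?c g) \<bullet> snd x g k"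
        using k' h yr ux uy c by (simp add: assoc M_Cmp)
      also have "\<dots> = (?m y \<bullet> M (inv k) (M (inv h) a)) \<bullet> M (inv k) (snd x r h) \<bullet> snd x g k"
        unfolding cg using k' h yr xr ux aa by (simp add: assoc M_Cmp)
      also have "\<dots> = (M (inv k \<otimes> inv h) a \<bullet> ?m x) \<bullet> M (inv k) (snd x r h) \<bullet> snd x g k"
        using \<mu>_nat[OF k' h(5) aa(1)] aa by simp
      also have "\<dots> = M (inv (h \<otimes> k)) a \<bullet> snd x r (h \<otimes> k)"
        unfolding mult inv_mult_H[OF h(1) k] using k' h yr xr ux aa by (simp add: assoc)
      also have "\<dots> = snd y r (h \<otimes> k) \<bullet> ?c (g \<otimes> k)"
        using coset_arrow_on(2)[OF h(4)] h(3) by simp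
      also have "\<dots> = (?m y \<bullet> M (inv k) (snd y r h)) \<bullet> (snd y g k \<bullet> ?c (g \<otimes> k))"
        unfolding mult using k' h yr uy c' by (simp add: assoc)
      finally show "(?m y \<bullet> M (inv k) (snd y r h)) \<bullet> (M (inv k) (?c g) \<bullet> snd x g k)
          = (?m y \<bullet> M (inv k) (snd y r h)) \<bullet> (snd y g k \<bullet> ?c (g \<otimes> k))" .
    qed (use k' c c' ux uy in \<open>simp_all\<close>)
  next
    case False
    hence "inv r \<otimes> (g \<otimes> k) \<notin> H" using coset_iff[OF r g k] by simp
    thus ?thesis
      using False k k' g obj_Obj[OF x g] obj_Obj[OF y g] obj_Obj[OF x gk] obj_Obj[OF y gk]
        obj_arr[OF x g k] obj_arr[OF y g k]
      by (simp add: coset_arrow_off gk M_Zero V.Cmp_Zero_left V.Cmp_Zero_right)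
  qed
qed

lemma coset_arrow_base: "cm (coset_arrow x y r a) r = a"
proof -
  let ?c = "cm (coset_arrow x y r a) r"
  note xr = obj_Obj[OF x r] and yr = obj_Obj[OF y r]
  have aa: "a \<in> Arr V" "Dom V a = fst x r" "Cod V a = fst y r" using a by (auto simp: V.homs_arr)
  have c: "?c \<in> Arr V" "Dom V ?c = fst x r" "Cod V ?c = fst y r"
    using coset_arrow_on(1)[of \<one>] r by (auto simp: V.homs_arr)
  have "iv (\<epsilon> (fst y r)) \<bullet> ?c = M \<one> a \<bullet> iv (\<epsilon> (fst x r))"
    using coset_arrow_on(2)[of \<one>] r by (simp add: obj_one[OF x r] obj_one[OF y r])
  hence "\<epsilon> (fst y r) \<bullet> iv (\<epsilon> (fst y r)) \<bullet> ?c = \<epsilon> (fst y r) \<bullet> M \<one> a \<bullet> iv (\<epsilon> (fst x r))" by simp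
  also have "\<dots> = (\<epsilon> (fst y r) \<bullet> M \<one> a) \<bullet> iv (\<epsilon> (fst x r))"
    using aa xr yr V.iso_arr[OF \<epsilon>_iso[OF xr]] by (simp add: assoc)
  also have "\<dots> = a \<bullet> \<epsilon> (fst x r) \<bullet> iv (\<epsilon> (fst x r))"
    using \<epsilon>_nat[OF aa(1), symmetric] aa xr yr V.iso_arr[OF \<epsilon>_iso[OF xr]] by (simp add: assoc)
  also have "\<dots> = a" using V.iso_arr[OF \<epsilon>_iso[OF xr]] aa by (simp add: V.Ide_right_arr)
  finally show ?thesis using V.iso_Cmp_inverse(2)[OF \<epsilon>_iso[OF yr] c(1,3)] by simp
qed

end

end

section \<open>The components of a transformation on the induced category\<close>

context induction_setting
begin

definition rep :: "'g \<Rightarrow> 'g" where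
  "rep g = (SOME k. k \<in> carrier G \<and> inv k \<otimes> g \<in> H)"

lemma rep:
  assumes "g \<in> carrier G" shows "rep g \<in> carrier G" "inv rep g \<otimes> g \<in> H"
  using someI_ex[of "\<lambda>k. k \<in> carrier G \<and> inv k \<otimes> g \<in> H"] assms unfolding rep_def
  by (metis G.l_inv H_closed(3))+

lemma rep_mult: "\<lbrakk>g \<in> carrier G; h \<in> H\<rbrakk> \<Longrightarrow> rep (g \<otimes> h) = rep g"
  unfolding rep_def using coset_iff by (metis (no_types, lifting))

text \<open>The element \<open>h\<close> with \<open>g = r'h\<close>, where \<open>r'\<close> represents the coset of \<open>g\<close>. The coset of \<open>r\<close> is
  represented by \<open>r\<close> itself, so that the offset of \<open>r\<close> is trivial.\<close>

definition offset :: "'g \<Rightarrow> 'g \<Rightarrow> 'g" where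
  "offset r g = (if inv r \<otimes> g \<in> H then inv r \<otimes> g else inv (rep g) \<otimes> g)"

lemma offset:
  assumes "r \<in> carrier G" "g \<in> carrier G"
  shows "offset r g \<in> H" "h \<in> H \<Longrightarrow> offset r (g \<otimes> h) = offset r g \<otimes> h"
  using assms rep[OF assms(2)] coset_iff[OF assms] rep_mult[OF assms(2)]
  by (simp_all add: offset_def G.m_assoc[symmetric])

lemma offset_base: "r \<in> carrier G \<Longrightarrow> offset r r = \<one>"
  by (simp add: offset_def)

text \<open>An object of the induced category with value \<open>\<rho>(1)x\<close> at \<open>r\<close>: at \<open>r'h\<close>, for a representative \<open>r'\<close>, the
  value is \<open>\<rho>(h\<^sup>-\<^sup>1)x\<close>, and \<open>u\<close> consists of inverse coherence isomorphisms. It lets a transformation on the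
  induced category be evaluated at an arbitrary object \<open>x\<close>.\<close>

definition free :: "'g \<Rightarrow> 'o \<Rightarrow> ('g, 'o, 'a) ind_obj" where
  "free r x = (\<lambda>g\<in>carrier G. F (inv (offset r g)) x,
     \<lambda>g\<in>carrier G. \<lambda>h\<in>H. iv (\<mu> (inv h) (inv (offset r g)) x))"

lemma free_simps:
  "g \<in> carrier G \<Longrightarrow> fst (free r x) g = F (inv (offset r g)) x"
  "\<lbrakk>g \<in> carrier G; h \<in> H\<rbrakk> \<Longrightarrow> snd (free r x) g h = iv (\<mu> (inv h) (inv (offset r g)) x)"
  by (simp_all add: free_def)

lemma free_objs:
  assumes r: "r \<in> carrier G" and x: "x \<in> Obj V" shows "free r x \<in> objs"
proof (rule objsI)
  show "fst (free r x) \<in> extensional (carrier G)" "snd (free r x) \<in> extensional (carrier G)"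
    by (simp_all add: free_def)
  show "snd (free r x) g \<in> extensional H" if "g \<in> carrier G" for g using that by (simp add: free_def)
  show "fst (free r x) g \<in> Obj V" if "g \<in> carrier G" for g
    using that x offset[OF r that] by (simp add: free_simps)
  show "snd (free r x) g h \<in> isos V (fst (free r x) (g \<otimes> h)) (F (inv h) (fst (free r x) g))"
    if g: "g \<in> carrier G" and h: "h \<in> H" for g h
    using V.iso_inverse[OF \<mu>_iso[of "inv h" "inv (offset r g)" x]] g h x offset[OF r g]
    by (simp add: free_simps inv_mult_H)
  show "snd (free r x) g \<one> = iv (\<epsilon> (fst (free r x) g))" if g: "g \<in> carrier G" for g
    using g x offset[OF r g] \<mu>_one_left[of "inv (offset r g)" x] by (simp add: free_simps)
  show "snd (free r x) g (h \<otimes> k) = \<mu> (inv k) (inv h) (fst (free r x) g) \<bullet>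
      M (inv k) (snd (free r x) g h) \<bullet> snd (free r x) (g \<otimes> h) k"
    if g: "g \<in> carrier G" and h: "h \<in> H" and k: "k \<in> H" for g h k
  proof -
    define c where "c = inv (offset r g)"
    have c: "c \<in> H" and h': "inv h \<in> H" and k': "inv k \<in> H" and hc: "inv h \<otimes> c \<in> H" and kh: "inv k \<otimes> inv h \<in> H"
      using offset[OF r g] h k by (auto simp: c_def)
    let ?p = "\<mu> (inv k \<otimes> inv h) c x" and ?q = "\<mu> (inv k) (inv h) (F c x)"
    let ?s = "\<mu> (inv k) (inv h \<otimes> c) x" and ?w = "\<mu> (inv h) c x"
    note ip = \<mu>_iso[OF kh c x] and iss = \<mu>_iso[OF k' hc x] and iw = \<mu>_iso[OF h' c x]
    note p = V.iso_arr[OF ip] and s = V.iso_arr[OF iss] and w = V.iso_arr[OF iw]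
    have Fc: "F c x \<in> Obj V" using c x by simp
    have q: "?q \<in> Arr V" "Dom V ?q = F (inv k) (F (inv h) (F c x))" "Cod V ?q = F (inv k \<otimes> inv h) (F c x)"
      using h' k' Fc by simp_all
    have asc: "inv k \<otimes> inv h \<otimes> c = inv k \<otimes> (inv h \<otimes> c)" using h k c by (simp add: G.m_assoc)
    \<comment> \<open>The cocycle identity is associativity of \<open>\<phi>\<close> at \<open>k\<^sup>-\<^sup>1, h\<^sup>-\<^sup>1, c\<close>, read for the inverses.\<close>
    have "?p \<bullet> (?q \<bullet> M (inv k) (iv ?w) \<bullet> iv ?s) = (?p \<bullet> ?q) \<bullet> M (inv k) (iv ?w) \<bullet> iv ?s"
      using p q s w k' by (simp add: assoc)
    also have "\<dots> = (?s \<bullet> M (inv k) ?w) \<bullet> M (inv k) (iv ?w) \<bullet> iv ?s"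
      by (simp only: \<mu>_assoc[OF k' h' c x])
    also have "\<dots> = ?s \<bullet> (M (inv k) ?w \<bullet> M (inv k) (iv ?w)) \<bullet> iv ?s"
      using s w k' by (simp add: assoc)
    also have "M (inv k) ?w \<bullet> M (inv k) (iv ?w) = Ide V (F (inv k) (F (inv h \<otimes> c) x))"
      using w k' hc x by (simp add: M_Cmp[symmetric] M_Ide)
    also have "?s \<bullet> Ide V (F (inv k) (F (inv h \<otimes> c) x)) \<bullet> iv ?s = Ide V (F (inv k \<otimes> inv h \<otimes> c) x)"
      using s asc by (simp add: V.Ide_left_arr)
    finally have eq: "?p \<bullet> iv ?p = ?p \<bullet> (?q \<bullet> M (inv k) (iv ?w) \<bullet> iv ?s)" using p(8) by simp
    have "iv ?p = ?q \<bullet> M (inv k) (iv ?w) \<bullet> iv ?s"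
      by (rule V.iso_cancel_left[OF ip p(4,6) _ _ eq]) (use q s(4-6) w(4-6) k' in simp_all)
    thus ?thesis
      using g h k offset[OF r g] inv_mult_H[OF h k] inv_mult_H[OF offset(1)[OF r g] h]
      by (simp add: free_simps c_def)
  qed
qed

lemma free_base:
  assumes "r \<in> carrier G" shows "fst (free r x) r = F \<one> x"
  using assms by (simp add: free_simps offset_base)

lemma translate_at:
  assumes r: "r \<in> carrier G" and t: "t \<in> H" and s: "s = r \<otimes> t \<otimes> inv r"
  shows "s \<in> carrier G" "inv s \<otimes> r = r \<otimes> inv t"
  using r t unfolding s by (simp_all add: G.inv_mult_group G.m_assoc)

text \<open>The component at \<open>r\<close> of \<open>\<eta> : id \<Rightarrow> \<sigma>(s)\<close> as a transformation \<open>id \<Rightarrow> \<rho>(t)\<close>, where \<open>s = rtr\<^sup>-\<^sup>1\<close>. It is read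
  off at the object \<open>free r x\<close>, with \<open>\<rho>(1)x\<close> identified with \<open>x\<close> at both ends.\<close>

definition component :: "'g \<Rightarrow> 'g \<Rightarrow> (('g, 'o, 'a) ind_obj \<Rightarrow> ('g, 'o, 'a) ind_arr) \<Rightarrow> 'o \<Rightarrow> 'a" where
  "component r t \<eta> = (\<lambda>x\<in>Obj V.
     M t (\<epsilon> x) \<bullet> snd (free r x) r (inv t) \<bullet> cm (\<eta> (free r x)) r \<bullet> iv (\<epsilon> x))"

abbreviation "NT t \<equiv> nat_trans V V id_functor (act \<rho> t)"

lemma NT_arr:
  assumes "\<xi> \<in> NT t" "x \<in> Obj V"
  shows "\<xi> x \<in> Arr V" "Dom V (\<xi> x) = x" "Cod V (\<xi> x) = F t x"
  using assms by (simp_all add: V.nat_trans_id_iff V.homs_arr)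

lemma NT_nat: "\<lbrakk>\<xi> \<in> NT t; a \<in> Arr V\<rbrakk> \<Longrightarrow> M t a \<bullet> \<xi> (Dom V a) = \<xi> (Cod V a) \<bullet> a"
  by (simp add: V.nat_trans_id_iff)

lemma NT_ext: "\<xi> \<in> NT t \<Longrightarrow> \<xi> \<in> extensional (Obj V)"
  by (simp add: V.nat_trans_id_iff)

context
  fixes r t s \<eta>
  assumes r: "r \<in> carrier G" and t: "t \<in> H" and s: "s = r \<otimes> t \<otimes> inv r" and \<eta>: "\<eta> \<in> Tr s"
begin

lemma Tr_at:
  assumes y: "y \<in> objs"
  shows "cm (\<eta> y) r \<in> Arr V" "Dom V (cm (\<eta> y) r) = fst y r" "Cod V (cm (\<eta> y) r) = fst y (r \<otimes> inv t)"
  using homs_I_D(7-9)[OF Tr_homs[OF \<eta> y] r] translate_at(2)[OF r t s] r by (simp_all add: tr_simps)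

lemma unit_at:
  assumes y: "y \<in> objs"
  shows "snd y r (inv t) \<in> isos V (fst y (r \<otimes> inv t)) (F t (fst y r))"
  using obj_iso[OF y r, of "inv t"] t by simp

lemma component_arr:
  assumes x: "x \<in> Obj V"
  shows "component r t \<eta> x \<in> Arr V" "Dom V (component r t \<eta> x) = x" "Cod V (component r t \<eta> x) = F t x"
  using x t Tr_at[OF free_objs[OF r x]] V.iso_arr[OF unit_at[OF free_objs[OF r x]]] V.iso_arr[OF \<epsilon>_iso[OF x]]
    free_base[OF r] by (simp_all add: component_def)

lemma component_\<epsilon>:
  assumes x: "x \<in> Obj V"
  shows "component r t \<eta> x \<bullet> \<epsilon> x = M t (\<epsilon> x) \<bullet> snd (free r x) r (inv t) \<bullet> cm (\<eta> (free r x)) r"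
proof -
  note arrs = Tr_at[OF free_objs[OF r x]] V.iso_arr(1-6)[OF unit_at[OF free_objs[OF r x]]]
    V.iso_arr(1-6)[OF \<epsilon>_iso[OF x]] free_base[OF r, of x]
  have "component r t \<eta> x \<bullet> \<epsilon> x =
      M t (\<epsilon> x) \<bullet> snd (free r x) r (inv t) \<bullet> cm (\<eta> (free r x)) r \<bullet> (iv (\<epsilon> x) \<bullet> \<epsilon> x)"
    using x t arrs by (simp add: component_def assoc)
  also have "\<dots> = M t (\<epsilon> x) \<bullet> snd (free r x) r (inv t) \<bullet> cm (\<eta> (free r x)) r"
    using arrs V.iso_arr(7)[OF \<epsilon>_iso[OF x]] by (simp add: V.Ide_right_arr)
  finally show ?thesis .
qed

text \<open>Naturality of \<open>\<eta>\<close> along the arrow from \<open>free r (f r)\<close> to \<open>y = (f, u)\<close> that is concentrated on \<open>rH\<close>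
  and has component \<open>\<phi>\<^sub>1\<close> at \<open>r\<close>. So the component at \<open>r\<close> depends only on \<open>f(r)\<close>, up to \<open>u\<close>.\<close>

lemma component_eq:
  assumes y: "y \<in> objs"
  shows "snd y r (inv t) \<bullet> cm (\<eta> y) r = component r t \<eta> (fst y r)"
proof (rule V.iso_cancel_right[OF \<epsilon>_iso])
  let ?x = "fst y r"
  show x: "?x \<in> Obj V" by (rule obj_Obj[OF y r])
  let ?z = "free r ?x"
  let ?b = "coset_arrow ?z y r (\<epsilon> ?x)"
  have z: "?z \<in> objs" by (rule free_objs[OF r x])
  have e: "\<epsilon> ?x \<in> homs V (fst ?z r) (fst y r)" using x by (simp add: free_base[OF r] V.homs_arr)
  have b: "?b \<in> homs I ?z y" by (rule coset_arrow_homs[OF z y r e])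
  have br: "cm ?b r = \<epsilon> ?x" by (rule coset_arrow_base[OF z y r e])
  have rt: "r \<otimes> inv t \<in> carrier G" using r t by simp
  note arrs = Tr_at[OF y] Tr_at[OF z] V.iso_arr(1-3)[OF unit_at[OF y]] V.iso_arr(1-3)[OF unit_at[OF z]]
    homs_I_D(7-9)[OF b rt] free_base[OF r, of ?x]
  have "(snd y r (inv t) \<bullet> cm (\<eta> y) r) \<bullet> \<epsilon> ?x = snd y r (inv t) \<bullet> (cm (\<eta> y) r \<bullet> cm ?b r)"
    using arrs x by (simp add: assoc br)
  also have "\<dots> = snd y r (inv t) \<bullet> (cm ?b (r \<otimes> inv t) \<bullet> cm (\<eta> ?z) r)"
    using Tr_nat[OF \<eta> b r] translate_at(2)[OF r t s] by simp
  also have "\<dots> = (snd y r (inv t) \<bullet> cm ?b (r \<otimes> inv t)) \<bullet> cm (\<eta> ?z) r"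
    using arrs by (simp add: assoc)
  also have "\<dots> = (M t (\<epsilon> ?x) \<bullet> snd ?z r (inv t)) \<bullet> cm (\<eta> ?z) r"
    using homs_I_D(10)[OF b r, of "inv t"] t br by simp
  also have "\<dots> = component r t \<eta> ?x \<bullet> \<epsilon> ?x"
    using component_\<epsilon>[OF x] arrs x t by (simp add: assoc)
  finally show "(snd y r (inv t) \<bullet> cm (\<eta> y) r) \<bullet> \<epsilon> ?x = component r t \<eta> ?x \<bullet> \<epsilon> ?x" .
qed (use Tr_at[OF y] V.iso_arr(1-3)[OF unit_at[OF y]] component_arr[OF obj_Obj[OF y r]] in simp_all)

text \<open>Naturality along \<open>m : x \<rightarrow> y\<close> is that of \<open>\<eta>\<close> along the arrow \<open>free r x \<rightarrow> free r y\<close> concentrated on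
  \<open>rH\<close> with component \<open>\<rho>(1)m\<close> at \<open>r\<close>.\<close>

lemma component_NT: "component r t \<eta> \<in> NT t"
  unfolding V.nat_trans_id_iff
proof (intro conjI ballI)
  show "component r t \<eta> \<in> extensional (Obj V)" by (simp add: component_def)
  show "component r t \<eta> x \<in> homs V x (F t x)" if "x \<in> Obj V" for x
    using component_arr[OF that] by (simp add: V.homs_arr)
  fix m assume m: "m \<in> Arr V"
  define x where "x = Dom V m" define y where "y = Cod V m"
  have x: "x \<in> Obj V" and y: "y \<in> Obj V" using m by (simp_all add: x_def y_def)
  let ?zx = "free r x" and ?zy = "free r y"
  let ?b = "coset_arrow ?zx ?zy r (M \<one> m)"
  have z: "?zx \<in> objs" "?zy \<in> objs" using free_objs[OF r] x y by auto
  have mm: "M \<one> m \<in> homs V (fst ?zx r) (fst ?zy r)"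
    using m by (simp add: free_base[OF r] V.homs_arr x_def y_def)
  have b: "?b \<in> homs I ?zx ?zy" by (rule coset_arrow_homs[OF z r mm])
  have br: "cm ?b r = M \<one> m" by (rule coset_arrow_base[OF z r mm])
  have rt: "r \<otimes> inv t \<in> carrier G" using r t by simp
  have m': "Dom V m = x" "Cod V m = y" by (simp_all add: x_def y_def)
  note arrs = Tr_at[OF z(1)] Tr_at[OF z(2)] V.iso_arr(1-3)[OF unit_at[OF z(1)]] V.iso_arr(1-3)[OF unit_at[OF z(2)]]
    homs_I_D(7-9)[OF b rt] free_base[OF r, of x] free_base[OF r, of y] component_arr[OF x] component_arr[OF y]
    m m'
  have "(component r t \<eta> y \<bullet> m) \<bullet> \<epsilon> x = component r t \<eta> y \<bullet> (\<epsilon> y \<bullet> M \<one> m)"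
    using \<epsilon>_nat[OF m] arrs x by (simp add: assoc)
  also have "\<dots> = (component r t \<eta> y \<bullet> \<epsilon> y) \<bullet> M \<one> m" using arrs y by (simp add: assoc)
  also have "\<dots> = M t (\<epsilon> y) \<bullet> snd ?zy r (inv t) \<bullet> (cm (\<eta> ?zy) r \<bullet> cm ?b r)"
    unfolding component_\<epsilon>[OF y] br using arrs y t by (simp add: assoc)
  also have "\<dots> = M t (\<epsilon> y) \<bullet> snd ?zy r (inv t) \<bullet> (cm ?b (r \<otimes> inv t) \<bullet> cm (\<eta> ?zx) r)"
    using Tr_nat[OF \<eta> b r] translate_at(2)[OF r t s] by simp
  also have "\<dots> = M t (\<epsilon> y) \<bullet> (snd ?zy r (inv t) \<bullet> cm ?b (r \<otimes> inv t)) \<bullet> cm (\<eta> ?zx) r"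
    using arrs by (simp add: assoc)
  also have "\<dots> = M t (\<epsilon> y) \<bullet> (M t (M \<one> m) \<bullet> snd ?zx r (inv t)) \<bullet> cm (\<eta> ?zx) r"
    using homs_I_D(10)[OF b r, of "inv t"] t br by simp
  also have "\<dots> = M t (\<epsilon> y \<bullet> M \<one> m) \<bullet> snd ?zx r (inv t) \<bullet> cm (\<eta> ?zx) r"
    using arrs y t by (simp add: assoc M_Cmp)
  also have "\<dots> = M t m \<bullet> M t (\<epsilon> x) \<bullet> snd ?zx r (inv t) \<bullet> cm (\<eta> ?zx) r"
    using \<epsilon>_nat[OF m, symmetric] arrs x t by (simp add: assoc M_Cmp)
  also have "\<dots> = (M t m \<bullet> component r t \<eta> x) \<bullet> \<epsilon> x"
    unfolding component_\<epsilon>[OF x, symmetric] using arrs x t by (simp add: assoc)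
  finally have eq: "(M t m \<bullet> component r t \<eta> x) \<bullet> \<epsilon> x = (component r t \<eta> y \<bullet> m) \<bullet> \<epsilon> x" ..
  have "M t m \<bullet> component r t \<eta> x = component r t \<eta> y \<bullet> m"
    by (rule V.iso_cancel_right[OF \<epsilon>_iso[OF x] _ _ _ _ eq]) (use arrs t in simp_all)
  thus "M t m \<bullet> component r t \<eta> (Dom V m) = component r t \<eta> (Cod V m) \<bullet> m" by (simp add: m')
qed

end

text \<open>Naturality along the endomorphism of \<open>x\<close> that is the identity on \<open>rH\<close> and zero elsewhere: the
  coset of \<open>s\<^sup>-\<^sup>1r\<close> differs from \<open>rH\<close>, so the component at \<open>r\<close> equals its composite with zero.\<close>

lemma Tr_zero_off:
  assumes \<eta>: "\<eta> \<in> Tr s" and s: "s \<in> carrier G" and r: "r \<in> carrier G" and n: "inv r \<otimes> s \<otimes> r \<notin> H" and x: "x \<in> objs"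
  shows "cm (\<eta> x) r = Zero V (fst x r) (fst x (inv s \<otimes> r))"
proof -
  let ?i = "Ide V (fst x r)"
  let ?b = "coset_arrow x x r ?i"
  have i: "?i \<in> homs V (fst x r) (fst x r)" by (rule V.Ide_closed[OF obj_Obj[OF x r]])
  have b: "?b \<in> homs I x x" by (rule coset_arrow_homs[OF x x r i])
  have sr: "inv s \<otimes> r \<in> carrier G" using s r by simp
  have "inv r \<otimes> (inv s \<otimes> r) \<notin> H"
  proof
    assume "inv r \<otimes> (inv s \<otimes> r) \<in> H"
    hence "inv (inv r \<otimes> (inv s \<otimes> r)) \<in> H" by blast
    thus False using n s r by (simp add: G.inv_mult_group G.m_assoc)
  qed
  hence "cm ?b (inv s \<otimes> r) = Zero V (fst x (inv s \<otimes> r)) (fst x (inv s \<otimes> r))"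
    by (intro coset_arrow_off[OF x x r i sr])
  moreover have c: "cm (\<eta> x) r \<in> Arr V" "Dom V (cm (\<eta> x) r) = fst x r" "Cod V (cm (\<eta> x) r) = fst x (inv s \<otimes> r)"
    using homs_I_D(7-9)[OF Tr_homs[OF \<eta> x] r] r by (simp_all add: tr_simps)
  ultimately show ?thesis
    using Tr_nat[OF \<eta> b r] coset_arrow_base[OF x x r i] obj_Obj[OF x sr]
    by (simp add: V.Ide_right_arr V.Cmp_Zero_left)
qed

definition transversal :: "'g set" where
  "transversal = rep ` carrier G"

lemma transversal:
  shows "transversal \<subseteq> carrier G"
    and "g \<in> carrier G \<Longrightarrow> \<exists>r\<in>transversal. inv r \<otimes> g \<in> H"
    and "\<lbrakk>r \<in> transversal; r' \<in> transversal; inv r \<otimes> r' \<in> H\<rbrakk> \<Longrightarrow> r = r'"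
proof -
  show "transversal \<subseteq> carrier G" "g \<in> carrier G \<Longrightarrow> \<exists>r\<in>transversal. inv r \<otimes> g \<in> H"
    using rep by (auto simp: transversal_def)
  assume r: "r \<in> transversal" "r' \<in> transversal" and h: "inv r \<otimes> r' \<in> H"
  obtain g g' where g: "g \<in> carrier G" "r = rep g" "g' \<in> carrier G" "r' = rep g'"
    using r by (auto simp: transversal_def)
  note rg = rep[OF g(1), folded g(2)] rep[OF g(3), folded g(4)]
  have "rep r = rep (r \<otimes> (inv r \<otimes> g))" using rep_mult[OF rg(1,2)] by simp
  hence 1: "rep r = r" using coset_factor[OF rg(1) g(1)] g(2) by simp
  have "rep r' = rep (r' \<otimes> (inv r' \<otimes> g'))" using rep_mult[OF rg(3,4)] by simp
  hence 2: "rep r' = r'" using coset_factor[OF rg(3) g(3)] g(4) by simp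
  have "rep r' = rep r" using rep_mult[OF rg(1) h] coset_factor[OF rg(1,3)] by simp
  thus "r = r'" using 1 2 by simp
qed

lemma conj_back:
  assumes r: "r \<in> carrier G" and s: "s \<in> carrier G"
  shows "s = r \<otimes> (inv r \<otimes> s \<otimes> r) \<otimes> inv r"
proof -
  have "r \<otimes> (inv r \<otimes> s \<otimes> r) \<otimes> inv r = (r \<otimes> inv r) \<otimes> s \<otimes> (r \<otimes> inv r)"
    using r s by (simp only: G.m_assoc G.m_closed G.inv_closed)
  thus ?thesis using r s by simp
qed

text \<open>A component at a representative vanishes by \<open>Tr_zero_off\<close> if \<open>s\<close> moves the coset and by
  \<open>component_eq\<close> if \<open>s\<close> fixes it; the other components on the coset follow.\<close>

lemma Tr_zeroI:
  assumes \<eta>: "\<eta> \<in> Tr s" and s: "s \<in> carrier G"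
    and z: "\<And>r x. \<lbrakk>r \<in> transversal; inv r \<otimes> s \<otimes> r \<in> H; x \<in> Obj V\<rbrakk> \<Longrightarrow>
      component r (inv r \<otimes> s \<otimes> r) \<eta> x = Zero V x (F (inv r \<otimes> s \<otimes> r) x)"
  shows "\<eta> = \<zero>\<^bsub>TI s\<^esub>"
proof (rule Tr_eqI[OF \<eta> trace_I_closed(3)[OF s]])
  fix x g assume x: "x \<in> objs" and g: "g \<in> carrier G"
  have base: "cm (\<eta> x) r = Zero V (fst x r) (fst (tr s x) r)" if rt: "r \<in> transversal" for r
  proof (cases "inv r \<otimes> s \<otimes> r \<in> H")
    case True
    have r: "r \<in> carrier G" using rt transversal(1) by blast
    let ?t = "inv r \<otimes> s \<otimes> r"
    have st: "s = r \<otimes> ?t \<otimes> inv r" using r s by (rule conj_back)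
    have xr: "fst x r \<in> Obj V" and rr: "r \<otimes> inv ?t \<in> carrier G" using obj_Obj[OF x r] r True by auto
    have u: "snd x r (inv ?t) \<in> isos V (fst x (r \<otimes> inv ?t)) (F ?t (fst x r))"
      by (rule unit_at[OF r True st \<eta> x])
    have sr: "inv s \<otimes> r = r \<otimes> inv ?t" by (rule translate_at(2)[OF r True st])
    have e: "snd x r (inv ?t) \<bullet> cm (\<eta> x) r = snd x r (inv ?t) \<bullet> Zero V (fst x r) (fst x (r \<otimes> inv ?t))"
      using component_eq[OF r True st \<eta> x] z[OF rt True xr] V.iso_arr(1-3)[OF u] xr
      by (simp add: V.Cmp_Zero_right)
    have "cm (\<eta> x) r = Zero V (fst x r) (fst x (r \<otimes> inv ?t))"
      by (rule V.iso_cancel_left[OF u _ _ _ _ e])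
        (use Tr_at[OF r True st \<eta> x] V.Zero_arr[OF xr obj_Obj[OF x rr]] in simp_all)
    thus ?thesis using r by (simp add: tr_simps sr)
  next
    case False
    have r: "r \<in> carrier G" using rt transversal(1) by blast
    show ?thesis using Tr_zero_off[OF \<eta> s r False x] r by (simp add: tr_simps)
  qed
  obtain r where r: "r \<in> transversal" "inv r \<otimes> g \<in> H" using transversal(2)[OF g] by blast
  have rG: "r \<in> carrier G" using r transversal(1) by blast
  have "cm (\<eta> x) (r \<otimes> (inv r \<otimes> g)) = Zero V (fst x (r \<otimes> (inv r \<otimes> g))) (fst (tr s x) (r \<otimes> (inv r \<otimes> g)))"
    by (rule zero_on_coset[OF Tr_homs[OF \<eta> x] rG r(2) base[OF r(1)]])
  thus "cm (\<eta> x) g = cm (\<zero>\<^bsub>TI s\<^esub> x) g"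
    using coset_factor[OF rG g] x g by (simp add: trace_I_simps I_simps)
qed

end

section \<open>Extension by zero\<close>

context category
begin

text \<open>Vertical pasting of two commuting squares.\<close>

lemma square_comp:
  assumes "p \<in> Arr C" "q \<in> Arr C" "p' \<in> Arr C" "q' \<in> Arr C" "a \<in> Arr C" "b \<in> Arr C" "c \<in> Arr C"
    and "Dom C q = Cod C p" "Dom C q' = Cod C p'" "Dom C p' = Cod C a" "Dom C b = Cod C p"
      "Dom C q' = Cod C b" "Dom C c = Cod C q"
    and pp: "b \<cdot> p = p' \<cdot> a" and qq: "c \<cdot> q = q' \<cdot> b"
  shows "c \<cdot> (q \<cdot> p) = (q' \<cdot> p') \<cdot> a"
proof -
  have "c \<cdot> (q \<cdot> p) = (c \<cdot> q) \<cdot> p" using assms(1-13) by (intro Cmp_assoc_arr[symmetric]) simp_all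
  also have "\<dots> = q' \<cdot> (b \<cdot> p)" unfolding qq using assms(1-13) by (intro Cmp_assoc_arr) simp_all
  also have "\<dots> = (q' \<cdot> p') \<cdot> a" unfolding pp using assms(1-13) by (intro Cmp_assoc_arr[symmetric]) simp_all
  finally show ?thesis .
qed

lemma square_inverse:
  assumes p: "p \<in> isos C x y" and q: "q \<in> isos C x' y'" and a: "a \<in> Arr C" "Dom C a = x" "Cod C a = x'"
    and b: "b \<in> Arr C" "Dom C b = y" "Cod C b = y'" and eq: "b \<cdot> p = q \<cdot> a"
  shows "a \<cdot> inverse_arrow C p = inverse_arrow C q \<cdot> b"
proof (rule iso_cancel_left[OF q])
  note i = iso_arr[OF p] and k = iso_arr[OF q]
  have "q \<cdot> (a \<cdot> inverse_arrow C p) = (q \<cdot> a) \<cdot> inverse_arrow C p"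
    using i(1-6) k(1-6) a by (intro Cmp_assoc_arr[symmetric]) simp_all
  also have "\<dots> = b \<cdot> (p \<cdot> inverse_arrow C p)"
    unfolding eq[symmetric] using i(1-6) b by (intro Cmp_assoc_arr) simp_all
  also have "\<dots> = q \<cdot> (inverse_arrow C q \<cdot> b)"
    using i(8) iso_Cmp_inverse(2)[OF q b(1,3)] Ide_right_arr[OF b(1,2)] by simp
  finally show "q \<cdot> (a \<cdot> inverse_arrow C p) = q \<cdot> (inverse_arrow C q \<cdot> b)" .
qed (use iso_arr(4-6)[OF p] iso_arr(4-6)[OF q] a b in \<open>simp_all add: Cmp_arr\<close>)

end

context induction_setting
begin

abbreviation "TV t \<equiv> cat_trace V (act \<rho> t)"
abbreviation "cV \<equiv> conj_map (G\<lparr>carrier := H\<rparr>) V \<rho>"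

text \<open>The isomorphism \<open>\<phi>\<^bsub>h,t,k\<^esub>\<close> at \<open>k = h\<^sup>-\<^sup>1\<close>.\<close>

definition coherence :: "'g \<Rightarrow> 'g \<Rightarrow> 'o \<Rightarrow> 'a" where
  "coherence h t x = \<mu> (h \<otimes> t) (inv h) x \<bullet> \<mu> h t (F (inv h) x)"

lemma cV_app:
  assumes "h \<in> H" "x \<in> Obj V"
  shows "cV t h \<xi> x = coherence h t x \<bullet> M h (\<xi> (F (inv h) x)) \<bullet> iv (\<mu> h (inv h) x) \<bullet> iv (\<epsilon> x)"
  using assms by (simp add: conj_map_def act_mult3_def coherence_def inv_H)

context
  fixes t h
  assumes t: "t \<in> H" and h: "h \<in> H"
begin

lemma coherence_arr:
  assumes x: "x \<in> Obj V"
  shows "coherence h t x \<in> Arr V" "Dom V (coherence h t x) = F h (F t (F (inv h) x))"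
    "Cod V (coherence h t x) = F (h \<otimes> t \<otimes> inv h) x"
  using t h x by (simp_all add: coherence_def)

lemma inverse_arrs:
  assumes x: "x \<in> Obj V"
  shows "iv (\<mu> h (inv h) x) \<in> Arr V" "Dom V (iv (\<mu> h (inv h) x)) = F \<one> x"
    "Cod V (iv (\<mu> h (inv h) x)) = F h (F (inv h) x)"
    "iv (\<epsilon> x) \<in> Arr V" "Dom V (iv (\<epsilon> x)) = x" "Cod V (iv (\<epsilon> x)) = F \<one> x"
  using V.iso_arr(4-6)[OF \<mu>_iso[OF h _ x, of "inv h"]] V.iso_arr(4-6)[OF \<epsilon>_iso[OF x]] h by simp_all

lemma cV_arr:
  assumes \<xi>: "\<xi> \<in> NT t" and x: "x \<in> Obj V"
  shows "cV t h \<xi> x \<in> Arr V" "Dom V (cV t h \<xi> x) = x" "Cod V (cV t h \<xi> x) = F (h \<otimes> t \<otimes> inv h) x"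
  using NT_arr[OF \<xi>, of "F (inv h) x"] h x coherence_arr[OF x] inverse_arrs[OF x]
  by (simp_all add: cV_app)

lemma coherence_nat:
  assumes m: "m \<in> Arr V" "Dom V m = x" "Cod V m = y"
  shows "M (h \<otimes> t \<otimes> inv h) m \<bullet> coherence h t x = coherence h t y \<bullet> M h (M t (M (inv h) m))"
proof -
  have xy: "x \<in> Obj V" "y \<in> Obj V" and h': "inv h \<in> H" "h \<otimes> t \<in> H" using m h t by auto
  show ?thesis unfolding coherence_def
  proof (rule V.square_comp[where b = "M (h \<otimes> t) (M (inv h) m)"])
    show "M (h \<otimes> t) (M (inv h) m) \<bullet> \<mu> h t (F (inv h) x) = \<mu> h t (F (inv h) y) \<bullet> M h (M t (M (inv h) m))"
      using \<mu>_nat[OF h t, of "M (inv h) m"] m h' by simp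
    show "M (h \<otimes> t \<otimes> inv h) m \<bullet> \<mu> (h \<otimes> t) (inv h) x = \<mu> (h \<otimes> t) (inv h) y \<bullet> M (h \<otimes> t) (M (inv h) m)"
      using \<mu>_nat[OF h'(2,1) m(1)] m by simp
  qed (use xy h' t h m in simp_all)
qed

text \<open>The naturality squares of the four factors of the conjugation map are pasted.\<close>

lemma cV_NT:
  assumes \<xi>: "\<xi> \<in> NT t" shows "cV t h \<xi> \<in> NT (h \<otimes> t \<otimes> inv h)"
  unfolding V.nat_trans_id_iff
proof (intro conjI ballI)
  show "cV t h \<xi> \<in> extensional (Obj V)" by (simp add: conj_map_def)
  show "cV t h \<xi> x \<in> homs V x (F (h \<otimes> t \<otimes> inv h) x)" if "x \<in> Obj V" for x
    using cV_arr[OF \<xi> that] by (simp add: V.homs_arr)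
  fix m assume m: "m \<in> Arr V"
  define x where "x = Dom V m" define y where "y = Cod V m"
  have m': "Dom V m = x" "Cod V m = y" by (simp_all add: x_def y_def)
  have xy: "x \<in> Obj V" "y \<in> Obj V" and h': "inv h \<in> H" "h \<otimes> inv h = \<one>" using m m' h by auto
  have Fx: "F (inv h) x \<in> Obj V" "F (inv h) y \<in> Obj V" using h' xy by auto
  note arrs = coherence_arr[OF xy(1)] coherence_arr[OF xy(2)] inverse_arrs[OF xy(1)] inverse_arrs[OF xy(2)]
    NT_arr[OF \<xi> Fx(1)] NT_arr[OF \<xi> Fx(2)] m m'
  have 1: "M \<one> m \<bullet> iv (\<epsilon> x) = iv (\<epsilon> y) \<bullet> m"
    by (rule V.square_inverse[OF \<epsilon>_iso[OF xy(1)] \<epsilon>_iso[OF xy(2)]]) (use m m' \<epsilon>_nat[OF m] in simp_all)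
  have 2: "M h (M (inv h) m) \<bullet> iv (\<mu> h (inv h) x) = iv (\<mu> h (inv h) y) \<bullet> M \<one> m"
    by (rule V.square_inverse[OF \<mu>_iso[OF h h'(1) xy(1), unfolded h'(2)] \<mu>_iso[OF h h'(1) xy(2), unfolded h'(2)]])
      (use m m' h h' \<mu>_nat[OF h h'(1) m] in simp_all)
  have 3: "M h (M t (M (inv h) m)) \<bullet> M h (\<xi> (F (inv h) x)) = M h (\<xi> (F (inv h) y)) \<bullet> M h (M (inv h) m)"
    using NT_nat[OF \<xi>, of "M (inv h) m"] arrs h h' t by (simp add: M_Cmp[symmetric])
  have "M (h \<otimes> t \<otimes> inv h) m \<bullet> (coherence h t x \<bullet> M h (\<xi> (F (inv h) x)) \<bullet> iv (\<mu> h (inv h) x) \<bullet> iv (\<epsilon> x))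
      = (coherence h t y \<bullet> M h (\<xi> (F (inv h) y)) \<bullet> iv (\<mu> h (inv h) y) \<bullet> iv (\<epsilon> y)) \<bullet> m"
  proof (rule V.square_comp[where b = "M h (M t (M (inv h) m))"])
    show "M h (M t (M (inv h) m)) \<bullet> (M h (\<xi> (F (inv h) x)) \<bullet> iv (\<mu> h (inv h) x) \<bullet> iv (\<epsilon> x))
        = (M h (\<xi> (F (inv h) y)) \<bullet> iv (\<mu> h (inv h) y) \<bullet> iv (\<epsilon> y)) \<bullet> m"
    proof (rule V.square_comp[where b = "M h (M (inv h) m)"])
      show "M h (M (inv h) m) \<bullet> (iv (\<mu> h (inv h) x) \<bullet> iv (\<epsilon> x)) = (iv (\<mu> h (inv h) y) \<bullet> iv (\<epsilon> y)) \<bullet> m"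
        by (rule V.square_comp[where b = "M \<one> m"]) (use arrs h h' in \<open>simp_all add: 1 2\<close>)
    qed (use arrs h h' t 3 in simp_all)
  qed (use arrs h h' t coherence_nat[OF m m'] in simp_all)
  thus "M (h \<otimes> t \<otimes> inv h) m \<bullet> cV t h \<xi> (Dom V m) = cV t h \<xi> (Cod V m) \<bullet> m"
    using h xy by (simp add: cV_app m')
qed

end

text \<open>Extension by zero from the coset \<open>H\<close>. The component at \<open>1\<close> is \<open>\<xi>\<close> at \<open>f(1)\<close>, carried from \<open>\<rho>(t)f(1)\<close> to
  \<open>f(t\<^sup>-\<^sup>1)\<close> by the inverse of \<open>u\<close>; this is the value for which \<open>component\<close> at \<open>r = 1\<close> returns \<open>\<xi>\<close>.\<close>

definition extend :: "'g \<Rightarrow> ('o \<Rightarrow> 'a) \<Rightarrow> ('g, 'o, 'a) ind_obj \<Rightarrow> ('g, 'o, 'a) ind_arr" where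
  "extend t \<xi> = (\<lambda>y\<in>objs. coset_arrow y (tr t y) \<one> (iv (snd y \<one> (inv t)) \<bullet> \<xi> (fst y \<one>)))"

context
  fixes t
  assumes t: "t \<in> H"
begin

lemma unit_one:
  assumes y: "y \<in> objs"
  shows "snd y \<one> (inv t) \<in> isos V (fst y (inv t)) (F t (fst y \<one>))"
  using obj_iso[OF y G.one_closed, of "inv t"] t by simp

lemma seed:
  assumes \<xi>: "\<xi> \<in> NT t" and y: "y \<in> objs"
  shows "iv (snd y \<one> (inv t)) \<bullet> \<xi> (fst y \<one>) \<in> homs V (fst y \<one>) (fst (tr t y) \<one>)"
  using V.iso_arr[OF unit_one[OF y]] NT_arr[OF \<xi> obj_Obj[OF y G.one_closed]] t
  by (simp add: V.homs_arr tr_simps)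

lemma extend_homs: "\<lbrakk>\<xi> \<in> NT t; y \<in> objs\<rbrakk> \<Longrightarrow> extend t \<xi> y \<in> homs I y (tr t y)"
  unfolding extend_def using t by (simp add: coset_arrow_homs[OF _ tr_objs _ seed])

lemma extend_one:
  "\<lbrakk>\<xi> \<in> NT t; y \<in> objs\<rbrakk> \<Longrightarrow> cm (extend t \<xi> y) \<one> = iv (snd y \<one> (inv t)) \<bullet> \<xi> (fst y \<one>)"
  unfolding extend_def using t by (simp add: coset_arrow_base[OF _ tr_objs _ seed])

lemma extend_off:
  assumes "\<xi> \<in> NT t" "y \<in> objs" "g \<in> carrier G" "g \<notin> H"
  shows "cm (extend t \<xi> y) g = Zero V (fst y g) (fst (tr t y) g)"
  unfolding extend_def using t assms by (simp add: coset_arrow_off[OF _ tr_objs _ seed])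

text \<open>Both paths around a naturality square are arrows that vanish off \<open>H\<close>, so it suffices to compare
  them at \<open>1\<close>, where the square for \<open>\<xi>\<close> is pasted with the compatibility of the arrow with \<open>u\<close>.\<close>

lemma extend_Tr:
  assumes \<xi>: "\<xi> \<in> NT t" shows "extend t \<xi> \<in> Tr t"
proof (rule TrI)
  show "t \<in> carrier G" using t by simp
  show "extend t \<xi> \<in> extensional objs" by (simp add: extend_def)
  show "extend t \<xi> y \<in> homs I y (tr t y)" if "y \<in> objs" for y by (rule extend_homs[OF \<xi> that])
  fix \<alpha> x y g assume a: "\<alpha> \<in> homs I x y" and g: "g \<in> carrier G"
  note xy = homs_I_D(1,2)[OF a]
  have tG: "t \<in> carrier G" using t by simp
  note ex = extend_homs[OF \<xi> xy(1)] and ey = extend_homs[OF \<xi> xy(2)] and am = am_homs[OF tG a]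
  have "am t \<alpha> \<cdot>\<^bsub>I\<^esub> extend t \<xi> x = extend t \<xi> y \<cdot>\<^bsub>I\<^esub> \<alpha>"
  proof (rule coset_hom_eqI[OF Cmp_I[OF ex am] Cmp_I[OF a ey] G.one_closed])
    let ?f = "fst x \<one>" and ?f' = "fst y \<one>"
    have o: "?f \<in> Obj V" "?f' \<in> Obj V" using obj_Obj xy by auto
    have it: "inv t \<in> carrier G" "inv t \<in> H" using t by auto
    note ux = V.iso_arr[OF unit_one[OF xy(1)]] and uy = V.iso_arr[OF unit_one[OF xy(2)]]
    note arrs = homs_I_D(7-9)[OF a G.one_closed] homs_I_D(7-9)[OF a it(1)] NT_arr[OF \<xi> o(1)] NT_arr[OF \<xi> o(2)]
    have "cm \<alpha> (inv t) \<bullet> iv (snd x \<one> (inv t)) = iv (snd y \<one> (inv t)) \<bullet> M t (cm \<alpha> \<one>)"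
      by (rule V.square_inverse[OF unit_one[OF xy(1)] unit_one[OF xy(2)]])
        (use arrs t it homs_I_D(10)[OF a G.one_closed it(2)] in simp_all)
    moreover have "M t (cm \<alpha> \<one>) \<bullet> \<xi> ?f = \<xi> ?f' \<bullet> cm \<alpha> \<one>"
      using NT_nat[OF \<xi> arrs(1)] arrs by simp
    ultimately have "cm \<alpha> (inv t) \<bullet> (iv (snd x \<one> (inv t)) \<bullet> \<xi> ?f) = (iv (snd y \<one> (inv t)) \<bullet> \<xi> ?f') \<bullet> cm \<alpha> \<one>"
      by (intro V.square_comp[where b = "M t (cm \<alpha> \<one>)"]) (use arrs ux(4-6) uy(4-6) t in simp_all)
    thus "cm (am t \<alpha> \<cdot>\<^bsub>I\<^esub> extend t \<xi> x) \<one> = cm (extend t \<xi> y \<cdot>\<^bsub>I\<^esub> \<alpha>) \<one>"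
      using it by (simp add: I_simps act_simps extend_one[OF \<xi>] xy)
  next
    fix k assume k: "k \<in> carrier G" "inv \<one> \<otimes> k \<notin> H"
    hence kH: "k \<notin> H" by simp
    have o: "fst x k \<in> Obj V" "fst (tr t y) k \<in> Obj V"
      using obj_Obj[OF xy(1) k(1)] obj_Obj[OF tr_objs[OF tG xy(2)] k(1)] by auto
    show "cm (am t \<alpha> \<cdot>\<^bsub>I\<^esub> extend t \<xi> x) k = Zero V (fst x k) (fst (tr t y) k)"
      using k(1) extend_off[OF \<xi> xy(1) k(1) kH] homs_I_D(7-9)[OF am k(1)] o
      by (simp add: I_simps V.Cmp_Zero_right)
    show "cm (extend t \<xi> y \<cdot>\<^bsub>I\<^esub> \<alpha>) k = Zero V (fst x k) (fst (tr t y) k)"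
      using k(1) extend_off[OF \<xi> xy(2) k(1) kH] homs_I_D(7-9)[OF a k(1)] o
      by (simp add: I_simps V.Cmp_Zero_left)
  qed
  hence "cm (am t \<alpha> \<cdot>\<^bsub>I\<^esub> extend t \<xi> x) g = cm (extend t \<xi> y \<cdot>\<^bsub>I\<^esub> \<alpha>) g" by simp
  thus "cm \<alpha> (inv t \<otimes> g) \<bullet> cm (extend t \<xi> x) g = cm (extend t \<xi> y) g \<bullet> cm \<alpha> g"
    using g by (simp add: I_simps act_simps)
qed

lemma Tr_eq_extendI:
  assumes \<eta>: "\<eta> \<in> Tr t" and \<xi>: "\<xi> \<in> NT t"
    and one: "\<And>y. y \<in> objs \<Longrightarrow> cm (\<eta> y) \<one> = iv (snd y \<one> (inv t)) \<bullet> \<xi> (fst y \<one>)"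
    and off: "\<And>y g. \<lbrakk>y \<in> objs; g \<in> carrier G; g \<notin> H\<rbrakk> \<Longrightarrow> cm (\<eta> y) g = Zero V (fst y g) (fst (tr t y) g)"
  shows "\<eta> = extend t \<xi>"
proof (rule Tr_eqI[OF \<eta> extend_Tr[OF \<xi>]])
  fix y g assume y: "y \<in> objs" and g: "g \<in> carrier G"
  have "\<eta> y = extend t \<xi> y"
    by (rule coset_hom_eqI[OF Tr_homs[OF \<eta> y] extend_homs[OF \<xi> y] G.one_closed])
      (use one[OF y] extend_one[OF \<xi> y] off[OF y] extend_off[OF \<xi> y] in simp_all)
  thus "cm (\<eta> y) g = cm (extend t \<xi> y) g" by simp
qed

lemma trace_V_module: "module K (TV t)"
  by (rule V.cat_trace_module[OF act_cat_functor[OF t]])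

lemma trace_V_simps:
  "carrier (TV t) = NT t"
  "x \<in> Obj V \<Longrightarrow> (\<xi> \<oplus>\<^bsub>TV t\<^esub> \<xi>') x = Add V (\<xi> x) (\<xi>' x)"
  "x \<in> Obj V \<Longrightarrow> (c \<odot>\<^bsub>TV t\<^esub> \<xi>) x = Scal V c (\<xi> x)"
  "x \<in> Obj V \<Longrightarrow> \<zero>\<^bsub>TV t\<^esub> x = Zero V x (F t x)"
  by (simp_all add: cat_trace_def)

lemma trace_V_closed:
  shows "\<lbrakk>\<xi> \<in> NT t; \<xi>' \<in> NT t\<rbrakk> \<Longrightarrow> \<xi> \<oplus>\<^bsub>TV t\<^esub> \<xi>' \<in> NT t"
    and "\<lbrakk>c \<in> carrier K; \<xi> \<in> NT t\<rbrakk> \<Longrightarrow> c \<odot>\<^bsub>TV t\<^esub> \<xi> \<in> NT t"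
    and "\<zero>\<^bsub>TV t\<^esub> \<in> NT t"
proof -
  interpret T: module K "TV t" by (rule trace_V_module)
  show "\<lbrakk>\<xi> \<in> NT t; \<xi>' \<in> NT t\<rbrakk> \<Longrightarrow> \<xi> \<oplus>\<^bsub>TV t\<^esub> \<xi>' \<in> NT t"
    using T.M.a_closed[of \<xi> \<xi>'] by (simp only: trace_V_simps)
  show "\<lbrakk>c \<in> carrier K; \<xi> \<in> NT t\<rbrakk> \<Longrightarrow> c \<odot>\<^bsub>TV t\<^esub> \<xi> \<in> NT t"
    using T.smult_closed[of c \<xi>] by (simp only: trace_V_simps)
  show "\<zero>\<^bsub>TV t\<^esub> \<in> NT t"
    using T.M.zero_closed by (simp only: trace_V_simps)
qed

lemma V_Add_Zero: "\<lbrakk>x \<in> Obj V; y \<in> Obj V\<rbrakk> \<Longrightarrow> Add V (Zero V x y) (Zero V x y) = Zero V x y"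
  using abelian_monoid.l_zero[OF abelian_group.axioms(1)[OF module.axioms(2)[OF V.hom_space]], of x y "Zero V x y"]
    V.Zero_arr by (simp add: hom_space_def V.homs_arr)

lemma V_Scal_Zero: "\<lbrakk>c \<in> carrier K; x \<in> Obj V; y \<in> Obj V\<rbrakk> \<Longrightarrow> Scal V c (Zero V x y) = Zero V x y"
  using module.smult_r_null[OF V.hom_space, of x y c] by (simp add: hom_space_def)

lemma extend_linear: "extend t \<in> linear_maps K (TV t) (TI t)"
proof -
  have tG: "t \<in> carrier G" using t by simp
  have zero_Obj: "fst y g \<in> Obj V" "fst (tr t y) g \<in> Obj V" if "y \<in> objs" "g \<in> carrier G" for y g
    using obj_Obj[OF that] obj_Obj[OF tr_objs[OF tG that(1)] that(2)] by auto
  have "extend t (\<xi> \<oplus>\<^bsub>TV t\<^esub> \<xi>') = extend t \<xi> \<oplus>\<^bsub>TI t\<^esub> extend t \<xi>'"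
    if x: "\<xi> \<in> NT t" "\<xi>' \<in> NT t" for \<xi> \<xi>'
  proof (rule Tr_eq_extendI[symmetric, OF trace_I_closed(1)[OF tG extend_Tr[OF x(1)] extend_Tr[OF x(2)]] trace_V_closed(1)[OF x]])
    fix y assume y: "y \<in> objs"
    have f: "fst y \<one> \<in> Obj V" using obj_Obj[OF y] by simp
    have h: "iv (snd y \<one> (inv t)) \<in> homs V (F t (fst y \<one>)) (fst y (inv t))"
      "\<xi> (fst y \<one>) \<in> homs V (fst y \<one>) (F t (fst y \<one>))" "\<xi>' (fst y \<one>) \<in> homs V (fst y \<one>) (F t (fst y \<one>))"
      using V.iso_arr[OF unit_one[OF y]] NT_arr[OF x(1) f] NT_arr[OF x(2) f] by (simp_all add: V.homs_arr)
    show "cm ((extend t \<xi> \<oplus>\<^bsub>TI t\<^esub> extend t \<xi>') y) \<one>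
        = iv (snd y \<one> (inv t)) \<bullet> (\<xi> \<oplus>\<^bsub>TV t\<^esub> \<xi>') (fst y \<one>)"
      using V.Cmp_Add_right[OF h] x y f by (simp add: trace_I_simps trace_V_simps I_simps extend_one)
  qed (use x extend_off zero_Obj in \<open>simp add: trace_I_simps I_simps V_Add_Zero\<close>)
  moreover have "extend t (c \<odot>\<^bsub>TV t\<^esub> \<xi>) = c \<odot>\<^bsub>TI t\<^esub> extend t \<xi>"
    if c: "c \<in> carrier K" and x: "\<xi> \<in> NT t" for c \<xi>
  proof (rule Tr_eq_extendI[symmetric, OF trace_I_closed(2)[OF tG c extend_Tr[OF x]] trace_V_closed(2)[OF c x]])
    fix y assume y: "y \<in> objs"
    have f: "fst y \<one> \<in> Obj V" using obj_Obj[OF y] by simp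
    have h: "iv (snd y \<one> (inv t)) \<in> homs V (F t (fst y \<one>)) (fst y (inv t))"
      "\<xi> (fst y \<one>) \<in> homs V (fst y \<one>) (F t (fst y \<one>))"
      using V.iso_arr[OF unit_one[OF y]] NT_arr[OF x f] by (simp_all add: V.homs_arr)
    show "cm ((c \<odot>\<^bsub>TI t\<^esub> extend t \<xi>) y) \<one>
        = iv (snd y \<one> (inv t)) \<bullet> (c \<odot>\<^bsub>TV t\<^esub> \<xi>) (fst y \<one>)"
      using V.Cmp_Scal_right[OF h c] x y f by (simp add: trace_I_simps trace_V_simps I_simps extend_one)
  qed (use x c extend_off zero_Obj in \<open>simp add: trace_I_simps I_simps V_Scal_Zero\<close>)
  ultimately show ?thesis
    using extend_Tr by (simp add: linear_maps_def trace_I_simps trace_V_simps)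
qed

end

text \<open>Both sides vanish off \<open>H\<close>, so it suffices to compare them at \<open>1\<close>, where the conjugate of the
  extension has the component of \<open>extend t \<xi>\<close> at \<open>h\<^sup>-\<^sup>1\<close>, for the translated object. Compose with
  \<open>u\<close> at \<open>(1, ht\<^sup>-\<^sup>1h\<^sup>-\<^sup>1)\<close>: the cocycle identities express this isomorphism through \<open>u\<close> at \<open>(1, h)\<close>, \<open>(h, t\<^sup>-\<^sup>1)\<close>
  and \<open>(ht\<^sup>-\<^sup>1, h\<^sup>-\<^sup>1)\<close>, the third is absorbed by the compatibility of the extension with \<open>u\<close>, the second
  cancels, and naturality of \<open>\<xi>\<close> along \<open>u\<^bsub>1,h\<^esub> : f(h) \<rightarrow> \<rho>(h\<^sup>-\<^sup>1)f(1)\<close> turns \<open>\<xi>\<close> at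
  \<open>f(h)\<close> into \<open>\<xi>\<close> at \<open>\<rho>(h\<^sup>-\<^sup>1)f(1)\<close>, as in the definition of the conjugation map. The inverse coherence
  isomorphisms there come from the cocycle identity for \<open>hh\<^sup>-\<^sup>1 = 1\<close>.\<close>

lemma extend_equivariant:
  assumes t: "t \<in> H" and h: "h \<in> H" and \<xi>: "\<xi> \<in> NT t"
  shows "extend (h \<otimes> t \<otimes> inv h) (cV t h \<xi>) = cI t h (extend t \<xi>)"
proof -
  let ?s = "h \<otimes> t \<otimes> inv h"
  have G: "t \<in> carrier G" "h \<in> carrier G" and h': "inv h \<in> H" and t': "inv t \<in> H" and s: "?s \<in> H"
    and ht': "h \<otimes> inv t \<in> H"
    using t h by auto
  note e = extend_Tr[OF t \<xi>]
  have "cI t h (extend t \<xi>) = extend ?s (cV t h \<xi>)"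
  proof (rule Tr_eq_extendI[OF s conj_Tr[OF G e] cV_NT[OF t h \<xi>]])
    fix y g assume y: "y \<in> objs" and g: "g \<in> carrier G" "g \<notin> H"
    have "inv h \<otimes> g \<notin> H" using coset_factor[OF G(2) g(1)] g h by (metis H_closed(1))
    thus "cm (cI t h (extend t \<xi>) y) g = Zero V (fst y g) (fst (tr ?s y) g)"
      using G g y extend_off[OF t \<xi>, of "tr (inv h) y" "inv h \<otimes> g"]
      by (simp add: conj_cm e tr_objs tr_simps G.m_assoc[symmetric] G.inv_mult_group)
  next
    fix y assume y: "y \<in> objs"
    let ?w = "tr (inv h) y"
    let ?x = "fst y \<one>" and ?f = "fst y h" and ?u = "snd y"
    define c where "c = cm (extend t \<xi> ?w) (inv h)"
    have w: "?w \<in> objs" using G y by (simp add: tr_objs)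
    have x: "?x \<in> Obj V" and f: "?f \<in> Obj V" and Fx: "F (inv h) ?x \<in> Obj V"
      using obj_Obj[OF y] G h' by auto
    have g1: "h \<otimes> inv t \<in> carrier G" and g2: "inv h \<in> carrier G" using G by auto
    have u1h: "?u \<one> h \<in> Arr V" "Dom V (?u \<one> h) = ?f" "Cod V (?u \<one> h) = F (inv h) ?x"
      using obj_arr[OF y G.one_closed h] G by simp_all
    have iht: "?u h (inv t) \<in> isos V (fst y (h \<otimes> inv t)) (F t ?f)" using obj_iso[OF y G(2) t'] G by simp
    note uht = V.iso_arr[OF iht]
    have uhh: "?u h (inv h) \<in> Arr V" "Dom V (?u h (inv h)) = ?x" "Cod V (?u h (inv h)) = F h ?f"
      using obj_arr[OF y G(2) h'] G by simp_all
    have uhth: "?u (h \<otimes> inv t) (inv h) \<in> Arr V" "Dom V (?u (h \<otimes> inv t) (inv h)) = fst y (h \<otimes> inv t \<otimes> inv h)"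
      "Cod V (?u (h \<otimes> inv t) (inv h)) = F h (fst y (h \<otimes> inv t))"
      using obj_arr[OF y g1 h'] G by simp_all
    have inv_s: "inv ?s = h \<otimes> inv t \<otimes> inv h" using G by (simp add: G.inv_mult_group G.m_assoc)
    have iU: "?u \<one> (h \<otimes> inv t \<otimes> inv h) \<in> isos V (fst y (h \<otimes> inv t \<otimes> inv h)) (F ?s ?x)"
      using unit_one[OF s y] by (simp add: inv_s)
    note U = V.iso_arr[OF iU]
    note xf = NT_arr[OF \<xi> f] and xF = NT_arr[OF \<xi> Fx]
    have c: "c \<in> Arr V" "Dom V c = ?x" "Cod V c = fst y (h \<otimes> inv t \<otimes> inv h)"
      using homs_I_D(7-9)[OF extend_homs[OF t \<xi> w] g2] G
      by (simp_all add: c_def tr_simps tr_objs y G.m_assoc)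
    \<comment> \<open>Compatibility of \<open>extend t \<xi>\<close> with \<open>u\<close> at the translated object determines \<open>c\<close>.\<close>
    have c_eq: "?u (h \<otimes> inv t) (inv h) \<bullet> c = M h (iv (?u h (inv t)) \<bullet> \<xi> ?f) \<bullet> ?u h (inv h)"
      using homs_I_D(10)[OF extend_homs[OF t \<xi> w] G.one_closed h'] G h h' t' y
      by (simp add: c_def tr_simps extend_one[OF t \<xi> w])
    \<comment> \<open>Three instances of the cocycle identity: for \<open>(ht\<^sup>-\<^sup>1)h\<^sup>-\<^sup>1\<close>, for \<open>ht\<^sup>-\<^sup>1\<close>, and for \<open>hh\<^sup>-\<^sup>1 = 1\<close>.\<close>
    have m1: "?u \<one> (h \<otimes> inv t \<otimes> inv h) =
        \<mu> h (t \<otimes> inv h) ?x \<bullet> M h (?u \<one> (h \<otimes> inv t)) \<bullet> ?u (h \<otimes> inv t) (inv h)"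
      using obj_mult[OF y G.one_closed ht' h'] G by (simp add: G.inv_mult_group)
    have m2: "?u \<one> (h \<otimes> inv t) = \<mu> t (inv h) ?x \<bullet> M t (?u \<one> h) \<bullet> ?u h (inv t)"
      using obj_mult[OF y G.one_closed h t'] G by simp
    have m3: "iv (\<epsilon> ?x) = \<mu> h (inv h) ?x \<bullet> M h (?u \<one> h) \<bullet> ?u h (inv h)"
      using obj_mult[OF y G.one_closed h h'] obj_one[OF y G.one_closed] G by simp
    have "M h (?u \<one> h) \<bullet> ?u h (inv h) = iv (\<mu> h (inv h) ?x) \<bullet> iv (\<epsilon> ?x)"
      unfolding m3 by (rule V.iso_Cmp_inverse(1)[OF \<mu>_iso[OF h h' x], symmetric]) (use u1h uhh h in simp_all)
    hence conj: "cV t h \<xi> ?x = coherence h t ?x \<bullet> M h (\<xi> (F (inv h) ?x)) \<bullet> M h (?u \<one> h) \<bullet> ?u h (inv h)"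
      by (simp add: cV_app[OF h x])
    have th: "t \<otimes> inv h \<in> H" using t h by auto
    have "?u \<one> (h \<otimes> inv t \<otimes> inv h) \<bullet> c
        = \<mu> h (t \<otimes> inv h) ?x \<bullet> M h (?u \<one> (h \<otimes> inv t)) \<bullet> (?u (h \<otimes> inv t) (inv h) \<bullet> c)"
      unfolding m1 using c uhth h t h' x th u1h uht(1-3)
      by (simp add: assoc m2 G.m_assoc[symmetric] G)
    also have "\<dots> = \<mu> h (t \<otimes> inv h) ?x \<bullet> M h (\<mu> t (inv h) ?x) \<bullet> M h (M t (?u \<one> h)) \<bullet>
        (M h (?u h (inv t)) \<bullet> M h (iv (?u h (inv t)))) \<bullet> M h (\<xi> ?f) \<bullet> ?u h (inv h)"
      unfolding c_eq m2 using h t h' x u1h uht(1-6) uhh xf by (simp add: assoc M_Cmp)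
    also have "M h (?u h (inv t)) \<bullet> M h (iv (?u h (inv t))) = Ide V (F h (F t ?f))"
      using uht h t f by (simp add: M_Cmp[symmetric] M_Ide)
    also have "Ide V (F h (F t ?f)) \<bullet> M h (\<xi> ?f) \<bullet> ?u h (inv h) = M h (\<xi> ?f) \<bullet> ?u h (inv h)"
      by (rule V.Ide_left_arr) (use xf uhh h in simp_all)
    also have "\<mu> h (t \<otimes> inv h) ?x \<bullet> M h (\<mu> t (inv h) ?x) \<bullet> M h (M t (?u \<one> h)) \<bullet> M h (\<xi> ?f) \<bullet> ?u h (inv h)
        = (\<mu> h (t \<otimes> inv h) ?x \<bullet> M h (\<mu> t (inv h) ?x)) \<bullet> M h (M t (?u \<one> h) \<bullet> \<xi> ?f) \<bullet> ?u h (inv h)"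
      using h t h' x th u1h uhh xf by (simp add: assoc M_Cmp)
    also have "\<mu> h (t \<otimes> inv h) ?x \<bullet> M h (\<mu> t (inv h) ?x) = coherence h t ?x"
      unfolding coherence_def by (rule \<mu>_assoc[OF h t h' x, symmetric])
    also have "M t (?u \<one> h) \<bullet> \<xi> ?f = \<xi> (F (inv h) ?x) \<bullet> ?u \<one> h"
      using NT_nat[OF \<xi> u1h(1)] u1h by simp
    also have "coherence h t ?x \<bullet> M h (\<xi> (F (inv h) ?x) \<bullet> ?u \<one> h) \<bullet> ?u h (inv h) = cV t h \<xi> ?x"
      unfolding conj using h u1h uhh xF by (simp add: assoc M_Cmp)
    finally have Uc: "?u \<one> (h \<otimes> inv t \<otimes> inv h) \<bullet> c = cV t h \<xi> ?x" .
    have "cm (cI t h (extend t \<xi>) y) \<one> = c"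
      using G y e by (simp add: conj_cm c_def)
    also have "c = iv (?u \<one> (inv ?s)) \<bullet> cV t h \<xi> ?x"
      unfolding inv_s Uc[symmetric] by (rule V.iso_Cmp_inverse(1)[OF iU c(1,3), symmetric])
    finally show "cm (cI t h (extend t \<xi>) y) \<one> = iv (snd y \<one> (inv ?s)) \<bullet> cV t h \<xi> (fst y \<one>)" .
  qed
  thus ?thesis ..
qed

text \<open>At \<open>r\<close>, the translate by \<open>r\<close> of the extension is \<open>\<xi>\<close> at \<open>\<rho>(1)x\<close> followed by the inverse of \<open>u\<close>. The two
  isomorphisms \<open>u\<close> cancel, and \<open>\<rho>(1)x\<close> is replaced by \<open>x\<close> by naturality of \<open>\<xi>\<close> along \<open>\<phi>\<^sub>1\<close>.\<close>

lemma component_extend_same: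
  assumes r: "r \<in> carrier G" and t: "t \<in> H" and \<xi>: "\<xi> \<in> NT t"
  shows "component r t (cI t r (extend t \<xi>)) = \<xi>"
proof (rule extensionalityI)
  have tG: "t \<in> carrier G" using t by simp
  note e = extend_Tr[OF t \<xi>]
  show "component r t (cI t r (extend t \<xi>)) \<in> extensional (Obj V)" by (simp add: component_def)
  show "\<xi> \<in> extensional (Obj V)" by (rule NT_ext[OF \<xi>])
  fix x assume x: "x \<in> Obj V"
  let ?z = "free r x"
  have z: "?z \<in> objs" by (rule free_objs[OF r x])
  have iu: "snd ?z r (inv t) \<in> isos V (fst ?z (r \<otimes> inv t)) (F t (F \<one> x))"
    using obj_iso[OF z r, of "inv t"] t free_base[OF r, of x] by simp
  have F1: "F \<one> x \<in> Obj V" using x by simp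
  note u = V.iso_arr[OF iu] and \<epsilon>i = V.iso_arr[OF \<epsilon>_iso[OF x]] and xi = NT_arr[OF \<xi> F1] NT_arr[OF \<xi> x]
  have "cm (cI t r (extend t \<xi>) ?z) r = cm (extend t \<xi> (tr (inv r) ?z)) \<one>"
    using r tG e z by (simp add: conj_cm)
  also have "\<dots> = iv (snd ?z r (inv t)) \<bullet> \<xi> (F \<one> x)"
    using r t z free_base[OF r, of x] by (simp add: extend_one[OF t \<xi>] tr_objs tr_simps)
  finally have "component r t (cI t r (extend t \<xi>)) x
      = M t (\<epsilon> x) \<bullet> snd ?z r (inv t) \<bullet> (iv (snd ?z r (inv t)) \<bullet> \<xi> (F \<one> x)) \<bullet> iv (\<epsilon> x)"
    using x by (simp add: component_def)
  also have "\<dots> = M t (\<epsilon> x) \<bullet> (snd ?z r (inv t) \<bullet> (iv (snd ?z r (inv t)) \<bullet> \<xi> (F \<one> x))) \<bullet> iv (\<epsilon> x)"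
    using u(1-6) \<epsilon>i(1-6) xi by (simp add: assoc)
  also have "\<dots> = M t (\<epsilon> x) \<bullet> \<xi> (F \<one> x) \<bullet> iv (\<epsilon> x)"
    using V.iso_Cmp_inverse(2)[OF iu xi(1,3)] by simp
  also have "\<dots> = (M t (\<epsilon> x) \<bullet> \<xi> (F \<one> x)) \<bullet> iv (\<epsilon> x)"
    using \<epsilon>i(1-6) xi x t by (simp add: assoc)
  also have "\<dots> = \<xi> x \<bullet> (\<epsilon> x \<bullet> iv (\<epsilon> x))"
    using NT_nat[OF \<xi> \<epsilon>_arr(1)[OF x]] \<epsilon>i(1-6) xi x by (simp add: assoc)
  also have "\<dots> = \<xi> x" using \<epsilon>i(8) xi by (simp add: V.Ide_right_arr)
  finally show "component r t (cI t r (extend t \<xi>)) x = \<xi> x" .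
qed

lemma component_zero:
  assumes r: "r \<in> carrier G" and t: "t \<in> H" and x: "x \<in> Obj V"
    and z: "cm (\<eta> (free r x)) r = Zero V (F \<one> x) (fst (free r x) (r \<otimes> inv t))"
  shows "component r t \<eta> x = Zero V x (F t x)"
proof -
  have o: "free r x \<in> objs" by (rule free_objs[OF r x])
  have iu: "snd (free r x) r (inv t) \<in> isos V (fst (free r x) (r \<otimes> inv t)) (F t (F \<one> x))"
    using obj_iso[OF o r, of "inv t"] t free_base[OF r, of x] by simp
  have "fst (free r x) (r \<otimes> inv t) \<in> Obj V" using obj_Obj[OF o] r t by simp
  thus ?thesis
    using x t V.iso_arr(1-6)[OF iu] V.iso_arr(1-6)[OF \<epsilon>_iso[OF x]]
    by (simp add: component_def z V.Cmp_Zero_left V.Cmp_Zero_right)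
qed

lemma component_extend_other:
  assumes r: "r \<in> carrier G" and t: "t \<in> H" and r': "r' \<in> carrier G" and t': "t' \<in> H"
    and n: "inv r' \<otimes> r \<notin> H" and s: "r \<otimes> t \<otimes> inv r = r' \<otimes> t' \<otimes> inv r'" and \<xi>: "\<xi> \<in> NT t'" and x: "x \<in> Obj V"
  shows "component r t (cI t' r' (extend t' \<xi>)) x = Zero V x (F t x)"
proof (rule component_zero[OF r t x])
  have tG: "t' \<in> carrier G" using t' by simp
  let ?z = "free r x"
  have z: "?z \<in> objs" "tr (inv r') ?z \<in> objs" using free_objs[OF r x] r' by (auto intro: tr_objs)
  have e: "inv r' \<otimes> r \<in> carrier G" using r r' by simp
  have "r' \<otimes> (inv t' \<otimes> (inv r' \<otimes> r)) = inv (r' \<otimes> t' \<otimes> inv r') \<otimes> r"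
    using r r' tG by (simp add: G.inv_mult_group G.m_assoc)
  also have "\<dots> = r \<otimes> inv t" by (rule translate_at(2)[OF r t s[symmetric]])
  finally have "r' \<otimes> (inv t' \<otimes> (inv r' \<otimes> r)) = r \<otimes> inv t" .
  thus "cm (cI t' r' (extend t' \<xi>) ?z) r = Zero V (F \<one> x) (fst ?z (r \<otimes> inv t))"
    using extend_off[OF t' \<xi> z(2) e n] r r' tG z free_base[OF r, of x]
    by (simp add: conj_cm extend_Tr[OF t' \<xi>] tr_simps coset_factor)
qed

lemma component_add:
  assumes r: "r \<in> carrier G" and t: "t \<in> H" and s: "s = r \<otimes> t \<otimes> inv r" and e: "\<eta> \<in> Tr s" "\<theta> \<in> Tr s"
  shows "component r t (\<eta> \<oplus>\<^bsub>TI s\<^esub> \<theta>) =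
    component r t \<eta> \<oplus>\<^bsub>TV t\<^esub> component r t \<theta>"
proof (rule extensionalityI[of _ "Obj V"])
  show "component r t \<eta> \<oplus>\<^bsub>TV t\<^esub> component r t \<theta> \<in> extensional (Obj V)"
    by (simp add: cat_trace_def)
  fix x assume x: "x \<in> Obj V"
  let ?z = "free r x"
  have z: "?z \<in> objs" by (rule free_objs[OF r x])
  have h: "M t (\<epsilon> x) \<bullet> snd ?z r (inv t) \<in> homs V (fst ?z (r \<otimes> inv t)) (F t x)"
    "iv (\<epsilon> x) \<in> homs V x (fst ?z r)"
    "cm (\<eta> ?z) r \<in> homs V (fst ?z r) (fst ?z (r \<otimes> inv t))" "cm (\<theta> ?z) r \<in> homs V (fst ?z r) (fst ?z (r \<otimes> inv t))"
    using x t V.iso_arr[OF unit_at[OF r t s e(1) z]] V.iso_arr[OF \<epsilon>_iso[OF x]] free_base[OF r, of x]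
      Tr_at[OF r t s e(1) z] Tr_at[OF r t s e(2) z]
    by (simp_all add: V.homs_arr)
  let ?c = "M t (\<epsilon> x) \<bullet> snd ?z r (inv t)"
  have comp: "component r t \<zeta> x = (?c \<bullet> a) \<bullet> iv (\<epsilon> x)"
    if "cm (\<zeta> ?z) r = a" "a \<in> homs V (fst ?z r) (fst ?z (r \<otimes> inv t))" for \<zeta> a
    using that x t h(2) V.iso_arr(1-3)[OF unit_at[OF r t s e(1) z]] free_base[OF r, of x]
    by (simp add: component_def assoc V.homs_arr)
  have "component r t (\<eta> \<oplus>\<^bsub>TI s\<^esub> \<theta>) x = (?c \<bullet> Add V (cm (\<eta> ?z) r) (cm (\<theta> ?z) r)) \<bullet> iv (\<epsilon> x)"
    by (rule comp) (use z r V.Add_closed[OF h(3,4)] in \<open>simp_all add: trace_I_simps I_simps\<close>)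
  also have "\<dots> = Add V ((?c \<bullet> cm (\<eta> ?z) r) \<bullet> iv (\<epsilon> x)) ((?c \<bullet> cm (\<theta> ?z) r) \<bullet> iv (\<epsilon> x))"
    unfolding V.Cmp_Add_right[OF h(1,3,4)]
    by (rule V.Cmp_Add_left[OF h(2) V.Cmp_closed[OF h(3,1)] V.Cmp_closed[OF h(4,1)]])
  also have "\<dots> = Add V (component r t \<eta> x) (component r t \<theta> x)"
    by (simp only: comp[of \<eta>, OF refl h(3)] comp[of \<theta>, OF refl h(4)])
  finally show "component r t (\<eta> \<oplus>\<^bsub>TI s\<^esub> \<theta>) x =
      (component r t \<eta> \<oplus>\<^bsub>TV t\<^esub> component r t \<theta>) x"
    using x by (simp add: trace_V_simps[OF t])
qed (simp add: component_def)

end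

section \<open>Comparison with the induced representation\<close>

context induction_setting
begin

abbreviation "\<Lambda>H \<equiv> inertia (G\<lparr>carrier := H\<rparr>)"
abbreviation "\<chi> \<equiv> cat_character (G\<lparr>carrier := H\<rparr>) V \<rho>"

text \<open>One arrow \<open>r : r\<^sup>-\<^sup>1sr \<rightarrow> s\<close> of the inertia groupoid for each coset \<open>rH\<close> fixed by \<open>s\<close>.\<close>

definition fixed_cosets :: "'g \<Rightarrow> ('g \<times> 'g) set" where
  "fixed_cosets s = {(inv r \<otimes> s \<otimes> r, r) |r. r \<in> transversal \<and> inv r \<otimes> s \<otimes> r \<in> H}"

lemma character_V:
  "space \<chi> t = TV t" "rmap \<chi> p = cV (fst p) (snd p)"
  by (simp_all add: cat_character_def split_beta)

lemma inertia_H_simps: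
  "Obj \<Lambda>H = H" "Arr \<Lambda>H = H \<times> H"
  "Dom \<Lambda>H p = fst p" "Ide \<Lambda>H u = (u, \<one>)"
  "p \<in> H \<times> H \<Longrightarrow> Cod \<Lambda>H p = snd p \<otimes> fst p \<otimes> inv (snd p)"
  by (auto simp: inertia_simps inv_H)

lemma fixed_cosetsD:
  assumes "s \<in> carrier G" "p \<in> fixed_cosets s"
  shows "snd p \<in> transversal" "snd p \<in> carrier G" "fst p \<in> H" "s = snd p \<otimes> fst p \<otimes> inv (snd p)"
    "p = (fst p, snd p)" "fst p = inv (snd p) \<otimes> s \<otimes> snd p"
  using assms transversal(1) conj_back[OF _ assms(1)] by (auto simp: fixed_cosets_def)

text \<open>The factorization of an arrow \<open>k : t \<rightarrow> s\<close> with \<open>t\<close> in \<open>H\<close> is \<open>k = rh\<close> with \<open>r\<close> the representative of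
  \<open>kH\<close>; then \<open>r\<^sup>-\<^sup>1sr = hth\<^sup>-\<^sup>1\<close> lies in \<open>H\<close>, so \<open>s\<close> fixes \<open>rH\<close>.\<close>

lemma induction_data_character:
  "induction_data K (inertia G) \<Lambda>H \<chi>I \<chi>
     extend fixed_cosets (\<lambda>p. component (snd p) (fst p))"
proof (intro induction_data.intro character_I_representation induction_data_axioms.intro)
  have groupH: "group (G\<lparr>carrier := H\<rparr>)" by (rule subgroup.subgroup_is_group[OF subgroup_H group_G])
  show "category \<Lambda>H" by (rule group.inertia_category[OF groupH])
  show "finite (Arr (inertia G))" by (simp add: inertia_simps finite_G)
  show "Obj \<Lambda>H \<subseteq> Obj (inertia G)" "Arr \<Lambda>H \<subseteq> Arr (inertia G)"
    unfolding inertia_H_simps by (auto simp: inertia_simps)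
  show "Dom \<Lambda>H d = Dom (inertia G) d" for d by (simp add: inertia_simps)
  show "Cod \<Lambda>H d = Cod (inertia G) d"
    if "d \<in> Arr \<Lambda>H" for d
    using inertia_H_simps(5)[OF that[unfolded inertia_H_simps(2)]] by (simp add: inertia_simps)
  show "Ide \<Lambda>H t = Ide (inertia G) t" for t by (simp add: inertia_simps)
  show "module K (space \<chi> t)" if "t \<in> Obj \<Lambda>H" for t
    using that unfolding character_V inertia_H_simps by (rule trace_V_module)
  show "rmap \<chi> d \<xi> \<in> carrier (space \<chi> (Cod (inertia G) d))"
    if "d \<in> Arr \<Lambda>H" "\<xi> \<in> carrier (space \<chi> (Dom (inertia G) d))" for d \<xi>
    using that cV_NT[of "fst d" "snd d" \<xi>]
    unfolding inertia_H_simps character_V inertia_simps by (auto simp: trace_V_simps)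
  show "extend t \<in> linear_maps K (space \<chi> t) (space \<chi>I t)"
    if "t \<in> Obj \<Lambda>H" for t
    using that unfolding character_V character_I inertia_H_simps by (rule extend_linear)
  show "inj_on (extend t) (carrier (space \<chi> t))" if "t \<in> Obj \<Lambda>H" for t
  proof (rule inj_on_inverseI[where g = "\<lambda>\<eta>. component \<one> t (cI t \<one> \<eta>)"])
    fix \<xi> assume "\<xi> \<in> carrier (space \<chi> t)"
    thus "component \<one> t (cI t \<one> (extend t \<xi>)) = \<xi>"
      using that component_extend_same[OF G.one_closed] by (simp add: character_V trace_V_simps inertia_H_simps(1))
  qed
  show "extend (Cod (inertia G) d) (rmap \<chi> d \<xi>) = rmap \<chi>I d (extend (Dom (inertia G) d) \<xi>)"
    if "d \<in> Arr \<Lambda>H" "\<xi> \<in> carrier (space \<chi> (Dom (inertia G) d))" for d \<xi>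
    using that extend_equivariant[of "fst d" "snd d" \<xi>]
    unfolding inertia_H_simps character_V character_I inertia_simps by (auto simp: trace_V_simps)
  show "p \<in> Arr (inertia G) \<and> Cod (inertia G) p = s \<and> Dom (inertia G) p \<in> Obj \<Lambda>H"
    if "s \<in> Obj (inertia G)" "p \<in> fixed_cosets s" for s p
  proof -
    note p = fixed_cosetsD[OF that(1)[unfolded inertia_simps] that(2)]
    have "p \<in> carrier G \<times> carrier G" using p(2,3) p(5) by (metis H_G SigmaI)
    thus ?thesis using p(3) p(4)[symmetric] by (simp add: inertia_simps inertia_H_simps(1))
  qed
  show "\<exists>p\<in>fixed_cosets (Cod (inertia G) g). \<exists>d\<in>Arr \<Lambda>H.
      Cod (inertia G) d = Dom (inertia G) p \<and> p \<cdot>\<^bsub>inertia G\<^esub> d = g"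
    if g: "g \<in> Arr (inertia G)" "Dom (inertia G) g \<in> Obj \<Lambda>H" for g
  proof -
    obtain t k where tk: "g = (t, k)" "t \<in> H" "k \<in> carrier G"
      using g unfolding inertia_H_simps inertia_simps by (cases g) auto
    have tG: "t \<in> carrier G" using tk by simp
    obtain r where r: "r \<in> transversal" "inv r \<otimes> k \<in> H" using transversal(2)[OF tk(3)] by blast
    have rG: "r \<in> carrier G" using r transversal(1) by blast
    define h where "h = inv r \<otimes> k"
    have h: "h \<in> H" "r \<otimes> h = k" using r coset_factor[OF rG tk(3)] by (simp_all add: h_def)
    have conj: "inv r \<otimes> (k \<otimes> t \<otimes> inv k) \<otimes> r = h \<otimes> t \<otimes> inv h"
      using rG tk(3) tG by (simp add: h_def G.inv_mult_group G.m_assoc)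
    have "h \<otimes> t \<otimes> inv h \<in> H" using h tk by blast
    hence "(h \<otimes> t \<otimes> inv h, r) \<in> fixed_cosets (k \<otimes> t \<otimes> inv k)"
      unfolding fixed_cosets_def conj[symmetric] using r by blast
    moreover have "(t, h) \<in> Arr \<Lambda>H" using h tk by (simp add: inertia_H_simps(2))
    ultimately show ?thesis
      by (intro bexI[of _ "(h \<otimes> t \<otimes> inv h, r)"] bexI[of _ "(t, h)"]) (simp_all add: tk(1) inertia_simps h)
  qed
  show "component (snd p) (fst p) \<eta> \<in> carrier (space \<chi> (Dom (inertia G) p))"
    if "s \<in> Obj (inertia G)" "p \<in> fixed_cosets s" "\<eta> \<in> carrier (space \<chi>I s)" for s p \<eta>
  proof -
    note p = fixed_cosetsD[OF that(1)[unfolded inertia_simps] that(2)]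
    show ?thesis using component_NT[OF p(2-4)] that(3)
      by (simp add: character_V character_I trace_I_simps trace_V_simps[OF p(3)] inertia_simps)
  qed
  show "component (snd p) (fst p) (\<eta> \<oplus>\<^bsub>space \<chi>I s\<^esub> \<theta>) =
      component (snd p) (fst p) \<eta> \<oplus>\<^bsub>space \<chi> (Dom (inertia G) p)\<^esub> component (snd p) (fst p) \<theta>"
    if "s \<in> Obj (inertia G)" "p \<in> fixed_cosets s" "\<eta> \<in> carrier (space \<chi>I s)"
      "\<theta> \<in> carrier (space \<chi>I s)" for s p \<eta> \<theta>
  proof -
    note p = fixed_cosetsD[OF that(1)[unfolded inertia_simps] that(2)]
    show ?thesis using component_add[OF p(2-4)] that(3,4)
      by (simp add: character_V character_I trace_I_simps inertia_simps)
  qed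
  show "component (snd p) (fst p) (rmap \<chi>I p (extend (Dom (inertia G) p) \<xi>)) = \<xi>"
    if "s \<in> Obj (inertia G)" "p \<in> fixed_cosets s" "\<xi> \<in> carrier (space \<chi> (Dom (inertia G) p))" for s p \<xi>
  proof -
    note p = fixed_cosetsD[OF that(1)[unfolded inertia_simps] that(2)]
    show ?thesis using component_extend_same[OF p(2,3)] that(3)
      by (simp add: character_V character_I trace_V_simps[OF p(3)] inertia_simps)
  qed
  show "component (snd p) (fst p) (rmap \<chi>I p' (extend (Dom (inertia G) p') \<xi>)) =
      \<zero>\<^bsub>space \<chi> (Dom (inertia G) p)\<^esub>"
    if "s \<in> Obj (inertia G)" "p \<in> fixed_cosets s" "p' \<in> fixed_cosets s" "p \<noteq> p'"
      "\<xi> \<in> carrier (space \<chi> (Dom (inertia G) p'))" for s p p' \<xi>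
  proof -
    note p = fixed_cosetsD[OF that(1)[unfolded inertia_simps] that(2)]
    note p' = fixed_cosetsD[OF that(1)[unfolded inertia_simps] that(3)]
    have n: "inv (snd p') \<otimes> snd p \<notin> H"
      using transversal(3)[OF p'(1) p(1)] that(4) p(5,6) p'(5,6) by metis
    have \<xi>: "\<xi> \<in> NT (fst p')" using that(5) by (simp add: character_V trace_V_simps[OF p'(3)] inertia_simps)
    have e: "snd p \<otimes> fst p \<otimes> inv (snd p) = snd p' \<otimes> fst p' \<otimes> inv (snd p')" using p(4) p'(4) by simp
    have "component (snd p) (fst p) (cI (fst p') (snd p') (extend (fst p') \<xi>)) =
        \<zero>\<^bsub>TV (fst p)\<^esub>"
    proof (rule extensionalityI[of _ "Obj V"])
      show "component (snd p) (fst p) (cI (fst p') (snd p') (extend (fst p') \<xi>)) x =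
          \<zero>\<^bsub>TV (fst p)\<^esub> x" if "x \<in> Obj V" for x
        using that by (simp only: component_extend_other[OF p(2,3) p'(2,3) n e \<xi>] trace_V_simps(4)[OF p(3)])
    qed (simp_all add: component_def cat_trace_def)
    thus ?thesis by (simp add: character_V character_I inertia_simps)
  qed
  show "\<eta> = \<zero>\<^bsub>space \<chi>I s\<^esub>"
    if s: "s \<in> Obj (inertia G)" and e: "\<eta> \<in> carrier (space \<chi>I s)"
      and z: "\<And>p. p \<in> fixed_cosets s \<Longrightarrow> component (snd p) (fst p) \<eta> = \<zero>\<^bsub>space \<chi> (Dom (inertia G) p)\<^esub>" for s \<eta>
    unfolding character_I
  proof (rule Tr_zeroI)
    show "\<eta> \<in> Tr s" "s \<in> carrier G" using s e by (simp_all add: character_I trace_I_simps inertia_simps)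
    fix r x assume r: "r \<in> transversal" and H: "inv r \<otimes> s \<otimes> r \<in> H" and x: "x \<in> Obj V"
    have "(inv r \<otimes> s \<otimes> r, r) \<in> fixed_cosets s" using r H by (auto simp: fixed_cosets_def)
    from z[OF this] show "component r (inv r \<otimes> s \<otimes> r) \<eta> x = Zero V x (F (inv r \<otimes> s \<otimes> r) x)"
      by (simp add: character_V inertia_simps trace_V_simps(4)[OF H x])
  qed
qed

end

theorem theorem7p5:
  fixes K :: "'k ring" and G :: "'g monoid" and H :: "'g set"
    and V :: "('o, 'a, 'k) linear_category" and \<rho> :: "('g, 'o, 'a) action"
  assumes "field K" and "char_zero K" and "contains_roots_of_unity K"
    and "group G" and "finite (carrier G)" and "subgroup H G"
    and "linear_category K V"
    and "linear_action K (G\<lparr>carrier := H\<rparr>) V \<rho>"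
  shows "isomorphic_representations K (inertia G)
           (cat_character G (ind_category G H V \<rho>) (ind_action G H V \<rho>))
           (induced_representation K (inertia (G\<lparr>carrier := H\<rparr>)) (inertia G)
              (cat_character (G\<lparr>carrier := H\<rparr>) V \<rho>))"
proof -
  have "induction_setting K G H V \<rho>"
    using assms by (simp add: induction_setting_def)
  thus ?thesis
    by (rule induction_data.isomorphic_induced[OF induction_setting.induction_data_character])
qed

end
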